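(* Let $n\in\{3,4,6\}$. Let $\mathcal{G}_n$ be the family of all composed-polarity quotient graphs $\overline{P(\mathbb{G}_n(q,q)\odot\mathbb{G}_n(r,r))}$, where $\mathbb{G}_n(q,q)$ and $\mathbb{G}_n(r,r)$ range over incidence graphs of generalized $n$-gons, with $q$ and $r$ such that $\mathbb{G}_n(q,q)$ and $\mathbb{G}_n(r,r)$ admit non-rotation polarities $\rho_q$ and $\rho_r$, and $P$ is the quotient with respect to the composed polarity $(\rho_q,\rho_r)$. Then $\mathcal{G}_n$ is an infinite family of graphs of diameter $n-1$, covering degrees $(q+1)(r+1)$ (the graph built from $q$ and $r$ has degree $(q+1)(r+1)$), whose orders asymptotically approach the Moore bound as both $q$ and $r\to\infty$; that is, the ratio of the order of the graph to $\mathrm{MB}((q+1)(r+1),\,n-1)$ tends to $1$ as both $q\to\infty$ and $r\to\infty$ through admissible values.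
   Context: Graphs are undirected, without multi-edges; self-loops are allowed. The degree of a graph is the maximum of its vertex degrees. $\overline{G}$ denotes the graph $G$ with all self-loops deleted (after the whole construction under the bar is complete). Moore bound: $\mathrm{MB}(\Delta,D)=1+\Delta\sum_{i=0}^{D-1}(\Delta-1)^i$. Generalized polygons: a generalized $n$-gon is a point-line geometry whose bipartite point-line incidence graph has diameter $n$ and girth $2n$. It has order $(s,t)$ if every line is incident with $s+1$ points and every point with $t+1$ lines. $\mathbb{G}_n(q,q)$ ($q\ge1$) denotes the incidence graph (parts: points and lines) of a generalized $n$-gon of order $(q,q)$. The case $q=1$ (thin) is allowed: then $\mathbb{G}_n(1,1)$ is the cycle $C_{2n}$. Polarity: for a bipartite graph $\mathbb{G}$ with parts $A,B$, a polarity is a graph automorphism $\rho$ that is an involution with $\rho(A)=B$, $\rho(B)=A$. The rotation polarity is the rotation of $C_{2n}=\mathbb{G}_n(1,1)$ by $\pi$ radians when $n$ is odd; every other polarity of a generalized polygon is a non-rotation polarity. A value $q$ is admissible if some $\mathbb{G}_n(q,q)$ admitting a non-rotation polarity exists. Polarity quotient: $P(\mathbb{G})$ has as vertices the orbits $[v]=\{v,\rho(v)\}$, with $[v],[w]$ adjacent whenever some $v'\in[v]$, $w'\in[w]$ are adjacent in $\mathbb{G}$; multi-edges are merged, self-loops are retained. Kronecker product: $H\otimes K$ has vertex set $V(H)\times V(K)$, with $((h_1,k_1),(h_2,k_2))$ an edge if and only if $(h_1,h_2)\in E(H)$ and $(k_1,k_2)\in E(K)$. If $\mathbb{H},\mathbb{K}$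 are connected bipartite graphs with parts $A_H,B_H$ and $A_K,B_K$ that admit polarities $\rho_H,\rho_K$, then $\mathbb{H}\otimes\mathbb{K}$ has two isomorphic components, with vertex sets $(A_H\times A_K)\cup(B_H\times B_K)$ and $(A_H\times B_K)\cup(B_H\times A_K)$; $\mathbb{H}\odot\mathbb{K}$ denotes one of them, and the composed polarity on it is $\rho((h,k))=(\rho_H(h),\rho_K(k))$. *)

theory Defs
  imports Complex_Main "HOL-Library.Extended_Nat"
begin

section \<open>Graphs\<close>

text \<open>
  An undirected graph without multi-edges, possibly with self-loops, is given by its vertex set and
  a symmetric set of ordered pairs of vertices; a pair \<open>(v, v)\<close> is a self-loop at \<open>v\<close>.
\<close>

record 'v graph =
  verts :: "'v set"
  edges :: "('v \<times> 'v) set"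

text \<open>A bipartite graph together with its two (ordered) parts.\<close>

record 'v bigraph = "'v graph" +
  part1 :: "'v set"
  part2 :: "'v set"

definition order :: "('v, 'z) graph_scheme \<Rightarrow> nat" where
  "order G = card (verts G)"

definition vertex_degree :: "('v, 'z) graph_scheme \<Rightarrow> 'v \<Rightarrow> nat" where
  "vertex_degree G v = card {w \<in> verts G. (v, w) \<in> edges G}"

definition degree :: "('v, 'z) graph_scheme \<Rightarrow> nat" where
  "degree G = Max (vertex_degree G ` verts G)"

text \<open>
  \<open>(u, v) \<in> edges G ^^ k\<close> says that there is a walk of length \<open>k\<close> from \<open>u\<close> to \<open>v\<close>. The distance of
  vertices in different components, and hence the diameter of a disconnected graph, is \<open>\<infinity>\<close>.
\<close>

definition distance :: "('v, 'z) graph_scheme \<Rightarrow> 'v \<Rightarrow> 'v \<Rightarrow> enat" where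
  "distance G u v = (INF k \<in> {k. (u, v) \<in> edges G ^^ k}. enat k)"

definition diameter :: "('v, 'z) graph_scheme \<Rightarrow> enat" where
  "diameter G = (SUP u \<in> verts G. SUP v \<in> verts G. distance G u v)"

text \<open>
  A cycle is listed by its successive distinct vertices. A list of length 1 is a self-loop; length 2
  is excluded, as it would merely traverse one edge back and forth.
\<close>

definition is_cycle :: "('v, 'z) graph_scheme \<Rightarrow> 'v list \<Rightarrow> bool" where
  "is_cycle G c \<longleftrightarrow> c \<noteq> [] \<and> length c \<noteq> 2 \<and> distinct c \<and> set c \<subseteq> verts G \<and>
     (\<forall>i < length c. (c ! i, c ! (Suc i mod length c)) \<in> edges G)"

definition girth :: "('v, 'z) graph_scheme \<Rightarrow> enat" where
  "girth G = (INF c \<in> {c. is_cycle G c}. enat (length c))"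

definition graph_iso ::
    "('v \<Rightarrow> 'w) \<Rightarrow> ('v, 'y) graph_scheme \<Rightarrow> ('w, 'z) graph_scheme \<Rightarrow> bool" where
  "graph_iso f G H \<longleftrightarrow> bij_betw f (verts G) (verts H) \<and>
     (\<forall>u \<in> verts G. \<forall>v \<in> verts G. (u, v) \<in> edges G \<longleftrightarrow> (f u, f v) \<in> edges H)"

definition isomorphic :: "('v, 'y) graph_scheme \<Rightarrow> ('w, 'z) graph_scheme \<Rightarrow> bool" where
  "isomorphic G H \<longleftrightarrow> (\<exists>f. graph_iso f G H)"

definition cycle_graph :: "nat \<Rightarrow> nat graph" where
  "cycle_graph m = \<lparr>verts = {..<m},
     edges = {(i, j). i < m \<and> j < m \<and> (j = Suc i mod m \<or> i = Suc j mod m)}\<rparr>"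

definition delete_loops :: "'v graph \<Rightarrow> 'v graph" where
  "delete_loops G = \<lparr>verts = verts G, edges = {(u, v) \<in> edges G. u \<noteq> v}\<rparr>"

definition induced_subgraph :: "('v, 'z) graph_scheme \<Rightarrow> 'v set \<Rightarrow> 'v graph" where
  "induced_subgraph G S = \<lparr>verts = verts G \<inter> S, edges = edges G \<inter> S \<times> S\<rparr>"

text \<open>The truncated subtraction is harmless: for \<open>\<Delta> = 0\<close> the sum is multiplied by \<open>0\<close>.\<close>

definition moore_bound :: "nat \<Rightarrow> nat \<Rightarrow> nat" where
  "moore_bound \<Delta> D = 1 + \<Delta> * (\<Sum>i<D. (\<Delta> - 1) ^ i)"


section \<open>Generalized polygons\<close>

record ('p, 'l) geometry =
  points :: "'p set"
  lines :: "'l set"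
  incidence :: "('p \<times> 'l) set"

definition incidence_graph :: "('p, 'l) geometry \<Rightarrow> ('p + 'l) bigraph" where
  "incidence_graph \<Gamma> = \<lparr>verts = Inl ` points \<Gamma> \<union> Inr ` lines \<Gamma>,
     edges = (\<Union>(p, l) \<in> incidence \<Gamma>. {(Inl p, Inr l), (Inr l, Inl p)}),
     part1 = Inl ` points \<Gamma>, part2 = Inr ` lines \<Gamma>\<rparr>"

definition generalized_polygon :: "nat \<Rightarrow> ('p, 'l) geometry \<Rightarrow> bool" where
  "generalized_polygon n \<Gamma> \<longleftrightarrow> incidence \<Gamma> \<subseteq> points \<Gamma> \<times> lines \<Gamma> \<and>
     diameter (incidence_graph \<Gamma>) = enat n \<and> girth (incidence_graph \<Gamma>) = enat (2 * n)"

definition has_order :: "('p, 'l) geometry \<Rightarrow> nat \<Rightarrow> nat \<Rightarrow> bool" where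
  "has_order \<Gamma> s t \<longleftrightarrow>
     (\<forall>l \<in> lines \<Gamma>. card {p \<in> points \<Gamma>. (p, l) \<in> incidence \<Gamma>} = s + 1) \<and>
     (\<forall>p \<in> points \<Gamma>. card {l \<in> lines \<Gamma>. (p, l) \<in> incidence \<Gamma>} = t + 1)"


section \<open>Polarities\<close>

definition polarity :: "'v bigraph \<Rightarrow> ('v \<Rightarrow> 'v) \<Rightarrow> bool" where
  "polarity G \<rho> \<longleftrightarrow> graph_iso \<rho> G G \<and> (\<forall>v \<in> verts G. \<rho> (\<rho> v) = v) \<and>
     \<rho> ` part1 G = part2 G \<and> \<rho> ` part2 G = part1 G"

text \<open>
  The rotation by \<open>\<pi>\<close> of the \<open>2n\<close>-cycle is \<open>i \<mapsto> i + n\<close> modulo \<open>2n\<close>. The existence of the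
  isomorphism \<open>\<phi>\<close> forces \<open>G\<close> to be a \<open>2n\<close>-cycle, and for even \<open>n\<close> the rotation preserves the parts,
  so no polarity is a rotation then.
\<close>

definition rotation_polarity :: "nat \<Rightarrow> 'v bigraph \<Rightarrow> ('v \<Rightarrow> 'v) \<Rightarrow> bool" where
  "rotation_polarity n G \<rho> \<longleftrightarrow> polarity G \<rho> \<and>
     (\<exists>\<phi>. graph_iso \<phi> (cycle_graph (2 * n)) G \<and>
          (\<forall>i < 2 * n. \<rho> (\<phi> i) = \<phi> ((i + n) mod (2 * n))))"

definition nonrotation_polarity :: "nat \<Rightarrow> 'v bigraph \<Rightarrow> ('v \<Rightarrow> 'v) \<Rightarrow> bool" where
  "nonrotation_polarity n G \<rho> \<longleftrightarrow> polarity G \<rho> \<and> \<not> rotation_polarity n G \<rho>"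

text \<open>
  The pairs of a generalized \<open>n\<close>-gon of order \<open>(q, q)\<close>, \<open>q \<ge> 1\<close>, and a non-rotation polarity of its
  incidence graph. Such geometries are finite, so restricting the points and the lines to elements
  of one infinite type \<open>'a\<close> loses none of them up to isomorphism.
\<close>

definition polarized_polygons ::
    "nat \<Rightarrow> nat \<Rightarrow> (('a, 'a) geometry \<times> ('a + 'a \<Rightarrow> 'a + 'a)) set" where
  "polarized_polygons n q = {(\<Gamma>, \<rho>). q \<ge> 1 \<and> generalized_polygon n \<Gamma> \<and> has_order \<Gamma> q q \<and>
     nonrotation_polarity n (incidence_graph \<Gamma>) \<rho>}"

definition admissible :: "'a itself \<Rightarrow> nat \<Rightarrow> nat \<Rightarrow> bool" where
  "admissible _ n q \<longleftrightarrow>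
     (\<exists>\<Gamma> \<rho>. (\<Gamma>, \<rho>) \<in> (polarized_polygons n q :: (('a, 'a) geometry \<times> _) set))"

definition polarity_quotient :: "('v, 'z) graph_scheme \<Rightarrow> ('v \<Rightarrow> 'v) \<Rightarrow> 'v set graph" where
  "polarity_quotient G \<rho> = (let orbits = (\<lambda>v. {v, \<rho> v}) ` verts G in
     \<lparr>verts = orbits,
      edges = {(x, y) \<in> orbits \<times> orbits. \<exists>v \<in> x. \<exists>w \<in> y. (v, w) \<in> edges G}\<rparr>)"


section \<open>Kronecker products and the composed-polarity quotients\<close>

definition kronecker_product ::
    "('v, 'y) graph_scheme \<Rightarrow> ('w, 'z) graph_scheme \<Rightarrow> ('v \<times> 'w) graph" where
  "kronecker_product H K = \<lparr>verts = verts H \<times> verts K,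
     edges = {((h1, k1), (h2, k2)) |h1 k1 h2 k2. (h1, h2) \<in> edges H \<and> (k1, k2) \<in> edges K}\<rparr>"

text \<open>
  Of the two components of the Kronecker product we take the one containing the product of the first
  parts. Given polarities \<open>\<rho>\<^sub>H\<close> and \<open>\<rho>\<^sub>K\<close>, the map \<open>(h, k) \<mapsto> (h, \<rho>\<^sub>K k)\<close> is an isomorphism onto
  the other one that commutes with the composed polarity.
\<close>

definition component_product :: "'v bigraph \<Rightarrow> 'w bigraph \<Rightarrow> ('v \<times> 'w) graph" (infixl "\<odot>" 70) where
  "H \<odot> K = induced_subgraph (kronecker_product H K)
     (part1 H \<times> part1 K \<union> part2 H \<times> part2 K)"

definition composed_polarity :: "('v \<Rightarrow> 'v) \<Rightarrow> ('w \<Rightarrow> 'w) \<Rightarrow> 'v \<times> 'w \<Rightarrow> 'v \<times> 'w" where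
  "composed_polarity \<rho>H \<rho>K = (\<lambda>(h, k). (\<rho>H h, \<rho>K k))"

type_synonym 'a quotient_graph = "(('a + 'a) \<times> ('a + 'a)) set graph"

definition graphs_from :: "nat \<Rightarrow> nat \<Rightarrow> nat \<Rightarrow> 'a quotient_graph set" where
  "graphs_from n q r =
     {delete_loops (polarity_quotient (incidence_graph \<Gamma>q \<odot> incidence_graph \<Gamma>r)
        (composed_polarity \<rho>q \<rho>r)) |\<Gamma>q \<rho>q \<Gamma>r \<rho>r.
      (\<Gamma>q, \<rho>q) \<in> polarized_polygons n q \<and> (\<Gamma>r, \<rho>r) \<in> polarized_polygons n r}"

definition quotient_family :: "nat \<Rightarrow> 'a quotient_graph set" where
  "quotient_family n = (\<Union>q. \<Union>r. graphs_from n q r)"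

end

theory Submission
  imports Defs "HOL-Algebra.Algebraic_Closure_Type" "HOL-Real_Asymp.Real_Asymp"
begin

text \<open>
  Let \<open>H\<close> be the incidence graph of a generalized \<open>n\<close>-gon of order \<open>(q, q)\<close> with polarity \<open>\<rho>\<close>. Its
  polarity quotient lives on the points, with \<open>u \<sim> v\<close> if and only if \<open>u\<close> is incident with \<open>\<rho> v\<close>, and
  a walk of length \<open>k\<close> from \<open>u\<close> to \<open>v\<close> in the quotient is the same as a walk of length \<open>k\<close> from \<open>u\<close>
  to \<open>\<rho>\<^sup>k v\<close> in \<open>H\<close>. The quotient of \<open>H \<odot> K\<close> by the composed polarity is the Kronecker product of the
  two quotients (\<open>model_iso_quotient\<close>), and this reduces the three invariants to facts about \<open>H\<close>.

  \<^item> Diameter: \<open>\<rho>\<^sup>n\<^sup>-\<^sup>1 v\<close> has the right parity to be at distance at most \<open>n - 1\<close> from \<open>u\<close>, and going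
    back and forth along an edge turns a shorter walk into one of length exactly \<open>n - 1\<close>. Exact lengths
    are what a product needs: any two of its vertices are joined by a walk of length \<open>n - 1\<close>.
    Conversely, vertices at distance \<open>n\<close> and \<open>n - 1\<close> in \<open>H\<close> yield a pair of points joined by no short
    walk of even length in the quotient of \<open>H\<close>, likewise \<open>K\<close> yields a pair joined by no short walk of odd length, and the
    combination of the two pairs is at distance \<open>n - 1\<close>.
  \<^item> Degree: every vertex has \<open>(q + 1) (r + 1)\<close> neighbours, including possibly itself. A line carries
    at most one absolute point, so some point is not absolute and a vertex without a loop exists.
  \<^item> Order: from a vertex of \<open>H\<close> the vertices of one part are reached by exactly one non-backtracking
    walk of length below \<open>n\<close>, so each part has \<open>1 + q + \<dots> + q\<^sup>n\<^sup>-\<^sup>1\<close> elements. Comparison with the Moore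
    bound is then a limit of rational functions.

  It remains to produce infinitely many self-polar polygons. They are built from coordinates: two
  rooted \<open>q\<close>-ary trees of depth \<open>n - 1\<close> whose roots are joined by an edge, and whose leaves are joined by
  a relation between coordinate lists. For \<open>n = 3\<close> the relation is the equation of a line of the
  projective plane; for \<open>n = 4\<close> and \<open>n = 6\<close> it is the coordinatization of the symplectic quadrangle and
  of the split Cayley hexagon. A field automorphism \<open>\<theta>\<close> whose square is the Frobenius map, which exists
  on \<open>GF(p\<^sup>2\<^sup>e\<^sup>+\<^sup>1)\<close>, makes the relation symmetric in characteristic \<open>p = 2\<close>, respectively \<open>p = 3\<close>,
  and exchanging the two trees is then a polarity. To verify the axioms of a polygon without
  enumerating cycles, counting is used in the other direction: if a leaf reaches a whole part by walks
  of length below \<open>n\<close>, then these walks are unique and no cycle of length below \<open>2n\<close> passes through the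
  leaf (\<open>diameter_girth_of_counts\<close>). Every cycle meets a leaf, and translations of the coordinates reduce
  the claim to the leaf with all coordinates \<open>0\<close>, from which explicit paths are given.
\<close>

text \<open>
  The degree of a polynomial, the order of a root and the order of a group would otherwise shadow the
  graph invariants of the same names.
\<close>

hide_const (open) Polynomial.degree Polynomials.degree Polynomial.order Coset.order

section \<open>Distance and diameter\<close>

lemma distance_le_iff:
  "distance G u v \<le> enat k \<longleftrightarrow> (\<exists>j\<le>k. (u, v) \<in> edges G ^^ j)"
proof
  assume le: "distance G u v \<le> enat k"
  have ne: "{j. (u, v) \<in> edges G ^^ j} \<noteq> {}"
  proof
    assume "{j. (u, v) \<in> edges G ^^ j} = {}"
    then have "distance G u v = \<infinity>" unfolding distance_def
      by (simp add: top_enat_def)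
    with le show False by simp
  qed
  then have "enat ` {j. (u, v) \<in> edges G ^^ j} \<noteq> {}" by blast
  then have "distance G u v \<in> enat ` {j. (u, v) \<in> edges G ^^ j}"
    unfolding distance_def using wellorder_InfI[of _ "enat ` {j. (u, v) \<in> edges G ^^ j}"]
    by (metis ex_in_conv)
  with le show "\<exists>j\<le>k. (u, v) \<in> edges G ^^ j" by auto
next
  assume "\<exists>j\<le>k. (u, v) \<in> edges G ^^ j"
  then obtain j where "j \<le> k" "(u, v) \<in> edges G ^^ j" by blast
  then show "distance G u v \<le> enat k"
    unfolding distance_def by (intro INF_lower2[of j]) auto
qed

lemma diameter_le_iff:
  "diameter G \<le> enat k \<longleftrightarrow>
    (\<forall>u \<in> verts G. \<forall>v \<in> verts G. \<exists>j\<le>k. (u, v) \<in> edges G ^^ j)"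
  unfolding diameter_def by (simp add: SUP_le_iff distance_le_iff)

lemma diameter_eqI:
  assumes "\<And>u v. u \<in> verts G \<Longrightarrow> v \<in> verts G \<Longrightarrow> \<exists>j\<le>k. (u, v) \<in> edges G ^^ j"
    and "x \<in> verts G" "y \<in> verts G" "\<And>j. j < k \<Longrightarrow> (x, y) \<notin> edges G ^^ j"
  shows "diameter G = enat k"
proof (rule antisym)
  show "diameter G \<le> enat k" using assms(1) by (simp add: diameter_le_iff)
  show "enat k \<le> diameter G"
  proof (cases k)
    case 0 then show ?thesis by (simp flip: zero_enat_def)
  next
    case (Suc m)
    have "\<not> diameter G \<le> enat m"
    proof
      assume "diameter G \<le> enat m"
      then obtain j where "j \<le> m" "(x, y) \<in> edges G ^^ j"
        using assms(2,3) unfolding diameter_le_iff by blast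
      with assms(4)[of j] Suc show False by simp
    qed
    then show ?thesis using Suc by (cases "diameter G") auto
  qed
qed

section \<open>Non-backtracking walks\<close>

text \<open>
  Walks that never retrace the edge just used. A walk is listed from its end to its start, so that it
  is prolonged at the head of the list and its start is \<open>last w\<close>; a list of length \<open>k + 1\<close> is a walk of
  length \<open>k\<close>.
\<close>
definition nb_walk :: "('v \<times> 'v) set \<Rightarrow> 'v list \<Rightarrow> bool" where
  "nb_walk E w \<longleftrightarrow> w \<noteq> [] \<and> (\<forall>i. Suc i < length w \<longrightarrow> (w ! i, w ! Suc i) \<in> E) \<and>
     (\<forall>i. Suc (Suc i) < length w \<longrightarrow> w ! i \<noteq> w ! Suc (Suc i))"

lemma nb_walk_Nil [simp]: "\<not> nb_walk E []"
  by (simp add: nb_walk_def)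

lemma nb_walk_single [simp]: "nb_walk E [x]"
  by (simp add: nb_walk_def)

lemma nb_walk_Cons [simp]:
  "nb_walk E (x # y # w) \<longleftrightarrow> (x, y) \<in> E \<and> (w \<noteq> [] \<longrightarrow> x \<noteq> hd w) \<and> nb_walk E (y # w)"
  by (cases w) (auto simp: nb_walk_def All_less_Suc2)

lemma nb_walk_tl: "nb_walk E (x # w) \<Longrightarrow> w \<noteq> [] \<Longrightarrow> nb_walk E w"
  by (cases w) auto

lemma nb_walk_appendD2: "nb_walk E (u @ w) \<Longrightarrow> w \<noteq> [] \<Longrightarrow> nb_walk E w"
  by (induction u) (auto dest: nb_walk_tl)

lemma nb_walk_appendD1: "nb_walk E (u @ w) \<Longrightarrow> u \<noteq> [] \<Longrightarrow> nb_walk E u"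
proof -
  assume u: "nb_walk E (u @ w)" "u \<noteq> []"
  have "(u @ w) ! i = u ! i" if "i < length u" for i
    using that by (simp add: nth_append)
  with u show ?thesis unfolding nb_walk_def by (metis Suc_lessD length_append trans_less_add1)
qed

text \<open>
  Two walks with a common end \<open>x\<close> that arrive there along different edges can be traversed one after
  the other; this is how two distinct walks with the same ends produce a cycle.
\<close>
lemma nb_walk_glue:
  assumes "sym E"
  shows "nb_walk E (x # us) \<Longrightarrow> nb_walk E (x # ws) \<Longrightarrow>
    us = [] \<or> ws = [] \<or> hd us \<noteq> hd ws \<Longrightarrow> nb_walk E (rev us @ x # ws)"
proof (induction us arbitrary: x ws)
  case (Cons u us)
  have "nb_walk E (u # x # ws)" using Cons.prems assms by (auto dest: symD)
  moreover have "nb_walk E (u # us)" using Cons.prems by auto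
  ultimately have "nb_walk E (rev us @ u # x # ws)"
    using Cons.prems by (intro Cons.IH) auto
  then show ?case by simp
qed simp

lemma nb_walk_rev: "sym E \<Longrightarrow> nb_walk E w \<Longrightarrow> nb_walk E (rev w)"
  using nb_walk_glue[of E "hd w" "tl w" "[]"] by (cases w) auto

lemma nb_walk_relpow: "nb_walk E w \<Longrightarrow> (hd w, last w) \<in> E ^^ (length w - 1)"
proof (induction w)
  case (Cons x w)
  show ?case
  proof (cases w)
    case (Cons y v)
    then have "(x, y) \<in> E" "(y, last w) \<in> E ^^ (length w - 1)"
      using Cons.IH Cons.prems by auto
    then show ?thesis using Cons by (auto simp del: relpow.simps intro: relpow_Suc_I2)
  qed simp
qed simp

lemma relpow_sym: "sym E \<Longrightarrow> (u, v) \<in> E ^^ k \<Longrightarrow> (v, u) \<in> E ^^ k"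
proof (induction k arbitrary: v)
  case (Suc k)
  then obtain y where "(u, y) \<in> E ^^ k" "(y, v) \<in> E" by auto
  with Suc show ?case by (metis relpow_Suc_I2 symD)
qed auto

text \<open>
  Deleting back-and-forth steps shortens a walk by an even amount, so the parity of its length survives.
\<close>
lemma relpow_imp_nb_walk:
  assumes "sym E"
  shows "(u, v) \<in> E ^^ k \<Longrightarrow>
    \<exists>w. nb_walk E w \<and> last w = u \<and> hd w = v \<and> length w \<le> Suc k \<and> even (length w + Suc k)"
proof (induction k arbitrary: v)
  case 0
  then show ?case by (intro exI[of _ "[u]"]) auto
next
  case (Suc k)
  then obtain y where y: "(u, y) \<in> E ^^ k" "(y, v) \<in> E" by auto
  from Suc.IH[OF y(1)] obtain w where w: "nb_walk E w" "last w = u" "hd w = y"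
    "length w \<le> Suc k" "even (length w + Suc k)" by auto
  from w(1,3) obtain w' where w': "w = y # w'" by (cases w) auto
  show ?case
  proof (cases "w' \<noteq> [] \<and> hd w' = v")
    case True
    then show ?thesis using w w' by (intro exI[of _ w']) (auto dest: nb_walk_tl)
  next
    case False
    then show ?thesis using w w' y assms by (intro exI[of _ "v # w"]) (auto dest: symD)
  qed
qed

text \<open>
  A shortest segment between two visits of the same vertex is a cycle. It does not have length 2
  because the walk does not backtrack.
\<close>
lemma nb_walk_imp_cycle:
  assumes "nb_walk (edges G) w" "set w \<subseteq> verts G" "\<not> distinct w"
  shows "\<exists>c. is_cycle G c \<and> length c < length w"
  using assms
proof (induction w)
  case (Cons x w)
  show ?case
  proof (cases "distinct w")
    case False
    with Cons show ?thesis by (cases "w = []") (auto dest: nb_walk_tl intro: less_SucI)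
  next
    case True
    with Cons.prems obtain j where j: "j < length w" "w ! j = x"
      by (auto simp: in_set_conv_nth)
    define c where "c = take (Suc j) (x # w)"
    have len: "length c = Suc j" using j by (simp add: c_def)
    have "x \<notin> set (take j w)"
      using True j by (auto simp: in_set_conv_nth nth_eq_iff_index_eq)
    then have "distinct c" using True by (simp add: c_def)
    moreover have "length c \<noteq> 2"
      using Cons.prems(1) j len unfolding nb_walk_def by force
    moreover have "(c ! i, c ! (Suc i mod length c)) \<in> edges G" if "i < length c" for i
    proof (cases "Suc i = length c")
      case True
      have "((x # w) ! i, (x # w) ! Suc i) \<in> edges G"
        using Cons.prems(1) j len that unfolding nb_walk_def by auto
      then show ?thesis using True j len by (auto simp: c_def nth_Cons split: nat.splits)
    next
      case False
      then have i: "Suc i < Suc j" using that len by auto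
      then have "((x # w) ! i, (x # w) ! Suc i) \<in> edges G"
        using Cons.prems(1) j unfolding nb_walk_def by auto
      moreover have "c ! i = (x # w) ! i" "c ! Suc i = (x # w) ! Suc i"
        using i by (simp_all add: c_def del: take_Suc_Cons)
      ultimately show ?thesis using i len by simp
    qed
    moreover have "set c \<subseteq> verts G" using Cons.prems(2) by (auto simp: c_def dest: in_set_takeD)
    ultimately have "is_cycle G c" using len unfolding is_cycle_def by auto
    then show ?thesis using len j by auto
  qed
qed simp

lemma nb_walk_verts:
  assumes "edges G \<subseteq> verts G \<times> verts G"
  shows "nb_walk (edges G) w \<Longrightarrow> last w \<in> verts G \<Longrightarrow> set w \<subseteq> verts G"
proof (induction w)
  case (Cons x w)
  with assms show ?case by (cases w) auto
qed simp

text \<open>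
  Two different walks with the same ends share a terminal segment; cutting it off and gluing the rest
  gives a closed walk, hence a cycle, no longer than the two walks together.
\<close>
lemma nb_walk_unique:
  assumes "edges G \<subseteq> verts G \<times> verts G" "sym (edges G)"
    and short: "\<And>c. is_cycle G c \<Longrightarrow> g \<le> length c"
  shows "nb_walk (edges G) p \<Longrightarrow> nb_walk (edges G) r \<Longrightarrow> hd p = hd r \<Longrightarrow> last p = last r \<Longrightarrow>
    last p \<in> verts G \<Longrightarrow> length p + length r < g + 2 \<Longrightarrow> p = r"
proof (induction p arbitrary: r)
  case (Cons x p)
  have closed: "length w \<le> 1 \<or> g < length w"
    if "nb_walk (edges G) w" "hd w = last w" "last w \<in> verts G" for w
  proof (cases "length w \<le> 1")
    case False
    then have "\<not> distinct w" using that(2)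
      by (cases w) (auto split: if_splits)
    with nb_walk_imp_cycle[OF that(1)] nb_walk_verts[OF assms(1) that(1,3)]
    show ?thesis using short by force
  qed auto
  from Cons.prems(2,3) obtain r' where r': "r = x # r'" by (cases r) auto
  consider "p = []" | "r' = []" | y p' z r'' where "p = y # p'" "r' = z # r''"
    by (cases p; cases r') auto
  then show ?case
  proof cases
    case 1
    then show ?thesis using closed[of r] Cons.prems r' by auto
  next
    case 2
    then show ?thesis using closed[of "x # p"] Cons.prems r' by auto
  next
    case 3
    show ?thesis
    proof (cases "y = z")
      case True
      have "p = r'" using Cons.prems r' 3 True by (intro Cons.IH) auto
      then show ?thesis using r' by simp
    next
      case False
      have "nb_walk (edges G) (rev r' @ x # p)"
        using Cons.prems r' 3 False by (intro nb_walk_glue assms) auto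
      moreover have "hd (rev r' @ x # p) = last (rev r' @ x # p)"
        using Cons.prems r' 3 by (simp add: hd_rev)
      ultimately show ?thesis
        using closed[of "rev r' @ x # p"] Cons.prems r' 3 by auto
    qed
  qed
qed simp

lemma is_cycle_rotate:
  assumes "is_cycle G c" shows "is_cycle G (rotate m c)"
proof -
  let ?L = "length c"
  have L: "?L > 0" using assms by (auto simp: is_cycle_def)
  have "(rotate m c ! i, rotate m c ! (Suc i mod ?L)) \<in> edges G" if "i < ?L" for i
  proof -
    have "(c ! ((m + i) mod ?L), c ! (Suc ((m + i) mod ?L) mod ?L)) \<in> edges G"
      using assms L by (auto simp: is_cycle_def)
    moreover have "Suc ((m + i) mod ?L) mod ?L = (m + Suc i mod ?L) mod ?L"
      by (metis add_Suc_right mod_Suc_eq mod_add_right_eq)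
    ultimately show ?thesis using that L by (simp add: nth_rotate)
  qed
  then show ?thesis using assms by (auto simp: is_cycle_def)
qed

section \<open>Counting walks in regular bipartite graphs\<close>

text \<open>
  The two parts are given by a colouring, which makes the setting independent of how the parts are
  represented. Loops are excluded by the colouring.
\<close>
locale regular_bipartite =
  fixes G :: "('v, 'z) graph_scheme" and col :: "'v \<Rightarrow> bool" and q :: nat
  assumes edges_sub: "edges G \<subseteq> verts G \<times> verts G"
    and sym_edges: "sym (edges G)"
    and edge_col: "(u, v) \<in> edges G \<Longrightarrow> col u \<noteq> col v"
    and card_nbrs: "v \<in> verts G \<Longrightarrow> card {w. (v, w) \<in> edges G} = q + 1"
begin

text \<open>
  Only walks whose number of vertices has the parity of \<open>m\<close> are collected: their ends all lie in the
  same part, namely \<open>far_class m v\<close>, and for \<open>m = n\<close> in a generalized \<open>n\<close>-gon they reach every vertex of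
  that part exactly once.
\<close>
definition walks_from :: "nat \<Rightarrow> 'v \<Rightarrow> 'v list set" where
  "walks_from m v = {w. nb_walk (edges G) w \<and> length w \<le> m \<and> even (length w + m) \<and> last w = v}"

definition far_class :: "nat \<Rightarrow> 'v \<Rightarrow> 'v set" where
  "far_class m v = {x \<in> verts G. col x \<longleftrightarrow> (col v \<longleftrightarrow> odd m)}"

lemma finite_nbrs: "v \<in> verts G \<Longrightarrow> finite {w. (v, w) \<in> edges G}"
  using card_nbrs card.infinite by fastforce

text \<open>
  There are \<open>q + 1\<close> choices for the first step and \<open>q\<close> for every further one.
\<close>
lemma card_walks_length:
  assumes "v \<in> verts G"
  shows "finite {w. nb_walk (edges G) w \<and> length w = m + 2 \<and> last w = v} \<and>
    card {w. nb_walk (edges G) w \<and> length w = m + 2 \<and> last w = v} = (q + 1) * q ^ m"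
proof (induction m)
  case 0
  have "{w. nb_walk (edges G) w \<and> length w = 0 + 2 \<and> last w = v} =
    (\<lambda>y. [y, v]) ` {w. (v, w) \<in> edges G}"
    using sym_edges by (auto simp: length_Suc_conv numeral_2_eq_2 dest: symD)
  then show ?case using finite_nbrs[OF assms] card_nbrs[OF assms]
    by (simp add: card_image inj_on_def)
next
  case (Suc m)
  let ?W = "\<lambda>m. {w. nb_walk (edges G) w \<and> length w = m + 2 \<and> last w = v}"
  let ?N = "\<lambda>w. {y. (hd w, y) \<in> edges G} - {w ! 1}"
  have N: "finite (?N w) \<and> card (?N w) = q" if wW: "w \<in> ?W m" for w
  proof -
    obtain x y w' where w: "w = x # y # w'"
      using wW by (cases w; cases "tl w") auto
    then have "(x, y) \<in> edges G" using wW by simp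
    moreover then have "x \<in> verts G" using edges_sub by auto
    ultimately show ?thesis using w card_nbrs[of x] finite_nbrs[of x] by simp
  qed
  have img: "?W (Suc m) = (\<lambda>(w, y). y # w) ` Sigma (?W m) ?N"
  proof (intro equalityI subsetI)
    fix u assume u: "u \<in> ?W (Suc m)"
    then obtain y x z w' where "u = y # x # z # w'"
      by (auto simp: length_Suc_conv)
    then show "u \<in> (\<lambda>(w, y). y # w) ` Sigma (?W m) ?N"
      using u sym_edges by (intro image_eqI[of _ _ "(x # z # w', y)"]) (auto dest: symD)
  next
    fix u assume "u \<in> (\<lambda>(w, y). y # w) ` Sigma (?W m) ?N"
    then obtain w y where wy: "w \<in> ?W m" "y \<in> ?N w" "u = y # w" by auto
    then obtain x z w' where "w = x # z # w'"
      by (auto simp: length_Suc_conv)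
    then show "u \<in> ?W (Suc m)" using wy sym_edges by (auto dest: symD)
  qed
  have inj: "inj_on (\<lambda>(w, y). y # w) (Sigma (?W m) ?N)" by (auto simp: inj_on_def)
  have W: "finite (?W m)" "card (?W m) = (q + 1) * q ^ m" using Suc by blast+
  have "card (?W (Suc m)) = (\<Sum>w\<in>?W m. card (?N w))"
    unfolding img card_image[OF inj] using W N by (intro card_SigmaI) blast+
  also have "\<dots> = card (?W m) * q" using N by simp
  finally have "card (?W (Suc m)) = (q + 1) * q ^ Suc m" unfolding W(2) by (simp add: algebra_simps)
  moreover have "finite (?W (Suc m))" unfolding img using W N by (intro finite_imageI finite_SigmaI) blast+
  ultimately show ?case by blast
qed

text \<open>
  The numbers \<open>(q + 1) q\<^sup>m\<close> of walks of every second length add up to a full geometric sum.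
\<close>
lemma card_walks_from:
  assumes "v \<in> verts G"
  shows "finite (walks_from m v) \<and> card (walks_from m v) = (\<Sum>i<m. q ^ i)"
proof (induction m rule: induct_nat_012)
  case 0
  then show ?case by (auto simp: walks_from_def)
next
  case 1
  have "walks_from 1 v = {[v]}"
    by (auto simp: walks_from_def le_Suc_eq length_Suc_conv)
  then show ?case by simp
next
  case (ge2 m)
  let ?W = "{w. nb_walk (edges G) w \<and> length w = m + 2 \<and> last w = v}"
  have "walks_from (Suc (Suc m)) v = walks_from m v \<union> ?W"
    by (auto simp: walks_from_def le_Suc_eq)
  moreover have "walks_from m v \<inter> ?W = {}" by (auto simp: walks_from_def)
  ultimately show ?case
    using ge2(1) card_walks_length[OF assms, of m] by (simp add: card_Un_disjoint)
qed

lemma relpow_col: "(u, v) \<in> edges G ^^ k \<Longrightarrow> col v \<longleftrightarrow> (col u \<longleftrightarrow> even k)"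
proof (induction k arbitrary: v)
  case (Suc k)
  then obtain y where "(u, y) \<in> edges G ^^ k" "(y, v) \<in> edges G" by auto
  with Suc.IH edge_col show ?case by auto
qed auto

lemma relpow_verts: "(u, v) \<in> edges G ^^ k \<Longrightarrow> u \<in> verts G \<Longrightarrow> v \<in> verts G"
  using edges_sub by (cases k) auto

lemma walks_from_far_class:
  assumes "v \<in> verts G" shows "hd ` walks_from m v \<subseteq> far_class m v"
proof -
  have "hd w \<in> far_class m v" if "w \<in> walks_from m v" for w
  proof -
    have w: "nb_walk (edges G) w" "last w = v" "even (length w + m)"
      using that by (auto simp: walks_from_def)
    have r: "(v, hd w) \<in> edges G ^^ (length w - 1)"
      using nb_walk_relpow[OF w(1)] relpow_sym[OF sym_edges] w(2) by auto
    have "length w > 0" using w(1) by auto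
    with relpow_col[OF r] relpow_verts[OF r assms] w(3) show ?thesis
      by (cases "length w") (auto simp: far_class_def)
  qed
  then show ?thesis by auto
qed

lemma near_in_walks_from:
  assumes "(v, x) \<in> edges G ^^ k" "k < m" "x \<in> far_class m v"
  shows "x \<in> hd ` walks_from m v"
proof -
  from relpow_imp_nb_walk[OF sym_edges assms(1)]
  obtain w where w: "nb_walk (edges G) w" "last w = v" "hd w = x" "length w \<le> Suc k"
    "even (length w + Suc k)" by auto
  have "even (Suc k + m)"
    using relpow_col[OF assms(1)] assms(3) by (auto simp: far_class_def)
  with w assms(2) have "w \<in> walks_from m v" by (auto simp: walks_from_def)
  with w(3) show ?thesis by auto
qed

lemma walks_from_near:
  assumes "x \<in> hd ` walks_from m v" shows "\<exists>k<m. (v, x) \<in> edges G ^^ k"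
proof -
  from assms obtain w where w: "nb_walk (edges G) w" "last w = v" "hd w = x" "length w \<le> m"
    by (auto simp: walks_from_def)
  then have "(v, x) \<in> edges G ^^ (length w - 1)"
    using nb_walk_relpow[OF w(1)] relpow_sym[OF sym_edges] by auto
  moreover have "length w - 1 < m" using w by (cases w) auto
  ultimately show ?thesis by blast
qed

lemma girth_imp_inj:
  assumes "\<And>c. is_cycle G c \<Longrightarrow> 2 * n \<le> length c" "v \<in> verts G"
  shows "inj_on hd (walks_from n v)"
proof (rule inj_onI)
  fix p r assume "p \<in> walks_from n v" "r \<in> walks_from n v" "hd p = hd r"
  with assms(2) show "p = r"
    by (intro nb_walk_unique[OF edges_sub sym_edges assms(1)]) (auto simp: walks_from_def)
qed

text \<open>
  A cycle of length \<open>2h < 2n\<close> through \<open>v\<close> can be cut at a second vertex into two walks from \<open>v\<close> of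
  admissible parity and length, which contradicts injectivity.
\<close>
lemma inj_imp_girth:
  assumes inj: "inj_on hd (walks_from n v)" and c: "is_cycle G c" and v: "v \<in> set c"
  shows "2 * n \<le> length c"
proof (rule ccontr)
  assume small: "\<not> 2 * n \<le> length c"
  obtain m where m: "m < length c" "c ! m = v" using v by (auto simp: in_set_conv_nth)
  define d where "d = rotate m c"
  let ?L = "length d"
  have d: "is_cycle G d" using is_cycle_rotate[OF c] d_def by auto
  have d0: "d ! 0 = v" using m by (subst d_def, subst nth_rotate) auto
  have L: "?L = length c" by (simp add: d_def)
  have edge: "(d ! i, d ! (Suc i mod ?L)) \<in> edges G" if "i < ?L" for i
    using d that by (auto simp: is_cycle_def)
  have colour: "i < ?L \<Longrightarrow> col (d ! i) \<longleftrightarrow> (col v \<longleftrightarrow> even i)" for i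
  proof (induction i)
    case 0 then show ?case using d0 by simp
  next
    case (Suc i)
    then show ?case using edge_col[OF edge[of i]] by auto
  qed
  have pos: "?L > 0" using m L by auto
  have "even ?L"
    using edge_col[OF edge[of "?L - 1"]] colour[of "?L - 1"] colour[of 0] pos d0
    by (cases ?L) auto
  moreover have "?L \<noteq> 2" "distinct d" using d by (auto simp: is_cycle_def)
  ultimately have L3: "?L \<ge> 3" using pos by presburger
  obtain h where h: "?L = 2 * h" using \<open>even ?L\<close> by auto
  \<comment> \<open>The second cutting point is antipodal to \<open>v\<close>, or next to the antipodal vertex if the antipodal
    one lies in the wrong part.\<close>
  define j where "j = (if even (h + n) then h + 1 else h)"
  have j: "1 \<le> j" "j < ?L" "Suc j \<le> n" "even (Suc j + n)" "?L - j + 1 \<le> n" "even (?L - j + 1 + n)"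
    using h L3 small L unfolding j_def by (simp_all split: if_splits, presburger+)
  define w where "w = d @ [v]"
  have nth_w: "w ! i = d ! (i mod ?L)" if "i \<le> ?L" for i
    using that d0 pos by (auto simp: w_def nth_append le_less)
  have nbw: "nb_walk (edges G) w"
    unfolding nb_walk_def
  proof (intro conjI allI impI)
    show "w \<noteq> []" by (simp add: w_def)
    show "(w ! i, w ! Suc i) \<in> edges G" if "Suc i < length w" for i
      using edge[of i] that nth_w[of i] nth_w[of "Suc i"] by (simp add: w_def)
    show "w ! i \<noteq> w ! Suc (Suc i)" if "Suc (Suc i) < length w" for i
    proof -
      have i: "i < ?L" "Suc (Suc i) \<le> ?L" using that by (auto simp: w_def)
      have "i \<noteq> Suc (Suc i) mod ?L" using i L3 by (auto simp: le_less)
      moreover have "Suc (Suc i) mod ?L < ?L" using pos by auto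
      ultimately have "d ! i \<noteq> d ! (Suc (Suc i) mod ?L)"
        using \<open>distinct d\<close> i by (simp add: nth_eq_iff_index_eq)
      then show ?thesis using nth_w i by simp
    qed
  qed
  define p where "p = rev (take (Suc j) w)"
  define r where "r = drop j w"
  have lenw: "length w = ?L + 1" and w_ne: "w \<noteq> []" by (simp_all add: w_def)
  have "nb_walk (edges G) (take (Suc j) w)"
    using nbw nb_walk_appendD1[of "edges G" "take (Suc j) w" "drop (Suc j) w"] w_ne by auto
  then have "nb_walk (edges G) p" unfolding p_def by (rule nb_walk_rev[OF sym_edges])
  moreover have "length p = Suc j" using j lenw by (simp add: p_def)
  moreover have "last p = v" using nth_w[of 0] d0 pos hd_conv_nth[OF w_ne]
    by (simp add: p_def last_rev)
  ultimately have p: "p \<in> walks_from n v" using j by (auto simp: walks_from_def)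
  have "nb_walk (edges G) r" unfolding r_def
    using nbw nb_walk_appendD2[of "edges G" "take j w" "drop j w"] lenw j by auto
  moreover have "length r = ?L - j + 1" using j lenw by (simp add: r_def)
  moreover have "last r = v" using j lenw by (simp add: r_def w_def)
  ultimately have r: "r \<in> walks_from n v" using j by (auto simp: walks_from_def)
  have "hd p = hd r"
    using j lenw by (simp add: p_def r_def hd_rev hd_drop_conv_nth take_Suc_conv_app_nth)
  with inj p r have "p = r" by (auto dest: inj_onD)
  moreover have "rev p ! 1 = d ! 1"
    using j lenw L3 nth_w[of 1] by (simp add: p_def)
  moreover have "rev r ! 1 = d ! (?L - 1)"
    using j lenw L3 nth_w[of "?L - 1"] by (simp add: r_def rev_nth)
  ultimately have "d ! 1 = d ! (?L - 1)" by simp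
  with \<open>distinct d\<close> L3 show False by (simp add: nth_eq_iff_index_eq)
qed

lemma diameter_imp_far_class:
  assumes "diameter G \<le> enat n" "v \<in> verts G"
  shows "far_class n v \<subseteq> hd ` walks_from n v"
proof
  fix x assume x: "x \<in> far_class n v"
  then obtain k where k: "k \<le> n" "(v, x) \<in> edges G ^^ k"
    using assms by (auto simp: diameter_le_iff far_class_def)
  have "k \<noteq> n" using relpow_col[OF k(2)] x by (auto simp: far_class_def)
  with k x show "x \<in> hd ` walks_from n v" by (intro near_in_walks_from) auto
qed

text \<open>
  Girth makes the end map on \<open>walks_from n v\<close> injective, diameter makes it surjective.
\<close>
lemma card_far_class:
  assumes "diameter G \<le> enat n" "\<And>c. is_cycle G c \<Longrightarrow> 2 * n \<le> length c" "v \<in> verts G"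
  shows "finite (far_class n v)" "card (far_class n v) = (\<Sum>i<n. q ^ i)"
proof -
  have "far_class n v = hd ` walks_from n v"
    using diameter_imp_far_class[OF assms(1,3)] walks_from_far_class[OF assms(3)] by blast
  then show "finite (far_class n v)" "card (far_class n v) = (\<Sum>i<n. q ^ i)"
    using card_walks_from[OF assms(3)] card_image[OF girth_imp_inj[OF assms(2,3)]] by auto
qed

text \<open>
  The converse of the previous count. Since walks and vertices are equally many, reaching a whole part
  from one vertex of each cycle forces uniqueness of the walks there, hence large girth. Large girth
  gives uniqueness from every vertex, and counting once more gives the diameter.
\<close>
theorem diameter_girth_of_counts:
  assumes n: "n \<ge> 2" and q: "q \<ge> 1" and ne: "verts G \<noteq> {}" and fin: "finite (verts G)"
    and card_class: "\<And>b. card {x \<in> verts G. col x = b} = (\<Sum>i<n. q ^ i)"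
    and hits: "\<And>c. is_cycle G c \<Longrightarrow> \<exists>v\<in>set c. far_class n v \<subseteq> hd ` walks_from n v"
  shows "diameter G = enat n" "girth G = enat (2 * n)"
proof -
  have cf: "card (far_class n v) = (\<Sum>i<n. q ^ i)" for v
    unfolding far_class_def by (rule card_class)
  have ffc: "finite (far_class n v)" for v
    using fin by (auto simp: far_class_def)
  have cyc: "2 * n \<le> length c" if c: "is_cycle G c" for c
  proof -
    from hits[OF c] obtain v where v: "v \<in> set c" "far_class n v \<subseteq> hd ` walks_from n v" by blast
    have vV: "v \<in> verts G" using c v by (auto simp: is_cycle_def)
    have "hd ` walks_from n v = far_class n v"
      using v walks_from_far_class[OF vV] by blast
    then have "inj_on hd (walks_from n v)"
      using card_walks_from[OF vV] cf[of v] by (intro eq_card_imp_inj_on) auto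
    then show ?thesis using inj_imp_girth c v by blast
  qed
  have cover: "far_class n v = hd ` walks_from n v" if v: "v \<in> verts G" for v
  proof (rule sym, rule card_subset_eq[OF ffc walks_from_far_class[OF v]])
    show "card (hd ` walks_from n v) = card (far_class n v)"
      using card_image[OF girth_imp_inj[OF cyc v]] card_walks_from[OF v] cf by simp
  qed
  obtain v where v: "v \<in> verts G" using ne by blast
  have "card {w. nb_walk (edges G) w \<and> length w = (n - 1) + 2 \<and> last w = v} > 0"
    using card_walks_length[OF v, of "n - 1"] q by simp
  then obtain w where w: "nb_walk (edges G) w" "length w = Suc n" "last w = v"
    using n by (auto simp: card_gt_0_iff)
  then obtain x y w' where wxy: "w = x # y # w'" using n
    by (cases w; cases "tl w") auto
  have xy: "(x, y) \<in> edges G" and xV: "x \<in> verts G"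
    using w wxy edges_sub by auto
  have far: "(v, x) \<notin> edges G ^^ k" if k: "k < n" for k
  proof
    assume r: "(v, x) \<in> edges G ^^ k"
    from relpow_imp_nb_walk[OF sym_edges r] obtain u where u: "nb_walk (edges G) u"
      "last u = v" "hd u = x" "length u \<le> Suc k" by auto
    have "u = w" using u w wxy v k
      by (intro nb_walk_unique[OF edges_sub sym_edges cyc]) auto
    with u w k show False by simp
  qed
  show "diameter G = enat n"
  proof (rule diameter_eqI[OF _ v xV far])
    fix a b assume ab: "a \<in> verts G" "b \<in> verts G"
    show "\<exists>j\<le>n. (a, b) \<in> edges G ^^ j"
    proof (cases "b \<in> far_class n a")
      case True
      then obtain k where "k < n" "(a, b) \<in> edges G ^^ k"
        using walks_from_near[of b n a] cover[OF ab(1)] by blast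
      then show ?thesis by (intro exI[of _ k]) auto
    next
      case False
      obtain b' where b': "(b, b') \<in> edges G"
        using card_nbrs[OF ab(2)] by (cases "{w. (b, w) \<in> edges G} = {}") auto
      then have "b' \<in> far_class n a"
        using False ab edge_col[OF b'] edges_sub by (auto simp: far_class_def)
      then obtain k where "k < n" "(a, b') \<in> edges G ^^ k"
        using walks_from_near[of b' n a] cover[OF ab(1)] by blast
      moreover have "(b', b) \<in> edges G" using b' sym_edges by (auto dest: symD)
      ultimately show ?thesis by (intro exI[of _ "Suc k"]) auto
    qed
  qed auto
  \<comment> \<open>The vertex \<open>x\<close> is at distance \<open>n\<close> from \<open>v\<close>; two of its neighbours give two walks from \<open>v\<close> to \<open>x\<close>,
    which close up to a cycle of length at most \<open>2n\<close>.\<close>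
  have "\<exists>c. is_cycle G c \<and> length c \<le> 2 * n"
  proof (rule ccontr)
    assume "\<not> ?thesis"
    then have long: "2 * n + 1 \<le> length c" if "is_cycle G c" for c
      using that by force
    have "card ({z. (x, z) \<in> edges G} - {y}) > 0"
      using card_nbrs[OF xV] finite_nbrs[OF xV] xy q by simp
    then obtain z where z: "(x, z) \<in> edges G" "z \<noteq> y" by (auto simp: card_gt_0_iff)
    have "(x, v) \<in> edges G ^^ n"
      using nb_walk_relpow[OF w(1)] w wxy by (simp del: relpow.simps)
    then have "(v, x) \<in> edges G ^^ n" by (rule relpow_sym[OF sym_edges])
    then have "z \<in> far_class n v"
      using relpow_col edge_col[OF z(1)] edges_sub z by (auto simp: far_class_def)
    then obtain u where u: "nb_walk (edges G) u" "last u = v" "hd u = z" "length u \<le> n"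
      using cover[OF v] by (auto simp: walks_from_def)
    then obtain u' where u': "u = z # u'" by (cases u) auto
    show False
    proof (cases "u' \<noteq> [] \<and> hd u' = x")
      case True
      then have "nb_walk (edges G) u'" "last u' = v" "hd u' = x" "length u' < n"
        using u u' by (auto dest: nb_walk_tl)
      then show False using far[of "length u' - 1"] nb_walk_relpow[of "edges G" u']
          relpow_sym[OF sym_edges] by fastforce
    next
      case False
      then have "nb_walk (edges G) (x # u)" using u u' z by auto
      then have "x # u = w"
        using u w wxy v by (intro nb_walk_unique[OF edges_sub sym_edges long]) auto
      then show False using wxy u' z by auto
    qed
  qed
  then obtain c where "is_cycle G c" "length c \<le> 2 * n" by blast
  then have "girth G \<le> enat (2 * n)"
    unfolding girth_def by (intro INF_lower2[of c]) auto
  moreover have "enat (2 * n) \<le> girth G"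
    unfolding girth_def using cyc by (intro INF_greatest) auto
  ultimately show "girth G = enat (2 * n)" by simp
qed

end

lemma girth_le_cycle: "girth G = enat m \<Longrightarrow> is_cycle G c \<Longrightarrow> m \<le> length c"
  using INF_lower[of c "{c. is_cycle G c}" "\<lambda>c. enat (length c)"] by (simp add: girth_def)

section \<open>Invariance under isomorphism\<close>

lemma graph_iso_sym:
  assumes "graph_iso f G H"
  shows "graph_iso (inv_into (verts G) f) H G"
proof -
  have f: "bij_betw f (verts G) (verts H)" using assms by (simp add: graph_iso_def)
  have "(u, v) \<in> edges H \<longleftrightarrow>
      (inv_into (verts G) f u, inv_into (verts G) f v) \<in> edges G"
    if "u \<in> verts H" "v \<in> verts H" for u v
  proof -
    have "inv_into (verts G) f w \<in> verts G \<and> f (inv_into (verts G) f w) = w"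
      if "w \<in> verts H" for w
      using bij_betw_inv_into_right[OF f that] bij_betw_inv_into[OF f] that
      by (auto dest: bij_betwE)
    note inv = this[OF that(1)] this[OF that(2)]
    have "(inv_into (verts G) f u, inv_into (verts G) f v) \<in> edges G \<longleftrightarrow>
      (f (inv_into (verts G) f u), f (inv_into (verts G) f v)) \<in> edges H"
      using assms inv unfolding graph_iso_def by blast
    with inv show ?thesis by simp
  qed
  then show ?thesis using bij_betw_inv_into[OF f] by (simp add: graph_iso_def)
qed

lemma graph_iso_relpow:
  assumes "graph_iso f G H" "edges G \<subseteq> verts G \<times> verts G"
  shows "(u, v) \<in> edges G ^^ k \<Longrightarrow> (f u, f v) \<in> edges H ^^ k"
proof (induction k arbitrary: v)
  case (Suc k)
  then obtain y where "(u, y) \<in> edges G ^^ k" "(y, v) \<in> edges G" by auto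
  moreover then have "(f y, f v) \<in> edges H" using assms by (auto simp: graph_iso_def)
  ultimately show ?case using Suc.IH by auto
qed auto

lemma graph_iso_diameter_le:
  assumes "graph_iso f G H" "edges H \<subseteq> verts H \<times> verts H" "diameter H \<le> enat k"
  shows "diameter G \<le> enat k"
  unfolding diameter_le_iff
proof (intro ballI)
  fix u v assume uv: "u \<in> verts G" "v \<in> verts G"
  let ?g = "inv_into (verts G) f"
  have f: "bij_betw f (verts G) (verts H)" using assms(1) by (simp add: graph_iso_def)
  then have "f u \<in> verts H" "f v \<in> verts H" using uv by (auto simp: bij_betw_def)
  then obtain j where j: "j \<le> k" "(f u, f v) \<in> edges H ^^ j"
    using assms(3) by (auto simp: diameter_le_iff)
  have "(?g (f u), ?g (f v)) \<in> edges G ^^ j"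
    by (rule graph_iso_relpow[OF graph_iso_sym[OF assms(1)] assms(2) j(2)])
  then show "\<exists>j\<le>k. (u, v) \<in> edges G ^^ j"
    using j(1) f uv by (auto simp: bij_betw_def)
qed

lemma enat_eqI_le:
  assumes "\<And>k. a \<le> enat k \<longleftrightarrow> b \<le> enat k"
  shows "a = b"
proof (rule antisym)
  show "a \<le> b" using assms by (cases b) auto
  show "b \<le> a" using assms by (cases a) auto
qed

lemma graph_iso_diameter:
  assumes "graph_iso f G H" "edges G \<subseteq> verts G \<times> verts G" "edges H \<subseteq> verts H \<times> verts H"
  shows "diameter G = diameter H"
  using graph_iso_diameter_le[OF assms(1,3)]
    graph_iso_diameter_le[OF graph_iso_sym[OF assms(1)] assms(2)]
  by (intro enat_eqI_le) blast

lemma graph_iso_is_cycle: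
  assumes "graph_iso f G H" "is_cycle G c"
  shows "is_cycle H (map f c)"
proof -
  have c: "c \<noteq> []" "length c \<noteq> 2" "distinct c" "set c \<subseteq> verts G"
    "\<And>i. i < length c \<Longrightarrow> (c ! i, c ! (Suc i mod length c)) \<in> edges G"
    using assms(2) by (auto simp: is_cycle_def)
  have f: "bij_betw f (verts G) (verts H)" using assms(1) by (simp add: graph_iso_def)
  have "(map f c ! i, map f c ! (Suc i mod length c)) \<in> edges H" if "i < length c" for i
  proof -
    have "Suc i mod length c < length c" using c(1) by simp
    then show ?thesis using c(4) c(5)[OF that] that assms(1)
      by (auto simp: graph_iso_def subset_iff)
  qed
  moreover have "distinct (map f c)"
    using c f by (auto simp: distinct_map bij_betw_def intro: inj_on_subset)
  moreover have "set (map f c) \<subseteq> verts H" using c f by (auto simp: bij_betw_def)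
  ultimately show ?thesis using c by (auto simp: is_cycle_def)
qed

lemma graph_iso_girth_le:
  assumes "graph_iso f G H"
  shows "girth H \<le> girth G"
  unfolding girth_def
proof (rule INF_greatest)
  fix c assume "c \<in> {c. is_cycle G c}"
  then show "(INF c \<in> {c. is_cycle H c}. enat (length c)) \<le> enat (length c)"
    using graph_iso_is_cycle[OF assms] by (intro INF_lower2[of "map f c"]) auto
qed

lemma graph_iso_girth: "graph_iso f G H \<Longrightarrow> girth G = girth H"
  by (meson antisym graph_iso_girth_le graph_iso_sym)

lemma graph_iso_order: "graph_iso f G H \<Longrightarrow> order G = order H"
  by (auto simp: graph_iso_def Defs.order_def dest: bij_betw_same_card)

lemma graph_iso_degree:
  assumes "graph_iso f G H"
  shows "degree G = degree H"
proof -
  have f: "bij_betw f (verts G) (verts H)" using assms by (simp add: graph_iso_def)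
  have "vertex_degree H (f v) = vertex_degree G v" if v: "v \<in> verts G" for v
  proof -
    have "{w \<in> verts H. (f v, w) \<in> edges H} = f ` {w \<in> verts G. (v, w) \<in> edges G}"
    proof (intro equalityI subsetI)
      fix x assume x: "x \<in> {w \<in> verts H. (f v, w) \<in> edges H}"
      then obtain w where "w \<in> verts G" "x = f w" using f by (auto simp: bij_betw_def)
      then show "x \<in> f ` {w \<in> verts G. (v, w) \<in> edges G}"
        using x v assms by (auto simp: graph_iso_def)
    next
      fix x assume "x \<in> f ` {w \<in> verts G. (v, w) \<in> edges G}"
      then show "x \<in> {w \<in> verts H. (f v, w) \<in> edges H}"
        using v assms bij_betwE[OF f] by (auto simp: graph_iso_def)
    qed
    moreover have "inj_on f {w \<in> verts G. (v, w) \<in> edges G}"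
      using f by (auto simp: bij_betw_def intro: inj_on_subset)
    ultimately show ?thesis by (simp add: vertex_degree_def card_image)
  qed
  moreover have "verts H = f ` verts G" using f by (simp add: bij_betw_def)
  ultimately have "vertex_degree H ` verts H = vertex_degree G ` verts G"
    by (simp add: image_image cong: image_cong)
  then show ?thesis by (simp add: Defs.degree_def)
qed

section \<open>The polarity quotient of a polygon\<close>

locale polar_polygon = regular_bipartite G col q
  for G :: "'v bigraph" and col :: "'v \<Rightarrow> bool" and q :: nat +
  fixes n :: nat and \<rho> :: "'v \<Rightarrow> 'v"
  assumes parts: "part1 G = {v \<in> verts G. col v}" "part2 G = {v \<in> verts G. \<not> col v}"
    and polar: "polarity G \<rho>"
    and diam: "diameter G = enat n"
    and girth_ge: "is_cycle G c \<Longrightarrow> 2 * n \<le> length c"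
    and n3: "3 \<le> n" and q1: "1 \<le> q"
begin

lemma rho_verts [simp]: "v \<in> verts G \<Longrightarrow> \<rho> v \<in> verts G"
  using polar by (auto simp: polarity_def graph_iso_def bij_betw_def)

lemma rho_rho [simp]: "v \<in> verts G \<Longrightarrow> \<rho> (\<rho> v) = v"
  using polar by (auto simp: polarity_def)

lemma rho_edge: "(u, v) \<in> edges G \<Longrightarrow> (\<rho> u, \<rho> v) \<in> edges G"
  using polar edges_sub by (auto simp: polarity_def graph_iso_def)

lemma rho_col [simp]: "v \<in> verts G \<Longrightarrow> col (\<rho> v) \<longleftrightarrow> \<not> col v"
proof -
  assume v: "v \<in> verts G"
  have "\<rho> ` part1 G = part2 G" "\<rho> ` part2 G = part1 G" using polar by (auto simp: polarity_def)
  then show ?thesis using v unfolding parts by blast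
qed

lemma rho_pow: "v \<in> verts G \<Longrightarrow> (\<rho> ^^ k) v \<in> verts G \<and> (col ((\<rho> ^^ k) v) \<longleftrightarrow> (col v \<longleftrightarrow> even k))
    \<and> (\<rho> ^^ k) ((\<rho> ^^ k) v) = v"
proof (induction k)
  case (Suc k)
  have "(\<rho> ^^ Suc k) ((\<rho> ^^ Suc k) v) = (\<rho> ^^ k) (\<rho> (\<rho> ((\<rho> ^^ k) v)))"
    by (simp add: funpow_swap1)
  with Suc show ?case by simp
qed auto

lemma rho_pow_edge: "(u, v) \<in> edges G \<Longrightarrow> ((\<rho> ^^ k) u, (\<rho> ^^ k) v) \<in> edges G"
  by (induction k) (auto intro: rho_edge)

text \<open>
  The polarity quotient with loops, transported to the first part: every orbit of \<open>\<rho>\<close> contains exactly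
  one vertex of \<open>part1 G\<close>.
\<close>
definition polar_rel :: "('v \<times> 'v) set" where
  "polar_rel = {(u, v). u \<in> part1 G \<and> v \<in> part1 G \<and> (u, \<rho> v) \<in> edges G}"

text \<open>
  Applying \<open>\<rho>\<close> to every second vertex turns a walk of the quotient into a walk of the polygon, and
  conversely.
\<close>
lemma polar_rel_relpow:
  "(u, v) \<in> polar_rel ^^ k \<and> u \<in> part1 G \<longleftrightarrow>
    u \<in> part1 G \<and> v \<in> part1 G \<and> (u, (\<rho> ^^ k) v) \<in> edges G ^^ k"
proof (induction k arbitrary: v)
  case (Suc k)
  show ?case
  proof safe
    assume u: "u \<in> part1 G" "(u, v) \<in> polar_rel ^^ Suc k"
    then obtain y where y: "(u, y) \<in> polar_rel ^^ k" "(y, v) \<in> polar_rel" by auto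
    then show "v \<in> part1 G" by (auto simp: polar_rel_def)
    have "(u, (\<rho> ^^ k) y) \<in> edges G ^^ k" using Suc.IH u y by blast
    moreover have "((\<rho> ^^ k) y, (\<rho> ^^ k) (\<rho> v)) \<in> edges G"
      using y by (intro rho_pow_edge) (auto simp: polar_rel_def)
    ultimately show "(u, (\<rho> ^^ Suc k) v) \<in> edges G ^^ Suc k"
      by (auto simp: funpow_swap1)
  next
    assume u: "u \<in> part1 G" "v \<in> part1 G" "(u, (\<rho> ^^ Suc k) v) \<in> edges G ^^ Suc k"
    then obtain z where z: "(u, z) \<in> edges G ^^ k" "(z, (\<rho> ^^ k) (\<rho> v)) \<in> edges G"
      by (auto simp: funpow_swap1)
    then have zV: "z \<in> verts G" using edges_sub by auto
    have "col z \<longleftrightarrow> even k" using relpow_col[OF z(1)] u by (auto simp: parts)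
    then have p1: "(\<rho> ^^ k) z \<in> part1 G" and zz: "(\<rho> ^^ k) ((\<rho> ^^ k) z) = z"
      using rho_pow[OF zV, of k] by (auto simp: parts)
    have "\<rho> v \<in> verts G" using u by (auto simp: parts)
    then have "((\<rho> ^^ k) z, \<rho> v) \<in> edges G"
      using rho_pow_edge[OF z(2), of k] rho_pow[of "\<rho> v" k] by auto
    then have "((\<rho> ^^ k) z, v) \<in> polar_rel" using u p1 by (auto simp: polar_rel_def)
    moreover have "(u, (\<rho> ^^ k) z) \<in> polar_rel ^^ k"
      using Suc.IH[of "(\<rho> ^^ k) z"] u p1 zz z by auto
    ultimately show "(u, v) \<in> polar_rel ^^ Suc k" by auto
  qed
qed auto

lemma extend_walk: "(u, v) \<in> edges G ^^ k \<Longrightarrow> u \<in> verts G \<Longrightarrow> (u, v) \<in> edges G ^^ (k + 2 * j)"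
proof (induction j)
  case (Suc j)
  then have "v \<in> verts G" by (auto intro: relpow_verts)
  then have "card {w. (v, w) \<in> edges G} \<noteq> 0" using card_nbrs by simp
  then obtain w where "(v, w) \<in> edges G" by (auto simp: card_eq_0_iff)
  then have "(v, w) \<in> edges G" "(w, v) \<in> edges G" using sym_edges by (auto dest: symD)
  with Suc show ?case by auto
qed auto

text \<open>
  All pairs are joined by walks of one common length, which is what makes the lemma usable for products.
\<close>
lemma polar_rel_far: 
  assumes "u \<in> part1 G" "v \<in> part1 G" shows "(u, v) \<in> polar_rel ^^ (n - 1)"
proof -
  let ?w = "(\<rho> ^^ (n - 1)) v"
  have uv: "u \<in> verts G" "v \<in> verts G" "col u" "col v" using assms by (auto simp: parts)
  have w: "?w \<in> verts G" "col ?w \<longleftrightarrow> even (n - 1)" using rho_pow[OF uv(2)] uv by auto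
  obtain k where k: "k \<le> n" "(u, ?w) \<in> edges G ^^ k"
    using eq_refl[OF diam] uv(1) w(1) unfolding diameter_le_iff by blast
  have "even k \<longleftrightarrow> even (n - 1)" using relpow_col[OF k(2)] w uv by auto
  moreover then have "k \<le> n - 1" using k(1) n3 by (cases "k = n") auto
  ultimately have "\<exists>j. n - 1 = k + 2 * j" by presburger
  then obtain j where "n - 1 = k + 2 * j" ..
  then have "(u, ?w) \<in> edges G ^^ (n - 1)" using extend_walk[OF k(2) uv(1)] by metis
  then show ?thesis using polar_rel_relpow assms by blast
qed

lemma card_parts:
  "finite (part1 G)" "card (part1 G) = (\<Sum>i<n. q ^ i)"
proof -
  have "verts G \<noteq> {}"
  proof
    assume "verts G = {}"
    then have "diameter G = 0" by (simp add: diameter_def bot_enat_def)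
    with diam n3 show False by (simp add: zero_enat_def)
  qed
  then obtain v where v: "v \<in> verts G" by blast
  define w where "w = (if col v = odd n then v else \<rho> v)"
  have w: "w \<in> verts G" "col w = odd n" using v by (auto simp: w_def)
  have "far_class n w = part1 G" using w by (auto simp: far_class_def parts)
  then show "finite (part1 G)" "card (part1 G) = (\<Sum>i<n. q ^ i)"
    using card_far_class[of n w] diam girth_ge w by auto
qed

text \<open>
  The diameter is attained, and a polarity moves the first of two opposite vertices into \<open>part1 G\<close>.
\<close>
lemma opposite_pair:
  "\<exists>u v. u \<in> part1 G \<and> v \<in> verts G \<and> (\<forall>k<n. (u, v) \<notin> edges G ^^ k)"
proof -
  have "\<not> diameter G \<le> enat (n - 1)" using diam n3 by auto
  then obtain u v where uv: "u \<in> verts G" "v \<in> verts G" "\<And>j. j \<le> n - 1 \<Longrightarrow> (u, v) \<notin> edges G ^^ j"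
    by (auto simp: diameter_le_iff)
  show ?thesis
  proof (cases "col u")
    case True
    then show ?thesis using uv n3 by (intro exI[of _ u] exI[of _ v]) (auto simp: parts)
  next
    case False
    have iso: "graph_iso \<rho> G G" using polar by (simp add: polarity_def)
    have "(\<rho> u, \<rho> v) \<notin> edges G ^^ k" if k: "k < n" for k
    proof
      assume "(\<rho> u, \<rho> v) \<in> edges G ^^ k"
      then have "(\<rho> (\<rho> u), \<rho> (\<rho> v)) \<in> edges G ^^ k"
        by (rule graph_iso_relpow[OF iso edges_sub])
      with uv k show False by auto
    qed
    then show ?thesis using uv False by (intro exI[of _ "\<rho> u"] exI[of _ "\<rho> v"]) (auto simp: parts)
  qed
qed

text \<open>
  A walk of length \<open>k\<close> in the quotient ends in \<open>part1 G\<close> or \<open>part2 G\<close> of the polygon according to the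
  parity of \<open>k\<close>. So it suffices to find in the prescribed part a vertex at distance at least \<open>n - 1\<close>
  from \<open>u\<close>: the opposite vertex \<open>v\<close> or a neighbour of it.
\<close>
lemma polar_rel_no_short:
  "\<exists>u v. u \<in> part1 G \<and> v \<in> part1 G \<and>
    (\<forall>k<n - 1. (even k \<longleftrightarrow> b) \<longrightarrow> (u, v) \<notin> polar_rel ^^ k)"
proof -
  obtain u v where uv: "u \<in> part1 G" "v \<in> verts G" and far: "\<And>k. k < n \<Longrightarrow> (u, v) \<notin> edges G ^^ k"
    using opposite_pair by blast
  have "card {w. (v, w) \<in> edges G} \<noteq> 0" using card_nbrs uv by simp
  then obtain v' where v': "(v, v') \<in> edges G" by (auto simp: card_eq_0_iff)
  then have v'V: "v' \<in> verts G" using edges_sub by auto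
  have far': "(u, v') \<notin> edges G ^^ k" if "k < n - 1" for k
  proof
    assume "(u, v') \<in> edges G ^^ k"
    moreover have "(v', v) \<in> edges G" using v' sym_edges by (auto dest: symD)
    ultimately have "(u, v) \<in> edges G ^^ Suc k" by auto
    moreover have "Suc k < n" using that by simp
    ultimately show False using far by blast
  qed
  define w where "w = (if col v = b then v else v')"
  have w: "w \<in> verts G" "col w = b" using uv v'V edge_col[OF v'] by (auto simp: w_def)
  have farw: "(u, w) \<notin> edges G ^^ k" if "k < n - 1" for k
    using far[of k] far'[of k] that by (auto simp: w_def)
  define x where "x = (if b then w else \<rho> w)"
  have x: "x \<in> part1 G" using w by (auto simp: x_def parts)
  have pow: "(\<rho> ^^ k) x = w" if "even k = b" for k
  proof -
    have "(\<rho> ^^ (2 * m)) y = y" if "y \<in> verts G" for m y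
      using that by (induction m) auto
    then have *: "even j \<Longrightarrow> y \<in> verts G \<Longrightarrow> (\<rho> ^^ j) y = y" for j y by (auto elim!: evenE)
    show ?thesis
    proof (cases b)
      case True
      then show ?thesis using * that w by (auto simp: x_def)
    next
      case False
      then obtain j where "k = Suc j" "even j" using \<open>even k = b\<close> by (auto elim!: oddE)
      then show ?thesis using * False w by (auto simp: x_def)
    qed
  qed
  have "(u, x) \<notin> polar_rel ^^ k" if "k < n - 1" "even k = b" for k
    using polar_rel_relpow[of u x k] pow[of k] farw[of k] that uv by auto
  then show ?thesis using uv x by blast
qed

lemma card_polar_nbrs:
  assumes "u \<in> part1 G"
  shows "finite {v. (u, v) \<in> polar_rel}" "card {v. (u, v) \<in> polar_rel} = q + 1"
proof -
  have u: "u \<in> verts G" "col u" using assms by (auto simp: parts)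
  have "{v. (u, v) \<in> polar_rel} = \<rho> ` {w. (u, w) \<in> edges G}"
  proof (intro equalityI subsetI)
    fix v assume "v \<in> {v. (u, v) \<in> polar_rel}"
    then show "v \<in> \<rho> ` {w. (u, w) \<in> edges G}"
      by (intro image_eqI[of _ _ "\<rho> v"]) (auto simp: polar_rel_def parts)
  next
    fix v assume "v \<in> \<rho> ` {w. (u, w) \<in> edges G}"
    then obtain w where "(u, w) \<in> edges G" "v = \<rho> w" by auto
    then show "v \<in> {v. (u, v) \<in> polar_rel}"
      using u edge_col[of u w] edges_sub by (auto simp: polar_rel_def parts)
  qed
  moreover have "inj_on \<rho> {w. (u, w) \<in> edges G}"
    using edges_sub by (intro inj_on_inverseI[of _ \<rho>]) auto
  ultimately show "finite {v. (u, v) \<in> polar_rel}" "card {v. (u, v) \<in> polar_rel} = q + 1"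
    using finite_nbrs[OF u(1)] card_nbrs[OF u(1)] by (auto simp: card_image)
qed

text \<open>
  If all points were absolute, take a line \<open>\<rho> x\<close>, its pole \<open>x\<close>, which lies on it, and another point \<open>p\<close>
  on it. Then \<open>\<rho> p\<close> passes through \<open>x\<close> and \<open>p\<close> but differs from \<open>\<rho> x\<close>, a quadrilateral.
\<close>
lemma nonabsolute: "\<exists>u \<in> part1 G. (u, u) \<notin> polar_rel"
proof (rule ccontr)
  assume "\<not> ?thesis"
  then have abs: "(u, \<rho> u) \<in> edges G" if "u \<in> part1 G" for u
    using that by (auto simp: polar_rel_def)
  obtain x where x: "x \<in> part1 G" using opposite_pair by blast
  then have xV: "x \<in> verts G" "col x" by (auto simp: parts)
  have xl: "(\<rho> x, x) \<in> edges G" using abs[OF x] sym_edges by (auto dest: symD)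
  have l: "\<rho> x \<in> verts G" using xV by simp
  have "card ({p. (\<rho> x, p) \<in> edges G} - {x}) > 0"
    using card_nbrs[OF l] finite_nbrs[OF l] xl q1 by simp
  then obtain p where p: "(\<rho> x, p) \<in> edges G" "p \<noteq> x" by (auto simp: card_gt_0_iff)
  have pV: "p \<in> verts G" using p edges_sub by auto
  have "col p" using edge_col[OF p(1)] xV by auto
  then have pp: "(p, \<rho> p) \<in> edges G" using abs pV by (auto simp: parts)
  have "(\<rho> (\<rho> x), \<rho> p) \<in> edges G" using p(1) by (rule rho_edge)
  then have xp: "(x, \<rho> p) \<in> edges G" using xV by simp
  have "\<rho> p \<noteq> \<rho> x" using p(2) rho_rho[OF pV] rho_rho[OF xV(1)] by auto
  moreover have "\<rho> x \<noteq> x" "\<rho> p \<noteq> p" "\<rho> x \<noteq> p" "\<rho> p \<noteq> x"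
    using rho_col[OF xV(1)] rho_col[OF pV] xV(2) \<open>col p\<close> by (metis (full_types))+
  moreover have "(\<rho> p, p) \<in> edges G" "(p, \<rho> x) \<in> edges G"
    using pp p(1) sym_edges by (auto dest: symD)
  ultimately have "is_cycle G [\<rho> x, x, \<rho> p, p]"
    using xl xp p xV pV l by (auto simp: is_cycle_def less_Suc_eq)
  from girth_ge[OF this] n3 show False by simp
qed

end

section \<open>Products of polarity quotients\<close>

text \<open>
  Loops only waste steps of a walk.
\<close>
lemma relpow_minus_Id:
  fixes R :: "('a \<times> 'a) set"
  shows "(x, y) \<in> R ^^ k \<Longrightarrow> \<exists>j\<le>k. (x, y) \<in> {(u, v) \<in> R. u \<noteq> v} ^^ j"
proof (induction k arbitrary: y)
  case (Suc k)
  then obtain z where z: "(x, z) \<in> R ^^ k" "(z, y) \<in> R" by auto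
  from Suc.IH[OF z(1)] obtain j where j: "j \<le> k" "(x, z) \<in> {(u, v) \<in> R. u \<noteq> v} ^^ j" by blast
  show ?case
  proof (cases "z = y")
    case True
    with j show ?thesis by (intro exI[of _ j]) auto
  next
    case False
    with j z show ?thesis by (intro exI[of _ "Suc j"]) auto
  qed
qed auto

lemma relpow_mono: "(R :: ('a \<times> 'a) set) \<subseteq> S \<Longrightarrow> R ^^ k \<subseteq> S ^^ k"
  by (induction k) auto

definition loopless_product :: "'u set \<Rightarrow> ('u \<times> 'u) set \<Rightarrow> 'w set \<Rightarrow> ('w \<times> 'w) set \<Rightarrow> ('u \<times> 'w) graph" where
  "loopless_product A R B S = \<lparr>verts = A \<times> B,
     edges = {(x, y). (fst x, fst y) \<in> R \<and> (snd x, snd y) \<in> S \<and> x \<noteq> y}\<rparr>"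

text \<open>
  Walks in a Kronecker product are pairs of walks of the same length.
\<close>
lemma prod_relpow:
  fixes R :: "('u \<times> 'u) set" and S :: "('w \<times> 'w) set"
  shows "((u, w), (u', w')) \<in> {(x, y). (fst x, fst y) \<in> R \<and> (snd x, snd y) \<in> S} ^^ k \<longleftrightarrow>
    (u, u') \<in> R ^^ k \<and> (w, w') \<in> S ^^ k"
proof (induction k arbitrary: u' w')
  case (Suc k)
  show ?case
  proof safe
    assume "((u, w), (u', w')) \<in> {(x, y). (fst x, fst y) \<in> R \<and> (snd x, snd y) \<in> S} ^^ Suc k"
    then obtain y z where "((u, w), (y, z)) \<in> {(x, y). (fst x, fst y) \<in> R \<and> (snd x, snd y) \<in> S} ^^ k"
      "(y, u') \<in> R" "(z, w') \<in> S" by auto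
    then show "(u, u') \<in> R ^^ Suc k" "(w, w') \<in> S ^^ Suc k" using Suc.IH by auto
  next
    assume "(u, u') \<in> R ^^ Suc k" "(w, w') \<in> S ^^ Suc k"
    then obtain y z where "(u, y) \<in> R ^^ k" "(y, u') \<in> R" "(w, z) \<in> S ^^ k" "(z, w') \<in> S" by auto
    then show "((u, w), (u', w')) \<in> {(x, y). (fst x, fst y) \<in> R \<and> (snd x, snd y) \<in> S} ^^ Suc k"
      using Suc.IH by (auto intro!: relcompI[of _ "(y, z)"])
  qed
qed auto

locale polar_polygon_pair =
  H: polar_polygon G col q n \<rho> + K: polar_polygon G' col' r n \<rho>'
  for G :: "'v bigraph" and col q n \<rho> and G' :: "'w bigraph" and col' r \<rho>'
begin

definition quotient :: "('v \<times> 'w) set graph" where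
  "quotient = delete_loops (polarity_quotient (G \<odot> G') (composed_polarity \<rho> \<rho>'))"

text \<open>
  The composed quotient with one representative chosen in each orbit.
\<close>
definition model :: "('v \<times> 'w) graph" where
  "model = loopless_product (part1 G) H.polar_rel (part1 G') K.polar_rel"

definition orbit :: "'v \<times> 'w \<Rightarrow> ('v \<times> 'w) set" where
  "orbit x = {x, composed_polarity \<rho> \<rho>' x}"

text \<open>
  Orbits of \<open>x\<close> and \<open>y\<close> are adjacent if one of the four pairs of representatives is. Two of these pairs
  lie within one part, and the remaining two are exchanged by the composed polarity.
\<close>
lemma model_iso_quotient: "graph_iso orbit model quotient"
proof -
  let ?c = "composed_polarity \<rho> \<rho>'"
  let ?A = "part1 G \<times> part1 G'" and ?B = "part2 G \<times> part2 G'"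
  have vp: "verts (G \<odot> G') = ?A \<union> ?B"
    by (auto simp: component_product_def induced_subgraph_def kronecker_product_def H.parts K.parts)
  have ep: "edges (G \<odot> G') = {((a, b), (c, d)). (a, c) \<in> edges G \<and> (b, d) \<in> edges G' \<and>
      (a, b) \<in> ?A \<union> ?B \<and> (c, d) \<in> ?A \<union> ?B}"
    by (auto simp: component_product_def induced_subgraph_def kronecker_product_def)
  have cA: "?c x \<in> ?B" "?c (?c x) = x" if "x \<in> ?A" for x
    using that by (auto simp: composed_polarity_def H.parts K.parts)
  have cB: "?c x \<in> ?A" "?c (?c x) = x" if "x \<in> ?B" for x
    using that by (auto simp: composed_polarity_def H.parts K.parts)
  have disj: "?A \<inter> ?B = {}" by (auto simp: H.parts)
  have verts_q: "verts quotient = orbit ` ?A"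
  proof -
    have "verts quotient = orbit ` (?A \<union> ?B)"
      by (simp add: quotient_def delete_loops_def polarity_quotient_def Let_def vp orbit_def)
    moreover have "orbit x \<in> orbit ` ?A" if "x \<in> ?B" for x
      using cB[OF that] by (intro image_eqI[of _ _ "?c x"]) (auto simp: orbit_def)
    ultimately show ?thesis by auto
  qed
  have orbit_inj: "x = y" if "orbit x = orbit y" "x \<in> ?A" "y \<in> ?A" for x y
  proof -
    have "x \<in> {y, ?c y}" using that(1) by (auto simp: orbit_def)
    then show ?thesis using cA[OF that(3)] that disj by auto
  qed
  have edge: "(x, y) \<in> edges model \<longleftrightarrow> (orbit x, orbit y) \<in> edges quotient"
    if xA: "x \<in> ?A" and yA: "y \<in> ?A" for x y
  proof -
    obtain u u' v v' where xy: "x = (u, u')" "y = (v, v')" by (cases x; cases y)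
    have uv: "u \<in> part1 G" "u' \<in> part1 G'" "v \<in> part1 G" "v' \<in> part1 G'" using xA yA xy by auto
    have V: "u \<in> verts G" "v \<in> verts G" "u' \<in> verts G'" "v' \<in> verts G'" "col u" "col v" "col' u'" "col' v'"
      using uv by (auto simp: H.parts K.parts)
    have "(orbit x, orbit y) \<in> edges quotient \<longleftrightarrow>
      orbit x \<noteq> orbit y \<and> (\<exists>a\<in>orbit x. \<exists>b\<in>orbit y. (a, b) \<in> edges (G \<odot> G'))"
      using xA yA vp by (auto simp: quotient_def delete_loops_def polarity_quotient_def Let_def orbit_def)
    also have "orbit x \<noteq> orbit y \<longleftrightarrow> x \<noteq> y" using orbit_inj xA yA by blast
    also have "(\<exists>a\<in>orbit x. \<exists>b\<in>orbit y. (a, b) \<in> edges (G \<odot> G')) \<longleftrightarrow>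
      (u, \<rho> v) \<in> edges G \<and> (u', \<rho>' v') \<in> edges G'" (is "?L \<longleftrightarrow> ?R")
    proof
      assume ?R
      then show ?L using uv cA[OF yA] xy
        by (auto simp: orbit_def composed_polarity_def ep)
    next
      assume ?L
      then consider "(u, v) \<in> edges G" | "(\<rho> u, \<rho> v) \<in> edges G" | ?R
        | "(\<rho> u, v) \<in> edges G" "(\<rho>' u', v') \<in> edges G'"
        by (auto simp: orbit_def composed_polarity_def ep xy)
      then show ?R
      proof cases
        case 1 then show ?thesis using H.edge_col V by blast
      next
        case 2 then show ?thesis using H.edge_col V H.rho_col by blast
      next
        case 4
        then show ?thesis using H.rho_edge[OF 4(1)] K.rho_edge[OF 4(2)] V by simp
      qed
    qed
    finally show ?thesis using uv xy
      by (auto simp: model_def loopless_product_def H.polar_rel_def K.polar_rel_def)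
  qed
  have vm: "verts model = ?A" by (simp add: model_def loopless_product_def)
  show ?thesis unfolding graph_iso_def bij_betw_def vm verts_q
    using edge orbit_inj by (auto simp: inj_on_def)
qed

lemma edges_quotient_sub: "edges quotient \<subseteq> verts quotient \<times> verts quotient"
  by (auto simp: quotient_def delete_loops_def polarity_quotient_def Let_def)

lemma edges_model_sub: "edges model \<subseteq> verts model \<times> verts model"
  by (auto simp: model_def loopless_product_def H.polar_rel_def K.polar_rel_def)

lemma order_quotient: "order quotient = (\<Sum>i<n. q ^ i) * (\<Sum>i<n. r ^ i)"
proof -
  have "order model = (\<Sum>i<n. q ^ i) * (\<Sum>i<n. r ^ i)"
    using H.card_parts K.card_parts
    by (simp add: Defs.order_def model_def loopless_product_def card_cartesian_product)
  then show ?thesis using graph_iso_order[OF model_iso_quotient] by simp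
qed

text \<open>
  All neighbourhoods have \<open>(q + 1) (r + 1)\<close> elements before the loops are deleted; a non-absolute point
  in one factor suffices to avoid a loop.
\<close>
lemma degree_quotient: "degree quotient = (q + 1) * (r + 1)"
proof -
  let ?N = "\<lambda>u w. {v. (u, v) \<in> H.polar_rel} \<times> {v. (w, v) \<in> K.polar_rel}"
  have deg: "vertex_degree model (u, w) = card (?N u w - {(u, w)})"
    if "u \<in> part1 G" "w \<in> part1 G'" for u w
    unfolding vertex_degree_def
    by (rule arg_cong[of _ _ card])
      (auto simp: model_def loopless_product_def H.polar_rel_def K.polar_rel_def)
  have card_N: "finite (?N u w)" "card (?N u w) = (q + 1) * (r + 1)"
    if "u \<in> part1 G" "w \<in> part1 G'" for u w
    using H.card_polar_nbrs[OF that(1)] K.card_polar_nbrs[OF that(2)]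
    by (auto simp: card_cartesian_product)
  obtain u where u: "u \<in> part1 G" "(u, u) \<notin> H.polar_rel" using H.nonabsolute by blast
  obtain w where w: "w \<in> part1 G'" using K.nonabsolute by blast
  have vm: "verts model = part1 G \<times> part1 G'" by (simp add: model_def loopless_product_def)
  have "degree model = (q + 1) * (r + 1)"
    unfolding Defs.degree_def
  proof (rule Max_eqI)
    show "finite (vertex_degree model ` verts model)"
      using H.card_parts K.card_parts vm by simp
    show "d \<le> (q + 1) * (r + 1)" if "d \<in> vertex_degree model ` verts model" for d
    proof -
      obtain a b where ab: "a \<in> part1 G" "b \<in> part1 G'" "d = vertex_degree model (a, b)"
        using \<open>d \<in> vertex_degree model ` verts model\<close> vm by auto
      have "d \<le> card (?N a b)" unfolding ab(3) deg[OF ab(1,2)] by (rule card_Diff1_le)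
      then show ?thesis unfolding card_N(2)[OF ab(1,2)] .
    qed
    have "vertex_degree model (u, w) = (q + 1) * (r + 1)"
      using deg[OF u(1) w] card_N[OF u(1) w] u by simp
    then show "(q + 1) * (r + 1) \<in> vertex_degree model ` verts model"
      using u w vm by (intro image_eqI[of _ _ "(u, w)"]) auto
  qed
  then show ?thesis using graph_iso_degree[OF model_iso_quotient] by simp
qed

text \<open>
  The first factor excludes walks of even length below \<open>n - 1\<close>, the second factor those of odd length.
\<close>
lemma diameter_quotient: "diameter quotient = enat (n - 1)"
proof -
  let ?P = "{(x, y). (fst x, fst y) \<in> H.polar_rel \<and> (snd x, snd y) \<in> K.polar_rel}"
  have em: "edges model = {(x, y) \<in> ?P. x \<noteq> y}"
    by (auto simp: model_def loopless_product_def)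
  have vm: "verts model = part1 G \<times> part1 G'" by (simp add: model_def loopless_product_def)
  obtain u v where uv: "u \<in> part1 G" "v \<in> part1 G"
    "\<And>k. k < n - 1 \<Longrightarrow> even k \<Longrightarrow> (u, v) \<notin> H.polar_rel ^^ k"
    using H.polar_rel_no_short[of True] by auto
  obtain u' v' where uv': "u' \<in> part1 G'" "v' \<in> part1 G'"
    "\<And>k. k < n - 1 \<Longrightarrow> odd k \<Longrightarrow> (u', v') \<notin> K.polar_rel ^^ k"
    using K.polar_rel_no_short[of False] by auto
  have "diameter model = enat (n - 1)"
  proof (rule diameter_eqI)
    fix x y assume "x \<in> verts model" "y \<in> verts model"
    then obtain a a' b b' where xy: "x = (a, a')" "y = (b, b')"
      "a \<in> part1 G" "a' \<in> part1 G'" "b \<in> part1 G" "b' \<in> part1 G'"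
      unfolding vm by blast
    have "(x, y) \<in> ?P ^^ (n - 1)"
      unfolding xy prod_relpow using H.polar_rel_far K.polar_rel_far xy by blast
    then show "\<exists>j\<le>n - 1. (x, y) \<in> edges model ^^ j"
      unfolding em by (rule relpow_minus_Id)
  next
    show "(u, u') \<in> verts model" "(v, v') \<in> verts model" using uv uv' vm by auto
    fix j assume j: "j < n - 1"
    have "edges model ^^ j \<subseteq> ?P ^^ j" unfolding em by (rule relpow_mono) auto
    moreover have "((u, u'), (v, v')) \<notin> ?P ^^ j"
      unfolding prod_relpow using uv(3)[OF j] uv'(3)[OF j] by blast
    ultimately show "((u, u'), (v, v')) \<notin> edges model ^^ j" by blast
  qed
  then show ?thesis
    using graph_iso_diameter[OF model_iso_quotient edges_model_sub edges_quotient_sub] by simp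
qed

end

text \<open>
  The two kinds of vertices of an incidence graph are the two colours.
\<close>
lemma polarized_polygon_locale:
  assumes "(\<Gamma>, \<rho>) \<in> polarized_polygons n q" "3 \<le> n"
  shows "polar_polygon (incidence_graph \<Gamma>) isl q n \<rho>"
proof -
  have q: "q \<ge> 1" and inc: "incidence \<Gamma> \<subseteq> points \<Gamma> \<times> lines \<Gamma>"
    and d: "diameter (incidence_graph \<Gamma>) = enat n"
    and g: "girth (incidence_graph \<Gamma>) = enat (2 * n)"
    and ord: "has_order \<Gamma> q q" and pol: "polarity (incidence_graph \<Gamma>) \<rho>"
    using assms(1) unfolding polarized_polygons_def generalized_polygon_def nonrotation_polarity_def
    by simp_all
  have nbr: "card {w. (v, w) \<in> edges (incidence_graph \<Gamma>)} = q + 1"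
    if v: "v \<in> verts (incidence_graph \<Gamma>)" for v
  proof (cases v)
    case (Inl p)
    have "{w. (v, w) \<in> edges (incidence_graph \<Gamma>)} = Inr ` {l \<in> lines \<Gamma>. (p, l) \<in> incidence \<Gamma>}"
      using inc unfolding incidence_graph_def Inl by auto
    moreover have "p \<in> points \<Gamma>" using v Inl by (auto simp: incidence_graph_def)
    ultimately show ?thesis using ord by (simp add: has_order_def card_image)
  next
    case (Inr l)
    have "{w. (v, w) \<in> edges (incidence_graph \<Gamma>)} = Inl ` {p \<in> points \<Gamma>. (p, l) \<in> incidence \<Gamma>}"
      using inc unfolding incidence_graph_def Inr by auto
    moreover have "l \<in> lines \<Gamma>" using v Inr by (auto simp: incidence_graph_def)
    ultimately show ?thesis using ord by (simp add: has_order_def card_image)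
  qed
  show ?thesis
  proof unfold_locales
    show "edges (incidence_graph \<Gamma>) \<subseteq> verts (incidence_graph \<Gamma>) \<times> verts (incidence_graph \<Gamma>)"
      using inc by (auto simp: incidence_graph_def)
    show "sym (edges (incidence_graph \<Gamma>))" by (auto simp: incidence_graph_def sym_def)
    show "isl u \<noteq> isl v" if "(u, v) \<in> edges (incidence_graph \<Gamma>)" for u v
      using that by (auto simp: incidence_graph_def)
    show "part1 (incidence_graph \<Gamma>) = {v \<in> verts (incidence_graph \<Gamma>). isl v}"
      "part2 (incidence_graph \<Gamma>) = {v \<in> verts (incidence_graph \<Gamma>). \<not> isl v}"
      by (auto simp: incidence_graph_def)
  qed (use nbr q d pol girth_le_cycle[OF g] assms(2) in auto)
qed

lemma graphs_from_properties:
  assumes "G \<in> graphs_from n q r" "3 \<le> n"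
  shows "diameter G = enat (n - 1)" "degree G = (q + 1) * (r + 1)"
    "order G = (\<Sum>i<n. q ^ i) * (\<Sum>i<n. r ^ i)"
proof -
  obtain \<Gamma> \<rho> \<Gamma>' \<rho>' where G: "G = delete_loops (polarity_quotient
      (incidence_graph \<Gamma> \<odot> incidence_graph \<Gamma>') (composed_polarity \<rho> \<rho>'))"
    "(\<Gamma>, \<rho>) \<in> polarized_polygons n q" "(\<Gamma>', \<rho>') \<in> polarized_polygons n r"
    using assms(1) by (auto simp: graphs_from_def)
  interpret polar_polygon_pair "incidence_graph \<Gamma>" isl q n \<rho> "incidence_graph \<Gamma>'" isl r \<rho>'
    unfolding polar_polygon_pair_def using G polarized_polygon_locale assms(2) by blast
  have "G = quotient" by (simp add: G(1) quotient_def)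
  then show "diameter G = enat (n - 1)" "degree G = (q + 1) * (r + 1)"
    "order G = (\<Sum>i<n. q ^ i) * (\<Sum>i<n. r ^ i)"
    using diameter_quotient degree_quotient order_quotient by auto
qed

section \<open>Realizing a polygon over a given infinite type\<close>

lemma one_lt_sum_powers:
  assumes "2 \<le> q" "2 \<le> n" shows "n < (\<Sum>i<n. q ^ i :: nat)"
proof -
  have "(\<Sum>i<n. 1) < (\<Sum>i<n. q ^ i)"
  proof (rule sum_strict_mono_ex1)
    show "\<forall>i\<in>{..<n}. 1 \<le> q ^ i" using assms by simp
    show "\<exists>i\<in>{..<n}. 1 < q ^ i" using assms by (intro bexI[of _ 1]) auto
  qed simp
  then show ?thesis by simp
qed

context polar_polygon
begin

lemma card_verts: "card (verts G) = 2 * (\<Sum>i<n. q ^ i)" "finite (verts G)"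
proof -
  have "part2 G = \<rho> ` part1 G" using polar by (simp add: polarity_def)
  moreover have "inj_on \<rho> (part1 G)" by (intro inj_on_inverseI[of _ \<rho>]) (simp add: parts)
  ultimately have "card (part2 G) = (\<Sum>i<n. q ^ i)" "finite (part2 G)"
    using card_parts by (simp_all add: card_image)
  moreover have "verts G = part1 G \<union> part2 G" "part1 G \<inter> part2 G = {}" by (auto simp: parts)
  ultimately show "card (verts G) = 2 * (\<Sum>i<n. q ^ i)" "finite (verts G)"
    using card_parts by (simp_all add: card_Un_disjoint)
qed

text \<open>
  Admissibility over \<open>'a\<close> asks for points and lines that are elements of \<open>'a\<close>; an injection of the
  finitely many vertices transports any polarized polygon there. For \<open>q \<ge> 2\<close> there are more than \<open>2n\<close>
  vertices, so the polygon is not a cycle and its polarity is not a rotation.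
\<close>
lemma admissible_of_model:
  assumes inf: "infinite (UNIV :: 'a set)" and q2: "2 \<le> q" and girth: "girth G = enat (2 * n)"
  shows "admissible TYPE('a) n q"
proof -
  obtain B :: "'a set" where "card B = card (verts G)" "finite B"
    using infinite_arbitrarily_large[OF inf] by blast
  then obtain \<iota> :: "'v \<Rightarrow> 'a" where "bij_betw \<iota> (verts G) B"
    using finite_same_card_bij[OF card_verts(2)] by metis
  then have inj: "inj_on \<iota> (verts G)" by (simp add: bij_betw_def)
  have inj_eq: "\<iota> x = \<iota> y \<longleftrightarrow> x = y" if "x \<in> verts G" "y \<in> verts G" for x y
    using inj that by (auto dest: inj_onD)
  define \<Gamma> where "\<Gamma> = \<lparr>points = \<iota> ` part1 G, lines = \<iota> ` part2 G,
    incidence = {(\<iota> x, \<iota> y) |x y. x \<in> part1 G \<and> y \<in> part2 G \<and> (x, y) \<in> edges G}\<rparr>"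
  let ?I = "incidence_graph \<Gamma>"
  define f where "f x = (if col x then Inl (\<iota> x) else Inr (\<iota> x))" for x
  have inj_f: "inj_on f (verts G)"
    using inj by (auto simp: inj_on_def f_def)
  have p1: "part1 ?I = f ` part1 G" and p2: "part2 ?I = f ` part2 G"
    by (auto simp: incidence_graph_def \<Gamma>_def f_def parts)
  have "verts ?I = part1 ?I \<union> part2 ?I" by (simp add: incidence_graph_def)
  then have vI: "verts ?I = f ` verts G" unfolding p1 p2 by (auto simp: parts)
  have edge: "(f u, f v) \<in> edges ?I \<longleftrightarrow> (u, v) \<in> edges G" if uv: "u \<in> verts G" "v \<in> verts G" for u v
  proof -
    have inc: "(\<iota> x, \<iota> y) \<in> incidence \<Gamma> \<longleftrightarrow> (x, y) \<in> edges G"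
      if "x \<in> verts G" "y \<in> verts G" "col x" "\<not> col y" for x y
      using that inj_eq by (auto simp: \<Gamma>_def parts)
    have eI: "edges ?I = {(Inl p, Inr l) |p l. (p, l) \<in> incidence \<Gamma>} \<union>
        {(Inr l, Inl p) |p l. (p, l) \<in> incidence \<Gamma>}"
      by (auto simp: incidence_graph_def)
    have sw: "(u, v) \<in> edges G \<longleftrightarrow> (v, u) \<in> edges G" using sym_edges by (auto dest: symD)
    show ?thesis
      using inc[OF uv] inc[OF uv(2,1)] edge_col[of u v] edge_col[of v u] sw unfolding eI f_def
      by (cases "col u"; cases "col v") (simp_all, blast+)
  qed
  have iso: "graph_iso f G ?I"
    unfolding graph_iso_def bij_betw_def using inj_f vI edge by simp
  have inc_sub: "incidence \<Gamma> \<subseteq> points \<Gamma> \<times> lines \<Gamma>" by (auto simp: \<Gamma>_def)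
  then have I_sub: "edges ?I \<subseteq> verts ?I \<times> verts ?I"
    by (auto simp: incidence_graph_def)
  have gp: "generalized_polygon n \<Gamma>"
    unfolding generalized_polygon_def
    using graph_iso_diameter[OF iso edges_sub I_sub] graph_iso_girth[OF iso] diam girth inc_sub
    by simp
  have nbr: "card (\<iota> ` {w. (v, w) \<in> edges G}) = q + 1" if v: "v \<in> verts G" for v
  proof -
    have "{w. (v, w) \<in> edges G} \<subseteq> verts G" using edges_sub by auto
    then show ?thesis using card_nbrs[OF v] card_image[OF inj_on_subset[OF inj]] by simp
  qed
  have ord: "has_order \<Gamma> q q"
    unfolding has_order_def
  proof (intro conjI ballI)
    fix l assume "l \<in> lines \<Gamma>"
    then obtain y where y: "y \<in> part2 G" "l = \<iota> y" by (auto simp: \<Gamma>_def)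
    then have yV: "y \<in> verts G" by (simp add: parts)
    have "{p \<in> points \<Gamma>. (p, l) \<in> incidence \<Gamma>} = \<iota> ` {w. (y, w) \<in> edges G}"
    proof (intro equalityI subsetI)
      fix p assume "p \<in> {p \<in> points \<Gamma>. (p, l) \<in> incidence \<Gamma>}"
      then obtain x y' where x: "p = \<iota> x" "l = \<iota> y'" "(x, y') \<in> edges G"
        by (auto simp: \<Gamma>_def)
      moreover then have "y' = y" using inj_eq[of y' y] yV y edges_sub by auto
      ultimately show "p \<in> \<iota> ` {w. (y, w) \<in> edges G}"
        using sym_edges by (auto dest: symD)
    next
      fix p assume "p \<in> \<iota> ` {w. (y, w) \<in> edges G}"
      then obtain x where x: "(y, x) \<in> edges G" "p = \<iota> x" by blast
      then have "x \<in> part1 G" "(x, y) \<in> edges G"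
        using edge_col[OF x(1)] edges_sub y sym_edges by (auto simp: parts dest: symD)
      then show "p \<in> {p \<in> points \<Gamma>. (p, l) \<in> incidence \<Gamma>}"
        using x y by (auto simp: \<Gamma>_def)
    qed
    then show "card {p \<in> points \<Gamma>. (p, l) \<in> incidence \<Gamma>} = q + 1" using nbr[OF yV] by simp
  next
    fix p assume "p \<in> points \<Gamma>"
    then obtain y where y: "y \<in> part1 G" "p = \<iota> y" by (auto simp: \<Gamma>_def)
    then have yV: "y \<in> verts G" by (simp add: parts)
    have "{l \<in> lines \<Gamma>. (p, l) \<in> incidence \<Gamma>} = \<iota> ` {w. (y, w) \<in> edges G}"
    proof (intro equalityI subsetI)
      fix l assume "l \<in> {l \<in> lines \<Gamma>. (p, l) \<in> incidence \<Gamma>}"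
      then obtain x y' where x: "l = \<iota> x" "p = \<iota> y'" "(y', x) \<in> edges G"
        by (auto simp: \<Gamma>_def)
      moreover then have "y' = y" using inj_eq[of y' y] yV y edges_sub by auto
      ultimately show "l \<in> \<iota> ` {w. (y, w) \<in> edges G}" by auto
    next
      fix l assume "l \<in> \<iota> ` {w. (y, w) \<in> edges G}"
      then obtain x where x: "(y, x) \<in> edges G" "l = \<iota> x" by blast
      then have "x \<in> part2 G"
        using edge_col[OF x(1)] edges_sub y by (auto simp: parts)
      then show "l \<in> {l \<in> lines \<Gamma>. (p, l) \<in> incidence \<Gamma>}"
        using x y by (auto simp: \<Gamma>_def)
    qed
    then show "card {l \<in> lines \<Gamma>. (p, l) \<in> incidence \<Gamma>} = q + 1" using nbr[OF yV] by simp
  qed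
  define \<sigma> where "\<sigma> y = f (\<rho> (inv_into (verts G) f y))" for y
  have sf: "\<sigma> (f x) = f (\<rho> x)" if "x \<in> verts G" for x
    using that inj_f by (simp add: \<sigma>_def)
  have pol: "polarity ?I \<sigma>"
    unfolding polarity_def
  proof (intro conjI ballI)
    have "bij_betw \<sigma> (f ` verts G) (f ` verts G)"
      by (rule bij_betw_byWitness[of _ \<sigma>]) (auto simp: sf)
    moreover have "(f u, f v) \<in> edges ?I \<longleftrightarrow> (f (\<rho> u), f (\<rho> v)) \<in> edges ?I"
      if uv: "u \<in> verts G" "v \<in> verts G" for u v
    proof -
      have "(u, v) \<in> edges G \<longleftrightarrow> (\<rho> u, \<rho> v) \<in> edges G"
        using rho_edge[of u v] rho_edge[of "\<rho> u" "\<rho> v"] rho_rho[OF uv(1)] rho_rho[OF uv(2)]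
        by auto
      then show ?thesis
        using edge[OF uv] edge[OF rho_verts[OF uv(1)] rho_verts[OF uv(2)]] by simp
    qed
    ultimately show "graph_iso \<sigma> ?I ?I"
      unfolding graph_iso_def vI by (auto simp only: sf ball_simps)
    show "\<sigma> (\<sigma> v) = v" if "v \<in> verts ?I" for v
      using that unfolding vI by (auto simp: sf)
    have "\<rho> ` part1 G = part2 G" "\<rho> ` part2 G = part1 G" using polar by (auto simp: polarity_def)
    moreover have "\<sigma> ` f ` A = f ` \<rho> ` A" if "A \<subseteq> verts G" for A
      unfolding image_image using that sf by (intro image_cong) auto
    moreover have "part1 G \<subseteq> verts G" "part2 G \<subseteq> verts G" by (auto simp: parts)
    ultimately show "\<sigma> ` part1 ?I = part2 ?I" "\<sigma> ` part2 ?I = part1 ?I"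
      unfolding p1 p2 by simp_all
  qed
  have "\<not> rotation_polarity n ?I \<sigma>"
  proof
    assume "rotation_polarity n ?I \<sigma>"
    then obtain \<phi> where "graph_iso \<phi> (cycle_graph (2 * n)) ?I"
      by (auto simp: rotation_polarity_def)
    then have "order (cycle_graph (2 * n)) = order ?I" by (rule graph_iso_order)
    also have "\<dots> = order G" using graph_iso_order[OF iso] by simp
    finally have "2 * n = 2 * (\<Sum>i<n. q ^ i)"
      by (simp add: Defs.order_def cycle_graph_def card_verts)
    with one_lt_sum_powers[OF q2, of n] n3 show False by simp
  qed
  then have "(\<Gamma>, \<sigma>) \<in> polarized_polygons n q"
    using gp ord pol q1 by (simp add: polarized_polygons_def nonrotation_polarity_def)
  then show ?thesis by (auto simp: admissible_def)
qed

end

section \<open>Coordinate graphs\<close>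

text \<open>
  A vertex of a coordinate graph is a pair of a tree \<open>s\<close> and a list of coordinates, the most recent
  coordinate first. The polarity exchanges the trees and transforms each coordinate: by \<open>\<theta>\<close> if the vertex
  described by the earlier coordinates lies in the first part, and by the inverse of \<open>\<theta>\<close> otherwise.
\<close>
fun twist :: "('f \<Rightarrow> 'f) \<Rightarrow> ('f \<Rightarrow> 'f) \<Rightarrow> bool \<Rightarrow> 'f list \<Rightarrow> 'f list" where
  "twist \<theta> \<theta>' s [] = []"
| "twist \<theta> \<theta>' s (x # w) = (if s = even (length w) then \<theta> x else \<theta>' x) # twist \<theta> \<theta>' s w"

lemma length_twist [simp]: "length (twist \<theta> \<theta>' s w) = length w"
  by (induction w) auto

text \<open>
  The tree \<open>s\<close> has as vertices the lists of length below \<open>n\<close>, and the parent of a list is its tail. The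
  two roots are joined, and leaves of the two trees are joined according to \<open>R\<close>, whose first argument
  is the leaf of the tree \<open>True\<close>. The parity of the length, combined with \<open>s\<close>, gives the two parts.
\<close>
definition coord_graph :: "'f set \<Rightarrow> nat \<Rightarrow> ('f list \<Rightarrow> 'f list \<Rightarrow> bool) \<Rightarrow> (bool \<times> 'f list) bigraph" where
  "coord_graph K n R = (let V = {(s, w). set w \<subseteq> K \<and> length w < n} in
    \<lparr>verts = V,
     edges = {((s, w), (t, u)) \<in> V \<times> V.
       (if s = t then \<exists>x. u = x # w \<or> w = x # u
        else w = [] \<and> u = [] \<or> length w = n - 1 \<and> length u = n - 1 \<and>
          (if s then R w u else R u w))},
     part1 = {(s, w) \<in> V. s = even (length w)}, part2 = {(s, w) \<in> V. s \<noteq> even (length w)}\<rparr>)"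

text \<open>
  The condition \<open>R_ex1\<close> says that the neighbours of a leaf in the other tree are parametrized by their
  first coordinate, which gives the degree; \<open>R_twist\<close> says that the twist is a polarity; and
  \<open>near_leaf\<close> is the geometric content. It speaks of one tree only, as the polarity covers the other.
\<close>
locale coordinates =
  fixes K :: "'f set" and n :: nat and R :: "'f list \<Rightarrow> 'f list \<Rightarrow> bool"
    and \<theta> \<theta>' :: "'f \<Rightarrow> 'f"
  assumes finK: "finite K" and K2: "2 \<le> card K" and n3: "3 \<le> n"
    and R_ex1: "length w = n - 1 \<Longrightarrow> set w \<subseteq> K \<Longrightarrow> x \<in> K \<Longrightarrow>
      \<exists>!u. length u = n - 1 \<and> set u \<subseteq> K \<and> last u = x \<and> R w u"
    and theta: "x \<in> K \<Longrightarrow> \<theta> x \<in> K" "x \<in> K \<Longrightarrow> \<theta>' x \<in> K"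
      "x \<in> K \<Longrightarrow> \<theta> (\<theta>' x) = x" "x \<in> K \<Longrightarrow> \<theta>' (\<theta> x) = x"
    and R_twist: "length w = n - 1 \<Longrightarrow> set w \<subseteq> K \<Longrightarrow> length u = n - 1 \<Longrightarrow> set u \<subseteq> K \<Longrightarrow> R w u \<Longrightarrow>
      R (twist \<theta> \<theta>' False u) (twist \<theta> \<theta>' True w)"
    and near_leaf: "length w = n - 1 \<Longrightarrow> set w \<subseteq> K \<Longrightarrow> v \<in> part1 (coord_graph K n R) \<Longrightarrow>
      \<exists>k<n. ((True, w), v) \<in> edges (coord_graph K n R) ^^ k"
begin

abbreviation "T \<equiv> coord_graph K n R"
abbreviation "tw \<equiv> twist \<theta> \<theta>'"

definition colour :: "bool \<times> 'f list \<Rightarrow> bool" where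
  "colour v \<longleftrightarrow> fst v = even (length (snd v))"

definition pol :: "bool \<times> 'f list \<Rightarrow> bool \<times> 'f list" where
  "pol v = (\<not> fst v, tw (fst v) (snd v))"

lemma colour_Pair [simp]: "colour (s, w) \<longleftrightarrow> s = even (length w)"
  by (simp add: colour_def)

lemma pol_Pair [simp]: "pol (s, w) = (\<not> s, tw s w)"
  by (simp add: pol_def)

lemma verts_T: "verts T = {(s, w). set w \<subseteq> K \<and> length w < n}"
  by (simp add: coord_graph_def)

lemma edges_T: "((s, w), (t, u)) \<in> edges T \<longleftrightarrow> set w \<subseteq> K \<and> length w < n \<and> set u \<subseteq> K \<and> length u < n \<and>
       (if s = t then \<exists>x. u = x # w \<or> w = x # u
        else w = [] \<and> u = [] \<or> length w = n - 1 \<and> length u = n - 1 \<and>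
          (if s then R w u else R u w))"
  by (auto simp: coord_graph_def Let_def)

lemma set_twist: "set w \<subseteq> K \<Longrightarrow> set (tw s w) \<subseteq> K"
  by (induction w) (auto simp: theta)

lemma twist_twist: "set w \<subseteq> K \<Longrightarrow> tw (\<not> s) (tw s w) = w"
  by (induction w) (auto simp: theta)

lemma pol_edge: "(x, y) \<in> edges T \<Longrightarrow> (pol x, pol y) \<in> edges T"
proof -
  obtain s w t u where xy: "x = (s, w)" "y = (t, u)" by (cases x; cases y)
  assume e: "(x, y) \<in> edges T"
  then have K: "set (tw s w) \<subseteq> K" "set (tw t u) \<subseteq> K"
    using set_twist unfolding xy edges_T by blast+
  show ?thesis
  proof (cases "s = t")
    case True
    then obtain x where "u = x # w \<or> w = x # u" using e unfolding xy edges_T by auto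
    then show ?thesis using e K True by (auto simp: xy edges_T)
  next
    case False
    then consider "w = []" "u = []" | "length w = n - 1" "length u = n - 1" "if s then R w u else R u w"
      using e unfolding xy edges_T by auto
    then show ?thesis
    proof cases
      case 1
      then show ?thesis using e K False by (simp add: xy edges_T)
    next
      case 2
      have "if \<not> s then R (tw s w) (tw t u) else R (tw t u) (tw s w)"
        using R_twist[of w u] R_twist[of u w] e 2 False unfolding xy edges_T
        by (cases s) auto
      then show ?thesis using e K False 2 by (cases s; cases t) (simp_all add: xy edges_T)
    qed
  qed
qed

lemma pol_verts: "v \<in> verts T \<Longrightarrow> pol v \<in> verts T" "v \<in> verts T \<Longrightarrow> pol (pol v) = v"
  using set_twist twist_twist by (cases v; simp add: verts_T)+

lemma pol_iso: "graph_iso pol T T"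
proof -
  have "bij_betw pol (verts T) (verts T)"
    using pol_verts by (intro bij_betw_byWitness[of _ pol]) auto
  moreover have "(u, v) \<in> edges T \<longleftrightarrow> (pol u, pol v) \<in> edges T"
    if uv: "u \<in> verts T" "v \<in> verts T" for u v
  proof
    assume "(pol u, pol v) \<in> edges T"
    then have "(pol (pol u), pol (pol v)) \<in> edges T" by (rule pol_edge)
    then show "(u, v) \<in> edges T" unfolding pol_verts(2)[OF uv(1)] pol_verts(2)[OF uv(2)] .
  qed (rule pol_edge)
  ultimately show ?thesis unfolding graph_iso_def by blast
qed

lemma pol_colour: "colour (pol v) \<longleftrightarrow> \<not> colour v"
  by (cases v) auto

lemma parts_T: "part1 T = {v \<in> verts T. colour v}" "part2 T = {v \<in> verts T. \<not> colour v}"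
  by (auto simp: coord_graph_def Let_def)

lemma polarity_T: "polarity T pol"
  unfolding polarity_def
proof (intro conjI ballI)
  show "graph_iso pol T T" by (rule pol_iso)
  show "pol (pol v) = v" if "v \<in> verts T" for v using that by (rule pol_verts(2))
  have img: "pol ` {v \<in> verts T. colour v = b} = {v \<in> verts T. colour v = (\<not> b)}" for b
  proof (intro equalityI subsetI)
    fix v assume "v \<in> {v \<in> verts T. colour v = (\<not> b)}"
    then show "v \<in> pol ` {v \<in> verts T. colour v = b}"
      using pol_verts[of v] pol_colour[of v] by (intro image_eqI[of _ _ "pol v"]) simp_all
  next
    fix v assume "v \<in> pol ` {v \<in> verts T. colour v = b}"
    then obtain u where "u \<in> verts T" "colour u = b" "v = pol u" by auto
    then show "v \<in> {v \<in> verts T. colour v = (\<not> b)}"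
      using pol_verts(1)[of u] pol_colour[of u] by simp
  qed
  show "pol ` part1 T = part2 T" "pol ` part2 T = part1 T"
    using img[of True] img[of False] unfolding parts_T by simp_all
qed

lemma leaf_nbrs: 
  assumes w: "length w = n - 1" "set w \<subseteq> K"
  shows "card {u. length u = n - 1 \<and> set u \<subseteq> K \<and> R w u} = card K"
    "card {u. length u = n - 1 \<and> set u \<subseteq> K \<and> R u w} = card K"
proof -
  have one: "card {u. length u = n - 1 \<and> set u \<subseteq> K \<and> R w u} = card K"
    if w: "length w = n - 1" "set w \<subseteq> K" for w
  proof (rule bij_betw_same_card[of last], unfold bij_betw_def, intro conjI)
    let ?L = "{u. length u = n - 1 \<and> set u \<subseteq> K \<and> R w u}"
    have lastK: "last u \<in> K" if "length u = n - 1" "set u \<subseteq> K" for u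
      using that n3 by (cases u rule: rev_cases) auto
    show "inj_on last ?L"
    proof (rule inj_onI)
      fix u v assume "u \<in> ?L" "v \<in> ?L" "last u = last v"
      then show "u = v" using R_ex1[OF w lastK[of u]] by auto
    qed
    show "last ` ?L = K"
    proof (intro equalityI subsetI)
      fix x assume "x \<in> K"
      then show "x \<in> last ` ?L" using R_ex1[OF w] by blast
    qed (auto intro: lastK)
  qed
  then show "card {u. length u = n - 1 \<and> set u \<subseteq> K \<and> R w u} = card K" using w by blast
  have "bij_betw (tw False) {u. length u = n - 1 \<and> set u \<subseteq> K \<and> R (tw False w) u}
     {u. length u = n - 1 \<and> set u \<subseteq> K \<and> R u w}"
  proof (rule bij_betw_byWitness[of _ "tw True"])
    show "\<forall>u\<in>{u. length u = n - 1 \<and> set u \<subseteq> K \<and> R (tw False w) u}. tw True (tw False u) = u"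
      using twist_twist[of _ False] by auto
    show "\<forall>u\<in>{u. length u = n - 1 \<and> set u \<subseteq> K \<and> R u w}. tw False (tw True u) = u"
      using twist_twist[of _ True] by auto
    show "tw False ` {u. length u = n - 1 \<and> set u \<subseteq> K \<and> R (tw False w) u}
      \<subseteq> {u. length u = n - 1 \<and> set u \<subseteq> K \<and> R u w}"
    proof
      fix v assume "v \<in> tw False ` {u. length u = n - 1 \<and> set u \<subseteq> K \<and> R (tw False w) u}"
      then obtain u where u: "length u = n - 1" "set u \<subseteq> K" "R (tw False w) u" "v = tw False u" by blast
      have "R (tw False u) (tw True (tw False w))"
        using u w set_twist by (intro R_twist) auto
      then show "v \<in> {u. length u = n - 1 \<and> set u \<subseteq> K \<and> R u w}"
        using u set_twist twist_twist[of w False] w by auto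
    qed
    show "tw True ` {u. length u = n - 1 \<and> set u \<subseteq> K \<and> R u w}
      \<subseteq> {u. length u = n - 1 \<and> set u \<subseteq> K \<and> R (tw False w) u}"
    proof
      fix v assume "v \<in> tw True ` {u. length u = n - 1 \<and> set u \<subseteq> K \<and> R u w}"
      then obtain u where u: "length u = n - 1" "set u \<subseteq> K" "R u w" "v = tw True u" by blast
      have "R (tw False w) v" unfolding u(4) by (rule R_twist[OF u(1,2) w u(3)])
      then show "v \<in> {u. length u = n - 1 \<and> set u \<subseteq> K \<and> R (tw False w) u}"
        using u set_twist by simp
    qed
  qed
  then show "card {u. length u = n - 1 \<and> set u \<subseteq> K \<and> R u w} = card K"
    using bij_betw_same_card[of "tw False"] one[of "tw False w"] w set_twist[OF w(2), of False]
    by fastforce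
qed

lemma regular_T: "regular_bipartite T colour (card K)"
proof
  show "edges T \<subseteq> verts T \<times> verts T" by (auto simp: coord_graph_def Let_def)
  show "sym (edges T)"
  proof (rule symI)
    fix x y assume "(x, y) \<in> edges T"
    then show "(y, x) \<in> edges T"
      by (cases x; cases y) (auto simp: edges_T split: if_splits)
  qed
  show "colour x \<noteq> colour y" if "(x, y) \<in> edges T" for x y
    using that by (cases x; cases y) (auto simp: edges_T split: if_splits)
  fix v assume v: "v \<in> verts T"
  obtain s w where sw: "v = (s, w)" by (cases v)
  have w: "set w \<subseteq> K" "length w < n" using v sw by (auto simp: verts_T)
  define up where "up = (if w = [] then (\<not> s, []) else (s, tl w))"
  show "card {y. (v, y) \<in> edges T} = card K + 1"
  proof (cases "length w = n - 1")
    case False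
    have eq: "{y. (v, y) \<in> edges T} = insert up ((\<lambda>x. (s, x # w)) ` K)"
    proof (intro equalityI subsetI)
      fix y assume "y \<in> {y. (v, y) \<in> edges T}"
      moreover obtain t u where "y = (t, u)" by (cases y)
      ultimately show "y \<in> insert up ((\<lambda>x. (s, x # w)) ` K)"
        using False by (cases "s = t") (auto simp: sw edges_T up_def)
    next
      have "(v, up) \<in> edges T"
        using w n3 by (cases w) (simp_all add: sw edges_T up_def)
      moreover have "(v, (s, x # w)) \<in> edges T" if "x \<in> K" for x
        using that w False by (simp add: sw edges_T)
      moreover fix y assume "y \<in> insert up ((\<lambda>x. (s, x # w)) ` K)"
      ultimately show "y \<in> {y. (v, y) \<in> edges T}" by blast
    qed
    have "up \<notin> (\<lambda>x. (s, x # w)) ` K" by (cases w) (auto simp: up_def)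
    then show ?thesis unfolding eq using finK by (simp add: card_image inj_on_def)
  next
    case True
    let ?L = "{u. length u = n - 1 \<and> set u \<subseteq> K \<and> (if s then R w u else R u w)}"
    have "w \<noteq> []" using True n3 by auto
    then obtain x u where xu: "w = x # u" by (cases w) auto
    have eq: "{y. (v, y) \<in> edges T} = insert up (Pair (\<not> s) ` ?L)"
    proof (intro equalityI subsetI)
      fix y assume "y \<in> {y. (v, y) \<in> edges T}"
      moreover obtain t u' where y: "y = (t, u')" by (cases y)
      ultimately have e: "(v, (t, u')) \<in> edges T" by simp
      show "y \<in> insert up (Pair (\<not> s) ` ?L)"
      proof (cases "s = t")
        case True
        then have "\<exists>z. u' = z # w \<or> w = z # u'" "length u' < n" using e by (simp_all add: sw edges_T)
        then have "u' = u" using \<open>length w = n - 1\<close> n3 xu by auto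
        then show ?thesis using True xu by (simp add: y up_def)
      next
        case False
        then have "u' \<in> ?L" using e xu by (simp add: sw edges_T)
        then show ?thesis using False by (auto simp: y)
      qed
    next
      have "(v, up) \<in> edges T" using w by (simp add: sw edges_T up_def xu)
      moreover have "(v, (\<not> s, u')) \<in> edges T" if "u' \<in> ?L" for u'
        using that w True by (simp add: sw edges_T)
      moreover fix y assume "y \<in> insert up (Pair (\<not> s) ` ?L)"
      ultimately show "y \<in> {y. (v, y) \<in> edges T}" by blast
    qed
    have "card ?L = card K" using leaf_nbrs[OF True w(1)] by (cases s) auto
    moreover then have "finite ?L" using K2 by (intro card_ge_0_finite) simp
    moreover have "up \<notin> Pair (\<not> s) ` ?L" using xu by (auto simp: up_def)
    ultimately show ?thesis unfolding eq by (simp add: card_image inj_on_def)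
  qed
qed

lemma card_colour: "finite (verts T)" "card {v \<in> verts T. colour v = b} = (\<Sum>i<n. card K ^ i)"
proof -
  let ?W = "{w. set w \<subseteq> K \<and> length w < n}"
  have W: "?W = (\<Union>i<n. {w. set w \<subseteq> K \<and> length w = i})" by auto
  have finW: "finite ?W" unfolding W using finK by (simp add: finite_lists_length_eq)
  have "verts T = UNIV \<times> ?W" by (auto simp: verts_T)
  then show "finite (verts T)" using finW by simp
  have "card ?W = (\<Sum>i<n. card {w. set w \<subseteq> K \<and> length w = i})"
    unfolding W using finK by (intro card_UN_disjoint) (auto simp: finite_lists_length_eq)
  also have "\<dots> = (\<Sum>i<n. card K ^ i)" using finK by (simp add: card_lists_length_eq)
  finally have cW: "card ?W = (\<Sum>i<n. card K ^ i)" .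
  have "{v \<in> verts T. colour v = b} = (\<lambda>w. (b = even (length w), w)) ` ?W"
    by (auto simp: verts_T)
  then show "card {v \<in> verts T. colour v = b} = (\<Sum>i<n. card K ^ i)"
    using cW by (simp add: card_image inj_on_def)
qed

text \<open>
  A deepest vertex of a cycle has two neighbours on it that are not deeper, but a vertex that is not a
  leaf has just one such neighbour.
\<close>
lemma cycle_meets_leaf:
  assumes c: "is_cycle T c"
  shows "\<exists>s w. (s, w) \<in> set c \<and> length w = n - 1"
proof (rule ccontr)
  assume no: "\<not> ?thesis"
  interpret regular_bipartite T colour "card K" by (rule regular_T)
  have cne: "c \<noteq> []" "set c \<subseteq> verts T" using c by (auto simp: is_cycle_def)
  obtain v where v: "v \<in> set c" "\<And>u. u \<in> set c \<Longrightarrow> length (snd u) \<le> length (snd v)"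
  proof -
    have "finite ((\<lambda>u. length (snd u)) ` set c)" "(\<lambda>u. length (snd u)) ` set c \<noteq> {}"
      using cne by auto
    from Max_in[OF this] Max_ge[OF this(1)] show ?thesis using that by fastforce
  qed
  obtain i where i: "i < length c" "c ! i = v" using v(1) by (auto simp: in_set_conv_nth)
  define d where "d = rotate i c"
  let ?L = "length d"
  have d: "is_cycle T d" using is_cycle_rotate[OF c] d_def by auto
  have d0: "d ! 0 = v" using i by (subst d_def, subst nth_rotate) auto
  have setd: "set d = set c" by (simp add: d_def)
  have edge: "(d ! j, d ! (Suc j mod ?L)) \<in> edges T" if "j < ?L" for j
    using d that by (auto simp: is_cycle_def)
  have pos: "?L > 0" "?L \<noteq> 2" "distinct d" using d by (auto simp: is_cycle_def)
  have "?L \<noteq> 1"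
  proof
    assume "?L = 1"
    then have "(v, v) \<in> edges T" using edge[of 0] d0 by simp
    then show False using edge_col by blast
  qed
  then have L3: "?L \<ge> 3" using pos by linarith
  have e1: "(v, d ! 1) \<in> edges T" using edge[of 0] d0 L3 pos(1) by simp
  have "(d ! (?L - 1), v) \<in> edges T"
    using edge[of "?L - 1"] d0 L3 pos(1) by simp
  then have e2: "(v, d ! (?L - 1)) \<in> edges T" using sym_edges by (auto dest: symD)
  obtain s w where sw: "v = (s, w)" by (cases v)
  have nl: "length w \<noteq> n - 1" using no v(1) sw by auto
  have up: "y = (if w = [] then (\<not> s, []) else (s, tl w))"
    if y: "(v, y) \<in> edges T" "y \<in> set c" for y
  proof -
    have "length (snd y) \<le> length w" using v(2)[OF y(2)] sw by simp
    then show ?thesis using y(1) nl by (cases y) (auto simp: sw edges_T split: if_splits)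
  qed
  have "d ! 1 \<in> set c" "d ! (?L - 1) \<in> set c"
    using L3 unfolding setd[symmetric] by (auto intro!: nth_mem)
  then have "d ! 1 = d ! (?L - 1)" using up[OF e1] up[OF e2] by simp
  then show False using pos(3) L3 by (simp add: nth_eq_iff_index_eq)
qed

text \<open>
  The polarity exchanges the two trees and the two parts.
\<close>
lemma near_leaves:
  assumes "length w = n - 1" "set w \<subseteq> K" "v \<in> verts T" "colour v = s"
  shows "\<exists>k<n. ((s, w), v) \<in> edges T ^^ k"
proof (cases s)
  case True
  then show ?thesis using near_leaf[of w v] assms parts_T by auto
next
  case False
  interpret regular_bipartite T colour "card K" by (rule regular_T)
  have "pol v \<in> part1 T" using pol_verts(1)[OF assms(3)] pol_colour[of v] assms(4) False
    by (simp add: parts_T)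
  then obtain k where k: "k < n" "((True, tw False w), pol v) \<in> edges T ^^ k"
    using near_leaf[of "tw False w" "pol v"] set_twist[OF assms(2)] assms(1) by auto
  have "(pol (True, tw False w), pol (pol v)) \<in> edges T ^^ k"
    by (rule graph_iso_relpow[OF pol_iso edges_sub k(2)])
  then have "((s, w), v) \<in> edges T ^^ k"
    using False twist_twist[OF assms(2), of False] pol_verts(2)[OF assms(3)] by simp
  then show ?thesis using k by blast
qed

lemma polygon_T: "diameter T = enat n" "girth T = enat (2 * n)"
proof -
  interpret regular_bipartite T colour "card K" by (rule regular_T)
  have hits: "\<exists>v\<in>set c. far_class n v \<subseteq> hd ` walks_from n v" if c: "is_cycle T c" for c
  proof -
    obtain s w where sw: "(s, w) \<in> set c" "length w = n - 1" using cycle_meets_leaf[OF c] by blast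
    then have V: "(s, w) \<in> verts T" using c by (auto simp: is_cycle_def)
    have "x \<in> hd ` walks_from n (s, w)" if x: "x \<in> far_class n (s, w)" for x
    proof -
      have "colour x = s" "x \<in> verts T" using x sw(2) n3 by (auto simp: far_class_def)
      moreover have "set w \<subseteq> K" using V by (simp add: verts_T)
      ultimately obtain k where "k < n" "((s, w), x) \<in> edges T ^^ k"
        using near_leaves[OF sw(2)] by blast
      then show ?thesis using x by (intro near_in_walks_from)
    qed
    then show ?thesis using sw(1) by blast
  qed
  have ne: "verts T \<noteq> {}" using n3 by (auto simp: verts_T intro!: exI[of _ "[]"])
  show "diameter T = enat n" "girth T = enat (2 * n)"
    using diameter_girth_of_counts[OF _ _ ne card_colour(1) _ hits] card_colour(2) n3 K2
    by auto
qed

lemma admissible: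
  assumes "infinite (UNIV :: 'a set)"
  shows "admissible TYPE('a) n (card K)"
proof -
  interpret regular_bipartite T colour "card K" by (rule regular_T)
  interpret polar_polygon T colour "card K" n pol
    using parts_T polarity_T polygon_T girth_le_cycle[OF polygon_T(2)] n3 K2 by unfold_locales auto
  show ?thesis using admissible_of_model[OF assms K2 polygon_T(2)] .
qed

end

section \<open>Translations of coordinate graphs\<close>

lemma coord_edges: "((s, w), (t, u)) \<in> edges (coord_graph K n R) \<longleftrightarrow>
    set w \<subseteq> K \<and> length w < n \<and> set u \<subseteq> K \<and> length u < n \<and>
       (if s = t then \<exists>x. u = x # w \<or> w = x # u
        else w = [] \<and> u = [] \<or> length w = n - 1 \<and> length u = n - 1 \<and>
          (if s then R w u else R u w))"
  by (auto simp: coord_graph_def Let_def)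

lemma coord_part1: "part1 (coord_graph K n R) = {(s, w). set w \<subseteq> K \<and> length w < n \<and> s = even (length w)}"
  by (auto simp: coord_graph_def Let_def)

text \<open>
  Adds to each coordinate an amount depending on the coordinates that precede it, hence maps each tree
  to itself.
\<close>
fun shift :: "('f list \<Rightarrow> 'f) \<Rightarrow> 'f list \<Rightarrow> 'f :: ab_group_add list" where
  "shift \<delta> [] = []"
| "shift \<delta> (x # w) = (x + \<delta> w) # shift \<delta> w"

lemma length_shift [simp]: "length (shift \<delta> w) = length w"
  by (induction w) auto

lemma shift_inj: "length w = length u \<Longrightarrow> shift \<delta> w = shift \<delta> u \<Longrightarrow> w = u"
  by (induction w u rule: list_induct2) auto

text \<open>
  The property required of leaves by the locale of coordinates, in a form that can be moved from leaf
  to leaf.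
\<close>
definition sees_part1 :: "'f set \<Rightarrow> nat \<Rightarrow> ('f list \<Rightarrow> 'f list \<Rightarrow> bool) \<Rightarrow> 'f list \<Rightarrow> bool" where
  "sees_part1 K n R w \<longleftrightarrow> (\<forall>v \<in> part1 (coord_graph K n R).
     \<exists>k<n. ((True, w), v) \<in> edges (coord_graph K n R) ^^ k)"

text \<open>
  If a shift of both trees preserves \<open>R\<close>, it is an injective endomorphism of a finite graph; so it is
  surjective on \<open>part1\<close> and carries walks from a leaf to walks from its image.
\<close>
lemma sees_part1_shift:
  fixes K :: "'f :: ab_group_add set"
  assumes fin: "finite K" and add: "\<And>x y. x \<in> K \<Longrightarrow> y \<in> K \<Longrightarrow> x + y \<in> K"
    and \<delta>: "\<And>s w. set w \<subseteq> K \<Longrightarrow> length w < n \<Longrightarrow> \<delta> s w \<in> K"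
    and R: "\<And>w u. length w = n - 1 \<Longrightarrow> set w \<subseteq> K \<Longrightarrow> length u = n - 1 \<Longrightarrow> set u \<subseteq> K \<Longrightarrow> R w u \<Longrightarrow>
      R (shift (\<delta> True) w) (shift (\<delta> False) u)"
    and w: "sees_part1 K n R w"
  shows "sees_part1 K n R (shift (\<delta> True) w)"
  unfolding sees_part1_def
proof
  let ?T = "coord_graph K n R"
  define g where "g = (\<lambda>(s :: bool, w). (s, shift (\<delta> s) w))"
  have setK: "set (shift (\<delta> s) w) \<subseteq> K" if "set w \<subseteq> K" "length w < n" for s w
    using that by (induction w) (simp_all add: add \<delta>)
  have edge: "(g x, g y) \<in> edges ?T" if e: "(x, y) \<in> edges ?T" for x y
  proof -
    obtain s w t u where xy: "x = (s, w)" "y = (t, u)" by (cases x; cases y)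
    have K: "set (shift (\<delta> s) w) \<subseteq> K" "set (shift (\<delta> t) u) \<subseteq> K"
      using e setK unfolding xy coord_edges by blast+
    show ?thesis
    proof (cases "s = t")
      case True
      then obtain z where "u = z # w \<or> w = z # u" using e unfolding xy coord_edges by auto
      then show ?thesis using e K True by (auto simp: g_def xy coord_edges)
    next
      case False
      then consider "w = []" "u = []" | "length w = n - 1" "length u = n - 1" "if s then R w u else R u w"
        using e unfolding xy coord_edges by auto
      then show ?thesis
      proof cases
        case 1
        then show ?thesis using e K False by (simp add: g_def xy coord_edges)
      next
        case 2
        have "if s then R (shift (\<delta> s) w) (shift (\<delta> t) u) else R (shift (\<delta> t) u) (shift (\<delta> s) w)"
        proof (cases s)
          case True
          have "R (shift (\<delta> True) w) (shift (\<delta> False) u)"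
            using 2 True e unfolding xy coord_edges by (intro R) simp_all
          then show ?thesis using True False by simp
        next
          case s: False
          have "R (shift (\<delta> True) u) (shift (\<delta> False) w)"
            using 2 s e unfolding xy coord_edges by (intro R) simp_all
          then show ?thesis using s False by simp
        qed
        then show ?thesis using e K False 2
          by (cases s; cases t) (simp_all add: g_def xy coord_edges)
      qed
    qed
  qed
  have walk: "(g x, g y) \<in> edges ?T ^^ k" if "(x, y) \<in> edges ?T ^^ k" for x y k
    using that
  proof (induction k arbitrary: y)
    case (Suc k)
    then obtain z where "(x, z) \<in> edges ?T ^^ k" "(z, y) \<in> edges ?T" by auto
    with Suc.IH[of z] edge[of z y] show ?case by auto
  qed auto
  have finP: "finite (part1 ?T)"
  proof (rule finite_subset)
    show "part1 ?T \<subseteq> UNIV \<times> {w. set w \<subseteq> K \<and> length w \<le> n}" by (auto simp: coord_part1)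
    show "finite (UNIV \<times> {w. set w \<subseteq> K \<and> length w \<le> n} :: (bool \<times> 'f list) set)"
      using finite_lists_length_le[OF fin] by simp
  qed
  have "inj_on g (part1 ?T)"
  proof (rule inj_onI)
    fix x y assume "x \<in> part1 ?T" "y \<in> part1 ?T" "g x = g y"
    moreover obtain s w t u where xy: "x = (s, w)" "y = (t, u)" by (cases x; cases y)
    ultimately have e: "s = t" "shift (\<delta> s) w = shift (\<delta> s) u" by (auto simp: g_def)
    have "length w = length u" using arg_cong[OF e(2), of length] by simp
    then show "x = y" using shift_inj e xy by blast
  qed
  moreover have "g ` part1 ?T \<subseteq> part1 ?T"
  proof
    fix y assume "y \<in> g ` part1 ?T"
    then obtain s w where "(s, w) \<in> part1 ?T" "y = (s, shift (\<delta> s) w)" by (auto simp: g_def)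
    then show "y \<in> part1 ?T" using setK[of w s] by (simp add: coord_part1)
  qed
  ultimately have surj: "g ` part1 ?T = part1 ?T" by (intro endo_inj_surj finP)
  fix v assume "v \<in> part1 ?T"
  then have "v \<in> g ` part1 ?T" by (simp only: surj)
  then obtain v' where v': "v' \<in> part1 ?T" "v = g v'" by blast
  then obtain k where "k < n" "((True, w), v') \<in> edges ?T ^^ k"
    using w unfolding sees_part1_def by blast
  moreover have "g (True, w) = (True, shift (\<delta> True) w)" by (simp add: g_def)
  ultimately show "\<exists>k<n. ((True, shift (\<delta> True) w), v) \<in> edges ?T ^^ k"
    using walk[of "(True, w)" v' k] v'(2) by auto
qed

section \<open>Fields with a square root of the Frobenius map\<close>

text \<open>
  A finite subfield \<open>K\<close> of an ambient field, with a map \<open>\<theta>\<close> that squares to \<open>x \<mapsto> x\<^sup>p\<close> on \<open>K\<close>. A subset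
  is used because the order of the field varies. For \<open>p = 1\<close> the identity is allowed.
\<close>
locale polarity_field =
  fixes K :: "'f :: field set" and p :: nat and \<theta> \<theta>' :: "'f \<Rightarrow> 'f"
  assumes finK: "finite K" and zeroK [simp]: "0 \<in> K" and oneK [simp]: "1 \<in> K"
    and addK [simp]: "x \<in> K \<Longrightarrow> y \<in> K \<Longrightarrow> x + y \<in> K"
    and minusK [simp]: "x \<in> K \<Longrightarrow> - x \<in> K"
    and multK [simp]: "x \<in> K \<Longrightarrow> y \<in> K \<Longrightarrow> x * y \<in> K"
    and inverseK [simp]: "x \<in> K \<Longrightarrow> inverse x \<in> K"
    and theta_add [simp]: "\<theta> (x + y) = \<theta> x + \<theta> y" "\<theta>' (x + y) = \<theta>' x + \<theta>' y"
    and theta_mult [simp]: "\<theta> (x * y) = \<theta> x * \<theta> y" "\<theta>' (x * y) = \<theta>' x * \<theta>' y"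
    and thetaK [simp]: "x \<in> K \<Longrightarrow> \<theta> x \<in> K" "x \<in> K \<Longrightarrow> \<theta>' x \<in> K"
    and theta_inv [simp]: "x \<in> K \<Longrightarrow> \<theta> (\<theta>' x) = x" "x \<in> K \<Longrightarrow> \<theta>' (\<theta> x) = x"
    and theta_theta: "x \<in> K \<Longrightarrow> \<theta> (\<theta> x) = x ^ p"
begin

lemma diffK [simp]: "x \<in> K \<Longrightarrow> y \<in> K \<Longrightarrow> x - y \<in> K"
  using addK[of x "- y"] by simp

lemma divK [simp]: "x \<in> K \<Longrightarrow> y \<in> K \<Longrightarrow> x / y \<in> K"
  by (simp add: divide_inverse)

lemma powK [simp]: "x \<in> K \<Longrightarrow> x ^ k \<in> K"
  by (induction k) auto

lemma theta_diff [simp]: "\<theta> (x - y) = \<theta> x - \<theta> y" "\<theta>' (x - y) = \<theta>' x - \<theta>' y"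
  using theta_add(1)[of "x - y" y] theta_add(2)[of "x - y" y] by simp_all

lemma theta_zero [simp]: "\<theta> 0 = 0" "\<theta>' 0 = 0"
  using theta_diff[of 0 0] by simp_all

lemma theta_uminus [simp]: "\<theta> (- x) = - \<theta> x" "\<theta>' (- x) = - \<theta>' x"
  using theta_diff[of 0 x] by simp_all

lemma theta'_power: "x \<in> K \<Longrightarrow> \<theta>' (x ^ p) = \<theta> x" 
  using theta_inv(2)[of "\<theta> x"] theta_theta[of x] by simp

lemma theta'_pow: "x \<in> K \<Longrightarrow> \<theta>' x ^ p = \<theta> x"
  using theta_theta[of "\<theta>' x"] by simp

lemma card_K: "2 \<le> card K"
proof -
  have "card {0, 1 :: 'f} \<le> card K" using finK by (intro card_mono) auto
  then show ?thesis by simp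
qed

end

section \<open>Projective planes and symplectic quadrangles\<close>

lemma list2: "length w = 2 \<longleftrightarrow> (\<exists>x y. w = [x, y])"
  by (auto simp: numeral_eq_Suc length_Suc_conv)

lemma list3: "length w = 3 \<longleftrightarrow> (\<exists>x y z. w = [x, y, z])"
  by (auto simp: numeral_eq_Suc length_Suc_conv)

lemma list5: "length w = 5 \<longleftrightarrow> (\<exists>x y z t s. w = [x, y, z, t, s])"
  by (auto simp: numeral_eq_Suc length_Suc_conv)

text \<open>
  The line \<open>(k, l)\<close> of the affine plane contains the points \<open>(a, b)\<close> with \<open>b + l = a k\<close>.
\<close>
definition plane_rel :: "'f :: field list \<Rightarrow> 'f list \<Rightarrow> bool" where
  "plane_rel w u \<longleftrightarrow> (\<exists>a b k l. w = [b, a] \<and> u = [l, k] \<and> b + l = a * k)"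

lemma plane_rel_simp [simp]: "plane_rel [b, a] [l, k] \<longleftrightarrow> b + l = a * k"
  by (auto simp: plane_rel_def)

text \<open>
  The incidence of the points \<open>(a, l, a')\<close> and lines \<open>(k, b, k')\<close> of the symplectic quadrangle that are
  opposite to the base flag, in the coordinates of Hanssens and Van Maldeghem.
\<close>
definition quadrangle_rel :: "'f :: field list \<Rightarrow> 'f list \<Rightarrow> bool" where
  "quadrangle_rel w u \<longleftrightarrow> (\<exists>a l a' k b k'. w = [a', l, a] \<and> u = [k', b, k] \<and>
     a' = b + a * k \<and> k' = l + a ^ 2 * k)"

lemma quadrangle_rel_simp [simp]: "quadrangle_rel [a', l, a] [k', b, k] \<longleftrightarrow>
    a' = b + a * k \<and> k' = l + a ^ 2 * k"
  by (auto simp: quadrangle_rel_def)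

context polarity_field
begin

text \<open>
  From the leaf \<open>(0, 0)\<close> a point \<open>(a, l)\<close> with \<open>a \<noteq> 0\<close> is reached through the line with slope \<open>l / a\<close>.
\<close>
lemma plane_coordinates:
  assumes \<theta>: "\<theta> = (\<lambda>x. x)" "\<theta>' = (\<lambda>x. x)"
  shows "coordinates K 3 plane_rel \<theta> \<theta>'"
proof -
  let ?T = "coord_graph K 3 (plane_rel :: 'f list \<Rightarrow> _)"
  let ?D = "\<lambda>k v. ((True, [0, 0]), v) \<in> edges ?T ^^ k"
  have step: "?D (Suc k) v'" if "?D k v" "(v, v') \<in> edges ?T" for k v v'
    using that by (rule relpow_Suc_I)
  have D1: "?D 1 (True, [0])" "k \<in> K \<Longrightarrow> ?D 1 (False, [0, k])" for k
    by (simp_all add: coord_edges)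
  have "\<exists>k<3. ?D k v" if "v \<in> part1 ?T" for v
  proof -
    obtain s w where v: "v = (s, w)" by (cases v)
    with that have w: "set w \<subseteq> K" "length w < 3" "s = even (length w)" by (auto simp: coord_part1)
    then consider "w = []" "s" | x where "w = [x]" "\<not> s" "x \<in> K"
      | l a where "w = [l, a]" "s" "l \<in> K" "a \<in> K" "a = 0"
      | l a where "w = [l, a]" "s" "l \<in> K" "a \<in> K" "a \<noteq> 0"
      by (cases w rule: remdups_adj.cases) auto
    then have "?D (Suc 1) v"
    proof cases
      case 1 then show ?thesis using v by (intro step[OF D1(1)]) (simp add: coord_edges)
    next
      case 2 then show ?thesis using v by (intro step[OF D1(2)]) (simp_all add: coord_edges)
    next
      case 3 then show ?thesis using v by (intro step[OF D1(1)]) (simp add: coord_edges)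
    next
      case 4 then show ?thesis using v
        by (intro step[OF D1(2)[of "l / a"]]) (simp_all add: coord_edges)
    qed
    then show ?thesis by (intro exI[of _ "Suc 1"]) auto
  qed
  then have base: "sees_part1 K 3 plane_rel [0, 0 :: 'f]" by (auto simp: sees_part1_def)
  have sees: "sees_part1 K 3 plane_rel [b, a]" if ab: "a \<in> K" "b \<in> K" for a b
  proof -
    let ?d = "\<lambda>s w. case w of [x] \<Rightarrow> if s then b else - b | _ \<Rightarrow> (0 :: 'f)"
    have "sees_part1 K 3 plane_rel (shift (?d True) [0, 0])"
      by (rule sees_part1_shift[OF finK addK _ _ base])
        (use ab in \<open>auto simp: list2 algebra_simps split: list.splits\<close>)
    then have b: "sees_part1 K 3 plane_rel [b, 0]" by simp
    let ?d = "\<lambda>s w. case w of [] \<Rightarrow> if s then a else 0 | [k] \<Rightarrow> if s then 0 else a * k | _ \<Rightarrow> (0 :: 'f)"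
    have "sees_part1 K 3 plane_rel (shift (?d True) [b, 0])"
      by (rule sees_part1_shift[OF finK addK _ _ b])
        (use ab in \<open>auto simp: list2 algebra_simps split: list.splits\<close>)
    then show ?thesis by simp
  qed
  show ?thesis
  proof
    show "finite K" "2 \<le> card K" "(3::nat) \<le> 3" by (simp_all add: finK card_K)
    fix w u :: "'f list" and x
    assume w: "length w = 3 - 1" "set w \<subseteq> K"
    then obtain a b where ab: "w = [b, a]" "a \<in> K" "b \<in> K" by (auto simp: list2)
    show "\<exists>!u. length u = 3 - 1 \<and> set u \<subseteq> K \<and> last u = x \<and> plane_rel w u" if "x \<in> K"
    proof (rule ex1I[of _ "[a * x - b, x]"])
      fix u assume "length u = 3 - 1 \<and> set u \<subseteq> K \<and> last u = x \<and> plane_rel w u"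
      then show "u = [a * x - b, x]" using ab by (auto simp: list2 algebra_simps)
    qed (use ab that in auto)
    show "\<exists>k<3. ((True, w), v) \<in> edges ?T ^^ k" if "v \<in> part1 ?T" for v
      using sees[OF ab(2,3)] that ab(1) by (auto simp: sees_part1_def)
    assume u: "length u = 3 - 1" "set u \<subseteq> K" "plane_rel w u"
    then show "plane_rel (twist \<theta> \<theta>' False u) (twist \<theta> \<theta>' True w)"
      using ab by (auto simp: list2 \<theta> algebra_simps)
  qed (simp_all add: \<theta>)
qed

text \<open>
  In characteristic 2 the equations \<open>a' = b + a k\<close> and \<open>k' = l + a\<^sup>2 k\<close> are exchanged by the twist, because
  \<open>\<theta>\<close> turns \<open>a k\<close> into \<open>\<theta> a \<cdot> \<theta> k\<close> and its inverse turns \<open>a\<^sup>2\<close> into \<open>\<theta> a\<close>.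
\<close>
lemma quadrangle_coordinates:
  assumes two: "(2 :: 'f) = 0" and p: "p = 2"
  shows "coordinates K 4 quadrangle_rel \<theta> \<theta>'"
proof -
  have m: "- x = x" for x :: 'f
    using two by (metis add_eq_0_iff mult_2 mult_zero_left)
  have sq: "(x + y) ^ 2 = x ^ 2 + y ^ 2" for x y :: 'f
    using two by (simp add: power2_sum)
  let ?T = "coord_graph K 4 (quadrangle_rel :: 'f list \<Rightarrow> _)"
  let ?D = "\<lambda>k v. ((True, [0, 0, 0]), v) \<in> edges ?T ^^ k"
  have step: "?D (Suc k) v'" if "?D k v" "(v, v') \<in> edges ?T" for k v v'
    using that by (rule relpow_Suc_I)
  have D1: "?D 1 (True, [0, 0])" "k \<in> K \<Longrightarrow> ?D 1 (False, [0, 0, k])" for k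
    by (simp_all add: coord_edges)
  have D2: "?D (Suc 1) (True, [0])" "x \<in> K \<Longrightarrow> ?D (Suc 1) (True, [x, 0, 0])"
    "x \<in> K \<Longrightarrow> ?D (Suc 1) (False, [0, x])"
    "x \<in> K \<Longrightarrow> y \<in> K \<Longrightarrow> ?D (Suc 1) (True, [y * x, - (y ^ 2 * x), y])" for x y
    using step[OF D1(1)] step[OF D1(2)[of x]] by (simp_all add: coord_edges)
  have "\<exists>k<4. ?D k v" if "v \<in> part1 ?T" for v
  proof -
    obtain s w where v: "v = (s, w)" by (cases v)
    with that have w: "set w \<subseteq> K" "length w < 4" "s = even (length w)" by (auto simp: coord_part1)
    then consider "w = []" "s" | x where "w = [x]" "\<not> s" "x \<in> K"
      | l a where "w = [l, a]" "s" "l \<in> K" "a \<in> K" 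
      | k' b k where "w = [k', b, k]" "\<not> s" "k' \<in> K" "b \<in> K" "k \<in> K"
      by (cases w rule: remdups_adj.cases; cases "tl (tl w)") auto
    then have "?D (Suc (Suc 1)) v"
    proof cases
      case 1 then show ?thesis using v by (intro step[OF D2(1)]) (simp add: coord_edges)
    next
      case 2 then show ?thesis using v by (intro step[OF D2(3)]) (simp_all add: coord_edges)
    next
      case 3
      show ?thesis
      proof (cases "a = 0")
        case True then show ?thesis using v 3 by (intro step[OF D2(1)]) (simp add: coord_edges)
      next
        case False then show ?thesis using v 3
          by (intro step[OF D2(4)[of "- l / a ^ 2" a]]) (simp_all add: coord_edges)
      qed
    next
      case 4
      consider "b = 0" | "b \<noteq> 0" "k' = 0" | "b \<noteq> 0" "k' \<noteq> 0" by blast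
      then show ?thesis
      proof cases
        case 1 then show ?thesis using v 4 by (intro step[OF D2(3)]) (simp_all add: coord_edges)
      next
        case 2 then show ?thesis using v 4
          by (intro step[OF D2(2)[of b]]) (simp_all add: coord_edges)
      next
        case 3
        \<comment> \<open>The point with first coordinate \<open>a\<close> on the given line also lies on a line through the leaf \<open>0\<close>,
          the one with first coordinate \<open>k + b / a\<close>.\<close>
        define a where "a = k' / b"
        have a: "a \<in> K" "a \<noteq> 0" "k' = a * b" using 3 4 by (simp_all add: a_def)
        have "a * (k + b / a) = b + a * k" "k' = - (a ^ 2 * (k + b / a)) + a ^ 2 * k"
          using a m by (simp_all add: field_simps power2_eq_square)
        then show ?thesis using v 4 a
          by (intro step[OF D2(4)[of "k + b / a" a]]) (simp_all add: coord_edges)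
      qed
    qed
    then show ?thesis by (intro exI[of _ "Suc (Suc 1)"]) auto
  qed
  then have base: "sees_part1 K 4 quadrangle_rel [0, 0, 0 :: 'f]" by (auto simp: sees_part1_def)
  have sees: "sees_part1 K 4 quadrangle_rel [a', l, a]" if ab: "a \<in> K" "l \<in> K" "a' \<in> K" for a l a'
  proof -
    let ?d = "\<lambda>s w. case w of [x] \<Rightarrow> if s then 0 else a' | [x, y] \<Rightarrow> if s then a' else 0 | _ \<Rightarrow> (0 :: 'f)"
    have "sees_part1 K 4 quadrangle_rel (shift (?d True) [0, 0, 0])"
      by (rule sees_part1_shift[OF finK addK _ _ base])
        (use ab in \<open>auto simp: list3 algebra_simps split: list.splits\<close>)
    then have 1: "sees_part1 K 4 quadrangle_rel [a', 0, 0]" by simp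
    let ?d = "\<lambda>s w. case w of [x] \<Rightarrow> if s then l else 0 | [x, y] \<Rightarrow> if s then 0 else l | _ \<Rightarrow> (0 :: 'f)"
    have "sees_part1 K 4 quadrangle_rel (shift (?d True) [a', 0, 0])"
      by (rule sees_part1_shift[OF finK addK _ _ 1])
        (use ab in \<open>auto simp: list3 algebra_simps split: list.splits\<close>)
    then have 2: "sees_part1 K 4 quadrangle_rel [a', l, 0]" by simp
    let ?d = "\<lambda>s w. case w of [] \<Rightarrow> if s then a else 0 | [k] \<Rightarrow> if s then 0 else - (a * k)
       | [b, k] \<Rightarrow> if s then 0 else a ^ 2 * k | _ \<Rightarrow> (0 :: 'f)"
    have "sees_part1 K 4 quadrangle_rel (shift (?d True) [a', l, 0])"
      by (rule sees_part1_shift[OF finK addK _ _ 2])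
        (use ab in \<open>auto simp: list3 algebra_simps sq split: list.splits\<close>)
    then show ?thesis by simp
  qed
  show ?thesis
  proof
    show "finite K" "2 \<le> card K" "(3::nat) \<le> 4" by (simp_all add: finK card_K)
    fix w u :: "'f list" and x
    assume w: "length w = 4 - 1" "set w \<subseteq> K"
    then obtain a l a' where ab: "w = [a', l, a]" "a \<in> K" "l \<in> K" "a' \<in> K" by (auto simp: list3)
    show "\<exists>!u. length u = 4 - 1 \<and> set u \<subseteq> K \<and> last u = x \<and> quadrangle_rel w u" if "x \<in> K"
    proof (rule ex1I[of _ "[l + a ^ 2 * x, a' - a * x, x]"])
      fix u assume "length u = 4 - 1 \<and> set u \<subseteq> K \<and> last u = x \<and> quadrangle_rel w u"
      then show "u = [l + a ^ 2 * x, a' - a * x, x]" using ab by (auto simp: list3 algebra_simps)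
    qed (use ab that in auto)
    show "\<exists>k<4. ((True, w), v) \<in> edges ?T ^^ k" if "v \<in> part1 ?T" for v
      using sees[OF ab(2-4)] that ab(1) by (auto simp: sees_part1_def)
    assume u: "length u = 4 - 1" "set u \<subseteq> K" "quadrangle_rel w u"
    then obtain k b k' where kb: "u = [k', b, k]" "k \<in> K" "b \<in> K" "k' \<in> K" by (auto simp: list3)
    have "\<theta>' (a ^ 2) = \<theta> a" "\<theta>' k ^ 2 = \<theta> k"
      using theta'_power[OF ab(2)] theta'_pow[OF kb(2)] p by simp_all
    then show "quadrangle_rel (twist \<theta> \<theta>' False u) (twist \<theta> \<theta>' True w)"
      using ab kb u(3) by (simp add: mult.commute)
  qed simp_all
qed

end

section \<open>Split Cayley hexagons in characteristic 3\<close>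

text \<open>
  The incidence of the points \<open>(a, l, a', l', a'')\<close> and lines \<open>(k, b, k', b', k'')\<close> of the split Cayley
  hexagon that are opposite to the base flag, in the coordinates of De Smet and Van Maldeghem reduced
  modulo 3.
\<close>
definition hexagon_rel :: "'f :: field list \<Rightarrow> 'f list \<Rightarrow> bool" where
  "hexagon_rel w u \<longleftrightarrow> (\<exists>a l a' l' a'' k b k' b' k''. w = [a'', l', a', l, a] \<and> u = [k'', b', k', b, k] \<and>
     a'' = b + a * k \<and> b' = a' + a * a'' + a ^ 2 * k \<and>
     k' = l' - k * l + a ^ 3 * k ^ 2 \<and> k'' = l + a ^ 3 * k)"

lemma hexagon_rel_simp [simp]: "hexagon_rel [a'', l', a', l, a] [k'', b', k', b, k] \<longleftrightarrow>
    a'' = b + a * k \<and> b' = a' + a * a'' + a ^ 2 * k \<and>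
    k' = l' - k * l + a ^ 3 * k ^ 2 \<and> k'' = l + a ^ 3 * k"
  by (auto simp: hexagon_rel_def)

locale hexagon_field = polarity_field K p \<theta> \<theta>'
  for K :: "'f :: field set" and p and \<theta> \<theta>' +
  assumes three: "(3 :: 'f) = 0" and p3: "p = 3"
begin

abbreviation "E \<equiv> edges (coord_graph K 6 (hexagon_rel :: 'f list \<Rightarrow> _))"

text \<open>
  Vertices joined to the leaf with all coordinates \<open>0\<close> by a walk of length \<open>k\<close>. The lemmas below follow
  the walks outwards: leaves at distance 3 from it are of the three kinds \<open>(k, x, 0, 0, 0)\<close>,
  \<open>(k, 0, 0, 0, y)\<close> and \<open>(k, A u, A\<^sup>3 u\<^sup>2, - A\<^sup>2 u, - A\<^sup>3 u)\<close>.
\<close>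
definition dist0 :: "nat \<Rightarrow> bool \<times> 'f list \<Rightarrow> bool" where
  "dist0 k v \<longleftrightarrow> ((True, [0, 0, 0, 0, 0]), v) \<in> E ^^ k"

lemma dist0_step: "dist0 k v \<Longrightarrow> (v, v') \<in> E \<Longrightarrow> dist0 (Suc k) v'"
  unfolding dist0_def by (rule relpow_Suc_I)

text \<open>
  Identities of characteristic 3 are proved as identities over the integers with an explicit multiple
  of 3 added.
\<close>
lemma mod3: "x = y + 3 * z \<Longrightarrow> x = (y :: 'f)"
  by (simp add: three)

lemma dist0_1: "dist0 1 (True, [0, 0, 0, 0])" "k \<in> K \<Longrightarrow> dist0 1 (False, [0, 0, 0, 0, k])"
  by (simp_all add: dist0_def coord_edges)

lemma dist0_2: "dist0 2 (True, [0, 0, 0])" "x \<in> K \<Longrightarrow> dist0 2 (True, [x, 0, 0, 0, 0])"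
  "k \<in> K \<Longrightarrow> dist0 2 (False, [0, 0, 0, k])"
  using dist0_step[OF dist0_1(1)] dist0_step[OF dist0_1(2)[of k]]
  by (simp_all add: coord_edges numeral_2_eq_2)

lemma dist0_2': 
  assumes "A \<in> K" "k \<in> K"
  shows "dist0 2 (True, [A * k, A ^ 3 * k ^ 2, A ^ 2 * k, - (A ^ 3 * k), A])"
proof -
  have "(0 :: 'f) = A ^ 2 * k + A * (A * k) + A ^ 2 * k"
    by (rule sym, rule mod3[of _ _ "A ^ 2 * k"]) Groebner_Basis.algebra
  moreover have "(0 :: 'f) = A ^ 3 * k ^ 2 - k * - (A ^ 3 * k) + A ^ 3 * k ^ 2"
    by (rule sym, rule mod3[of _ _ "A ^ 3 * k ^ 2"]) Groebner_Basis.algebra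
  ultimately show ?thesis using dist0_step[OF dist0_1(2)[OF assms(2)]] assms
    by (simp add: coord_edges numeral_2_eq_2)
qed

lemma dist0_3: "dist0 3 (True, [0, 0])" "x \<in> K \<Longrightarrow> dist0 3 (True, [x, 0, 0, 0])"
  "x \<in> K \<Longrightarrow> dist0 3 (False, [0, 0, x])"
  "x \<in> K \<Longrightarrow> y \<in> K \<Longrightarrow> dist0 3 (False, [0, 0, 0, x, y])"
  "x \<in> K \<Longrightarrow> y \<in> K \<Longrightarrow> dist0 3 (False, [x, 0, 0, 0, y])"
  "x \<in> K \<Longrightarrow> y \<in> K \<Longrightarrow> dist0 3 (True, [x ^ 3 * y ^ 2, x ^ 2 * y, - (x ^ 3 * y), x])"
  using dist0_step[OF dist0_2(1)] dist0_step[OF dist0_2(2)[of x]] dist0_step[OF dist0_2(3)[of x]]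
    dist0_step[OF dist0_2(3)[of y]] dist0_step[OF dist0_2'[of x y]]
  by (simp_all add: coord_edges numeral_3_eq_3 numeral_2_eq_2)

lemma dist0_3':
  assumes "A \<in> K" "u \<in> K" "k \<in> K"
  shows "dist0 3 (False, [- (A ^ 3 * u), - (A ^ 2 * u), A ^ 3 * u ^ 2, A * u, k])"
proof -
  have "A ^ 2 * (k + u) + A * (A * (k + u)) + A ^ 2 * k = - (A ^ 2 * u)"
    by (rule mod3[of _ _ "A ^ 2 * k + A ^ 2 * u"]) Groebner_Basis.algebra
  moreover have "A ^ 3 * (k + u) ^ 2 - k * - (A ^ 3 * (k + u)) + A ^ 3 * k ^ 2 = A ^ 3 * u ^ 2"
    by (rule mod3[of _ _ "A ^ 3 * (k ^ 2 + k * u)"]) Groebner_Basis.algebra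
  moreover have "A * (k + u) = A * u + A * k" "- (A ^ 3 * u) = - (A ^ 3 * (k + u)) + A ^ 3 * k"
    by Groebner_Basis.algebra+
  ultimately have "((True, [A * (k + u), A ^ 3 * (k + u) ^ 2, A ^ 2 * (k + u), - (A ^ 3 * (k + u)), A]),
      (False, [- (A ^ 3 * u), - (A ^ 2 * u), A ^ 3 * u ^ 2, A * u, k])) \<in> E"
    using assms by (simp only: coord_edges hexagon_rel_simp) simp
  then show ?thesis using dist0_step[OF dist0_2'[of A "k + u"]] assms
    by (simp add: numeral_3_eq_3 numeral_2_eq_2)
qed

lemma dist0_4: "dist0 4 (True, [0])" "x \<in> K \<Longrightarrow> dist0 4 (True, [x, 0, 0])"
  "x \<in> K \<Longrightarrow> dist0 4 (False, [0, x])"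
  "x \<in> K \<Longrightarrow> y \<in> K \<Longrightarrow> dist0 4 (False, [x, 0, 0, y])"
  "x \<in> K \<Longrightarrow> y \<in> K \<Longrightarrow> dist0 4 (False, [0, 0, x, y])"
  "x \<in> K \<Longrightarrow> y \<in> K \<Longrightarrow> dist0 4 (True, [x ^ 2 * y, - (x ^ 3 * y), x])"
  "x \<in> K \<Longrightarrow> y \<in> K \<Longrightarrow> dist0 4 (True, [y, x, 0, 0, 0])"
  using dist0_step[OF dist0_3(1)] dist0_step[OF dist0_3(2)[of x]] dist0_step[OF dist0_3(3)[of x]]
    dist0_step[OF dist0_3(3)[of y]] dist0_step[OF dist0_3(4)[of x y]] dist0_step[OF dist0_3(6)[of x y]]
  by (simp_all add: coord_edges eval_nat_numeral)

lemma dist0_4':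
  "A \<in> K \<Longrightarrow> u \<in> K \<Longrightarrow> k \<in> K \<Longrightarrow> dist0 4 (False, [- (A ^ 2 * u), A ^ 3 * u ^ 2, A * u, k])"
  "A \<in> K \<Longrightarrow> k \<in> K \<Longrightarrow> z \<in> K \<Longrightarrow> dist0 4 (True, [z, A ^ 3 * k ^ 2, A ^ 2 * k, - (A ^ 3 * k), A])"
  using dist0_step[OF dist0_3'[of A u k]] dist0_step[OF dist0_3(6)[of A k]]
  by (simp_all add: coord_edges eval_nat_numeral)

lemma dist0_4_leaf:
  assumes "dist0 3 (False, u)" "hexagon_rel w u" "length w = 5" "set w \<subseteq> K" "length u = 5" "set u \<subseteq> K"
  shows "dist0 4 (True, w)"
  using dist0_step[OF assms(1), of "(True, w)"] assms by (simp add: coord_edges eval_nat_numeral)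

text \<open>
  The vertices not opposite to the leaf \<open>0\<close> form a hyperplane in the standard projective embedding. For
  leaves its equation is \<open>a'' (a a' + l) = a l' - a'\<^sup>2\<close>. A leaf on the hyperplane with
  \<open>S = a a' + l \<noteq> 0\<close> has a neighbour of one of the three kinds above, and
  \<open>T = a\<^sup>3 l' - l\<^sup>2\<close> decides which: for \<open>a \<noteq> 0\<close>, the third kind must satisfy \<open>S = - u A (a - A)\<^sup>2\<close> and
  \<open>T = A\<^sup>3 u\<^sup>2 (a - A)\<^sup>3\<close>, so \<open>A / (a - A) = T / S\<^sup>2\<close>. This has a solution \<open>A \<noteq> 0\<close> unless \<open>T = 0\<close> or
  \<open>T = - S\<^sup>2\<close>, where the first and the second kind take over.
\<close>
lemma dist0_4_generic:
  assumes K: "a \<in> K" "l \<in> K" "a' \<in> K" "l' \<in> K" and S: "a * a' + l \<noteq> 0" and x: "x = (a * l' - a' ^ 2) / (a * a' + l)"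
  shows "dist0 4 (True, [x, l', a', l, a])"
proof -
  define S where "S = a * a' + l"
  define T where "T = a ^ 3 * l' - l ^ 2"
  have S0: "S \<noteq> 0" using S by (simp add: S_def)
  have xS: "S * x = a * l' - a' ^ 2" using S by (simp add: x S_def)
  have xK: "x \<in> K" using K by (simp add: x)
  have "a ^ 2 * (a * l' - a' ^ 2) = T - S ^ 2 + 2 * S * l" unfolding T_def S_def by Groebner_Basis.algebra
  then have a2xS: "a ^ 2 * (S * x) = T - S ^ 2 + 2 * S * l" by (simp only: xS)
  consider "a = 0" "a' = 0" | "a = 0" "a' \<noteq> 0" | "a \<noteq> 0" "T = 0" | "a \<noteq> 0" "T = - (S ^ 2)"
    | "a \<noteq> 0" "T \<noteq> 0" "S ^ 2 + T \<noteq> 0" using add_eq_0_iff[of "S ^ 2" T] by blast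
  then show ?thesis
  proof cases
    case 1
    then show ?thesis using K S x
      by (intro dist0_4_leaf[OF dist0_3(5)[of l "l' / l"]]) simp_all
  next
    case 2
    define A where "A = l / a'"
    define u where "u = - a' / A ^ 2"
    define k where "k = (l' - A ^ 3 * u ^ 2) / l"
    have l0: "l \<noteq> 0" using S 2 by simp
    have A0: "A \<noteq> 0" using l0 2 by (simp add: A_def)
    have M: "A \<in> K" "u \<in> K" "k \<in> K" using K by (simp_all add: A_def u_def k_def)
    have u: "A ^ 2 * u = - a'" using A0 by (simp add: u_def)
    have "x = A * u" using 2 l0 by (simp add: x u_def A_def power2_eq_square)
    moreover have "l = A * a'" using 2 by (simp add: A_def)
    then have "l = - (A ^ 3 * u)" using u by Groebner_Basis.algebra
    moreover have "A ^ 3 * u ^ 2 = l' - k * l" using l0 by (simp add: k_def)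
    ultimately show ?thesis using K xK M u 2
      by (intro dist0_4_leaf[OF dist0_3'[of A u k]]) simp_all
  next
    case 3
    define k where "k = - l / a ^ 3"
    have k: "k \<in> K" "a ^ 3 * k = - l" using K 3 by (simp_all add: k_def)
    have "S * (a ^ 2 * x) = S * (l - a * a')" using a2xS 3 by (simp add: S_def algebra_simps power2_eq_square)
    then have a2x: "a ^ 2 * x = l - a * a'" using S0 by simp
    have "a * (a' + a * x + a ^ 2 * k) = 0" using a2x k(2) by Groebner_Basis.algebra
    then have b': "a' + a * x + a ^ 2 * k = 0" using 3 by simp
    have "a ^ 3 * l' = l ^ 2" using 3 by (simp add: T_def)
    then have "a ^ 3 * (l' - k * l + a ^ 3 * k ^ 2) = 0 + 3 * l ^ 2" using k(2) by Groebner_Basis.algebra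
    then have "a ^ 3 * (l' - k * l + a ^ 3 * k ^ 2) = 0" by (rule mod3)
    then have k': "l' - k * l + a ^ 3 * k ^ 2 = 0" using 3 by simp
    show ?thesis using K xK k b' k'
      by (intro dist0_4_leaf[OF dist0_3(4)[of "x - a * k" k]]) simp_all
  next
    case 4
    define k where "k = a' / a ^ 2"
    have k: "k \<in> K" "a ^ 2 * k = a'" using K 4 by (simp_all add: k_def)
    have "S * (a ^ 2 * x) = S * (a ^ 2 * (a * k)) + 3 * (- (S * (a * a')))"
      using a2xS 4(2) k(2) S_def by Groebner_Basis.algebra
    then have "S * (a ^ 2 * x) = S * (a ^ 2 * (a * k))" by (rule mod3)
    then have xk: "x = a * k" using S0 4 by simp
    have "a' + a * x + a ^ 2 * k = 0 + 3 * a'" using xk k(2) by Groebner_Basis.algebra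
    then have b': "a' + a * x + a ^ 2 * k = 0" by (rule mod3)
    have "a ^ 3 * k = a * (a ^ 2 * k)" by Groebner_Basis.algebra
    then have a3k: "a ^ 3 * k = S - l" by (simp add: k(2) S_def)
    have "a ^ 3 * l' = l ^ 2 - S ^ 2" using 4(2) by (simp add: T_def algebra_simps)
    then have "a ^ 3 * (l' - k * l + a ^ 3 * k ^ 2) = 0 + 3 * (l ^ 2 - S * l)"
      using a3k by Groebner_Basis.algebra
    then have "a ^ 3 * (l' - k * l + a ^ 3 * k ^ 2) = 0" by (rule mod3)
    then have k': "l' - k * l + a ^ 3 * k ^ 2 = 0" using 4 by simp
    have "l + a ^ 3 * k = S" using a3k by simp
    then show ?thesis using K xK k b' k' xk
      by (intro dist0_4_leaf[OF dist0_3(5)[of S k]]) (simp_all add: S_def)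
  next
    case 5
    \<comment> \<open>The solution of \<open>A / D = T / S\<^sup>2\<close> and \<open>A + D = a\<close>.\<close>
    define A where "A = T * a / (S ^ 2 + T)"
    define D where "D = a * S ^ 2 / (S ^ 2 + T)"
    define u where "u = - S / (A * D ^ 2)"
    define k where "k = - (l + A ^ 3 * u) / a ^ 3"
    have A0: "A \<noteq> 0" "D \<noteq> 0" using 5 S0 by (simp_all add: A_def D_def)
    have M: "A \<in> K" "u \<in> K" "k \<in> K" using K
      by (simp_all add: A_def u_def k_def D_def S_def T_def)
    have aAD: "a = A + D"
    proof -
      have "A + D = (T * a + a * S ^ 2) / (S ^ 2 + T)" by (simp add: A_def D_def add_divide_distrib)
      also have "\<dots> = a" using 5 by (simp add: field_simps)
      finally show ?thesis by simp
    qed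
    have Su: "S = - (u * A * D ^ 2)" using A0 by (simp add: u_def)
    have "A * S ^ 2 = T * D" by (simp add: A_def D_def)
    then have "D * T = D * (A ^ 3 * u ^ 2 * D ^ 3)" using Su by Groebner_Basis.algebra
    then have Tu: "T = A ^ 3 * u ^ 2 * D ^ 3" using A0 by simp
    have ak: "a ^ 3 * k = - l - A ^ 3 * u" using 5 by (simp add: k_def)
    have "S * (a ^ 2 * x) = S * (a ^ 2 * (A * u + a * k)) + 3 * (u ^ 2 * A ^ 3 * D ^ 3 + S * l)"
      using a2xS Su Tu aAD ak by Groebner_Basis.algebra
    then have "S * (a ^ 2 * x) = S * (a ^ 2 * (A * u + a * k))" by (rule mod3)
    then have xu: "x = A * u + a * k" using S0 5 by simp
    have "a * (a' + a * x + a ^ 2 * k) = a * (- (A ^ 2 * u)) + 3 * (u * A ^ 2 * D - l)"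
      using xu Su S_def aAD ak by Groebner_Basis.algebra
    then have "a * (a' + a * x + a ^ 2 * k) = a * (- (A ^ 2 * u))" by (rule mod3)
    then have b': "a' + a * x + a ^ 2 * k = - (A ^ 2 * u)" using 5 mult_left_cancel by blast
    have "a ^ 3 * (l' - k * l + a ^ 3 * k ^ 2) = a ^ 3 * (A ^ 3 * u ^ 2) +
        3 * (l ^ 2 + l * A ^ 3 * u - A ^ 3 * u ^ 2 * (A ^ 2 * D + A * D ^ 2))"
      using Tu T_def aAD ak by Groebner_Basis.algebra
    then have "a ^ 3 * (l' - k * l + a ^ 3 * k ^ 2) = a ^ 3 * (A ^ 3 * u ^ 2)" by (rule mod3)
    then have k': "l' - k * l + a ^ 3 * k ^ 2 = A ^ 3 * u ^ 2"
      using 5 mult_left_cancel[of "a ^ 3"] by simp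
    show ?thesis using K xK M b' k' xu ak
      by (intro dist0_4_leaf[OF dist0_3'[of A u k]]) simp_all
  qed
qed

text \<open>
  For \<open>a a' + l = 0\<close> the near vertex on a line \<open>(a, l, a', l')\<close> is the parent of the line.
\<close>
lemma dist0_4_special:
  assumes "a \<in> K" "l \<in> K" "a' \<in> K" and S: "a * a' + l = 0"
  shows "dist0 4 (True, [a', l, a])"
proof (cases "a = 0")
  case True
  then show ?thesis using dist0_4(2) assms by simp
next
  case False
  have "a' = a ^ 2 * (a' / a ^ 2)" "l = - (a ^ 3 * (a' / a ^ 2))"
    using False S by (simp_all add: field_simps power2_eq_square power3_eq_cube eq_neg_iff_add_eq_0)
  then show ?thesis using dist0_4(6)[of a "a' / a ^ 2"] assms by simp
qed

text \<open>
  Every line carries a point of the hyperplane of vertices not opposite to \<open>0\<close>, so it suffices to find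
  this point. On \<open>(a, l, a', l')\<close> it is given by the two preceding lemmas, and on a leaf
  \<open>(k, b, k', b', k'')\<close> the equation of the hyperplane becomes \<open>a (k' + b b') = b k'' + b'\<^sup>2\<close> for the first
  coordinate \<open>a\<close> of the point. If the coefficient of \<open>a\<close> vanishes, the point is the parent of the leaf.
\<close>
lemma dist0_5:
  assumes "v \<in> part1 (coord_graph K 6 (hexagon_rel :: 'f list \<Rightarrow> _))"
  shows "dist0 5 v"
proof -
  have five: "5 = Suc 4" by simp
  obtain s w where v: "v = (s, w)" by (cases v)
  with assms have w: "set w \<subseteq> K" "length w < 6" "s = even (length w)" by (auto simp: coord_part1)
  have "length w = 0 \<or> length w = 1 \<or> length w = 2 \<or> length w = 3 \<or> length w = 4 \<or> length w = 5"
    using w(2) by linarith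
  moreover then have "s \<longleftrightarrow> length w = 0 \<or> length w = 2 \<or> length w = 4" using w(3) by auto
  ultimately consider "w = []" "s" | x where "w = [x]" "\<not> s" "x \<in> K"
    | l a where "w = [l, a]" "s" "l \<in> K" "a \<in> K"
    | k' b k where "w = [k', b, k]" "\<not> s" "k' \<in> K" "b \<in> K" "k \<in> K"
    | l' a' l a where "w = [l', a', l, a]" "s" "l' \<in> K" "a' \<in> K" "l \<in> K" "a \<in> K"
    | k'' b' k' b k where "w = [k'', b', k', b, k]" "\<not> s" "k'' \<in> K" "b' \<in> K" "k' \<in> K" "b \<in> K" "k \<in> K"
    using w(1) by (auto simp: eval_nat_numeral length_Suc_conv)
  then show ?thesis
  proof cases
    case 1
    then show ?thesis unfolding v five by (intro dist0_step[OF dist0_4(1)]) (simp add: coord_edges)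
  next
    case 2
    then show ?thesis unfolding v five by (intro dist0_step[OF dist0_4(3)[of x]]) (simp_all add: coord_edges)
  next
    case 3
    show ?thesis
    proof (cases "a = 0")
      case True
      then show ?thesis using 3 unfolding v five by (intro dist0_step[OF dist0_4(1)]) (simp add: coord_edges)
    next
      case False
      then have "dist0 4 (True, [- l / a, l, a])" using 3 by (intro dist0_4_special) simp_all
      from dist0_step[OF this] show ?thesis using 3 unfolding v five by (simp add: coord_edges)
    qed
  next
    case 4
    consider "b = 0" | "b \<noteq> 0" "k' = 0" | "b \<noteq> 0" "k' \<noteq> 0" by blast
    then show ?thesis
    proof cases
      case 1
      then show ?thesis using 4 unfolding v five
        by (intro dist0_step[OF dist0_4(3)[of k]]) (simp_all add: coord_edges)
    next
      case 2
      then show ?thesis using 4 unfolding v five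
        by (intro dist0_step[OF dist0_4(5)[of b k]]) (simp_all add: coord_edges)
    next
      case 3
      \<comment> \<open>The parent of a leaf of the third kind: solve \<open>A u = b\<close> and \<open>A\<^sup>3 u\<^sup>2 = k'\<close>.\<close>
      define A where "A = k' / b ^ 2"
      define u where "u = b ^ 3 / k'"
      have "A * u = b" "A ^ 3 * u ^ 2 = k'"
        using 3 by (simp_all add: A_def u_def field_simps power2_eq_square power3_eq_cube)
      then have D: "dist0 4 (False, [- (A ^ 2 * u), k', b, k])" and "A ^ 2 * u \<in> K"
        using dist0_4'(1)[of A u k] 4 by (simp_all add: A_def u_def)
      then show ?thesis using dist0_step[OF D] 4 unfolding v five by (simp add: coord_edges)
    qed
  next
    case 5
    show ?thesis
    proof (cases "a * a' + l = 0")
      case True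
      then have "dist0 4 (True, [a', l, a])" using 5 by (intro dist0_4_special) simp_all
      from dist0_step[OF this] show ?thesis using 5 unfolding v five by (simp add: coord_edges)
    next
      case False
      define x where "x = (a * l' - a' ^ 2) / (a * a' + l)"
      have D: "dist0 4 (True, [x, l', a', l, a])" and "x \<in> K"
        using False 5 by (auto simp: x_def intro!: dist0_4_generic)
      then show ?thesis using dist0_step[OF D] 5 unfolding v five by (simp add: coord_edges)
    qed
  next
    case 6
    show ?thesis
    proof (cases "k' + b * b' = 0")
      case True
      have "dist0 4 (False, [b', k', b, k])"
      proof (cases "b = 0 \<or> b' = 0")
        case bb: True
        then have "k' = 0" using True by auto
        then show ?thesis using bb dist0_4(4)[of b' k] dist0_4(5)[of b k] 6 by auto
      next
        case False
        define A where "A = - b' / b"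
        define u where "u = b / A"
        have A0: "A \<noteq> 0" using False by (simp add: A_def)
        then have u: "A * u = b" by (simp add: u_def)
        have b': "A * b = - b'" using False by (simp add: A_def)
        have "A ^ 2 * u = A * (A * u)" "A ^ 3 * u ^ 2 = A * (A * u) * (A * u)" by Groebner_Basis.algebra+
        then have "A ^ 2 * u = - b'" "A ^ 3 * u ^ 2 = - (b' * b)" unfolding u b' by simp_all
        moreover have "k' = - (b' * b)" using True by (simp add: eq_neg_iff_add_eq_0 mult.commute)
        ultimately have "- (A ^ 2 * u) = b'" "A ^ 3 * u ^ 2 = k'" by simp_all
        then show ?thesis using dist0_4'(1)[of A u k] u 6 by (simp add: A_def u_def)
      qed
      from dist0_step[OF this] show ?thesis using 6 unfolding v five by (simp add: coord_edges)
    next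
      case False
      define a where "a = (b * k'' + b' ^ 2) / (k' + b * b')"
      define a'' where "a'' = b + a * k"
      define l where "l = k'' - a ^ 3 * k"
      define a' where "a' = b' - a * a'' - a ^ 2 * k"
      define l' where "l' = k' + k * l - a ^ 3 * k ^ 2"
      have aD: "a * (k' + b * b') = b * k'' + b' ^ 2" using False by (simp add: a_def)
      have K: "a \<in> K" "a'' \<in> K" "l \<in> K" "a' \<in> K" "l' \<in> K"
        using 6 by (simp_all add: a_def a''_def l_def a'_def l'_def)
      have rel: "hexagon_rel [a'', l', a', l, a] [k'', b', k', b, k]"
        by (simp add: a''_def l_def a'_def l'_def)
      have "a'' * (a * a' + l) = a * l' - a' ^ 2 + 3 * (a ^ 4 * k ^ 2 - a ^ 2 * k * b')
          + (b * k'' + b' ^ 2 - a * (k' + b * b'))"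
        unfolding a'_def l'_def l_def a''_def by Groebner_Basis.algebra
      then have "a'' * (a * a' + l) = a * l' - a' ^ 2 + 3 * (a ^ 4 * k ^ 2 - a ^ 2 * k * b')"
        using aD by simp
      then have eq: "a'' * (a * a' + l) = a * l' - a' ^ 2" by (rule mod3)
      have "dist0 4 (True, [a'', l', a', l, a])"
      proof (cases "a * a' + l = 0")
        case S: True
        show ?thesis
        proof (cases "a = 0")
          case True
          \<comment> \<open>Here \<open>a a' + l = 0\<close> and the equation of the hyperplane force \<open>l = a' = 0\<close>.\<close>
          then show ?thesis using S eq K dist0_4(7)[of l' a''] by simp
        next
          case False
          define m where "m = a' / a ^ 2"
          have m: "a' = a ^ 2 * m" using False by (simp add: m_def)
          have "a * (a ^ 3 * m ^ 2) = a * l'" using m eq S by Groebner_Basis.algebra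
          then have "l' = a ^ 3 * m ^ 2" using False by simp
          moreover have "l = - (a ^ 3 * m)" using m S by Groebner_Basis.algebra
          moreover have "m \<in> K" using K by (simp add: m_def)
          ultimately show ?thesis using dist0_4'(2)[of a m a''] K m by simp
        qed
      next
        case False
        then show ?thesis using K eq by (intro dist0_4_generic) (simp_all add: field_simps)
      qed
      moreover have "((True, [a'', l', a', l, a]), (False, [k'', b', k', b, k])) \<in> E"
        using 6 K rel by (simp del: hexagon_rel_simp add: coord_edges)
      ultimately have "dist0 5 (False, [k'', b', k', b, k])" unfolding five by (rule dist0_step)
      then show ?thesis using 6 v by simp
    qed
  qed
qed

text \<open>
  Five families of automorphisms translate one coordinate of the points each. The translation of
  \<open>a''\<close> moves \<open>a'\<close> by a multiple of \<open>a\<close> as well and is therefore used first, while \<open>a = 0\<close>; the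
  others do not disturb the coordinates already reached.
\<close>
lemma sees_hexagon:
  assumes K: "a \<in> K" "l \<in> K" "a' \<in> K" "l' \<in> K" "a'' \<in> K"
  shows "sees_part1 K 6 hexagon_rel [a'', l', a', l, a]"
proof -
  have 0: "sees_part1 K 6 hexagon_rel [0, 0, 0, 0, 0 :: 'f]"
    unfolding sees_part1_def
  proof
    fix v assume "v \<in> part1 (coord_graph K 6 (hexagon_rel :: 'f list \<Rightarrow> _))"
    from dist0_5[OF this] show "\<exists>k<6. ((True, [0, 0, 0, 0, 0]), v) \<in> E ^^ k"
      unfolding dist0_def by (intro exI[of _ 5]) simp
  qed
  let ?d = "\<lambda>s w. case w of [x] \<Rightarrow> if s then 0 else a'' | [x, y] \<Rightarrow> if s then - (y * a'') else 0
    | [x, y, z, t] \<Rightarrow> if s then a'' else 0 | _ \<Rightarrow> (0 :: 'f)"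
  have "sees_part1 K 6 hexagon_rel (shift (?d True) [0, 0, 0, 0, 0])"
    by (rule sees_part1_shift[OF finK addK _ _ 0])
      (use K in \<open>auto simp: list5 algebra_simps split: list.splits\<close>)
  then have 1: "sees_part1 K 6 hexagon_rel [a'', 0, 0, 0, 0]" by simp
  let ?d = "\<lambda>s w. case w of [x] \<Rightarrow> if s then l else 0 | [x, y] \<Rightarrow> if s then 0 else - (y * l)
    | [x, y, z, t] \<Rightarrow> if s then 0 else l | _ \<Rightarrow> (0 :: 'f)"
  have "sees_part1 K 6 hexagon_rel (shift (?d True) [a'', 0, 0, 0, 0])"
    by (rule sees_part1_shift[OF finK addK _ _ 1])
      (use K in \<open>auto simp: list5 algebra_simps split: list.splits\<close>)
  then have 2: "sees_part1 K 6 hexagon_rel [a'', 0, 0, l, 0]" by simp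
  let ?d = "\<lambda>s w. case w of [x, y] \<Rightarrow> if s then a' else 0
    | [x, y, z] \<Rightarrow> if s then 0 else a' | _ \<Rightarrow> (0 :: 'f)"
  have "sees_part1 K 6 hexagon_rel (shift (?d True) [a'', 0, 0, l, 0])"
    by (rule sees_part1_shift[OF finK addK _ _ 2])
      (use K in \<open>auto simp: list5 algebra_simps split: list.splits\<close>)
  then have 3: "sees_part1 K 6 hexagon_rel [a'', 0, a', l, 0]" by simp
  let ?d = "\<lambda>s w. case w of [x, y] \<Rightarrow> if s then 0 else l'
    | [x, y, z] \<Rightarrow> if s then l' else 0 | _ \<Rightarrow> (0 :: 'f)"
  have "sees_part1 K 6 hexagon_rel (shift (?d True) [a'', 0, a', l, 0])"
    by (rule sees_part1_shift[OF finK addK _ _ 3])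
      (use K in \<open>auto simp: list5 algebra_simps split: list.splits\<close>)
  then have 4: "sees_part1 K 6 hexagon_rel [a'', l', a', l, 0]" by simp
  let ?d = "\<lambda>s w. case w of [] \<Rightarrow> if s then a else 0 | [k] \<Rightarrow> if s then 0 else - (a * k)
    | [x, k] \<Rightarrow> if s then 0 else a ^ 3 * k ^ 2 
    | [x, b, k] \<Rightarrow> if s then 0 else a * b + a ^ 2 * k
    | [x, y, b, k] \<Rightarrow> if s then 0 else a ^ 3 * k | _ \<Rightarrow> (0 :: 'f)"
  have "sees_part1 K 6 hexagon_rel (shift (?d True) [a'', l', a', l, 0])"
  proof (rule sees_part1_shift[OF finK addK _ _ 4])
    fix w u :: "'f list"
    assume w: "length w = 6 - 1" and u: "length u = 6 - 1" and r: "hexagon_rel w u"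
    obtain c m c' m' c'' where w: "w = [c'', m', c', m, c]" using w by (auto simp: list5)
    obtain k b k' b' k'' where u: "u = [k'', b', k', b, k]" using u by (auto simp: list5)
    have eq: "c'' = b + c * k" "b' = c' + c * c'' + c ^ 2 * k" "k' = m' - k * m + c ^ 3 * k ^ 2" "k'' = m + c ^ 3 * k"
      using r by (simp_all add: w u)
    have cube: "(c + a) ^ 3 = c ^ 3 + a ^ 3"
      by (rule mod3[of _ _ "c ^ 2 * a + c * a ^ 2"]) Groebner_Basis.algebra
    have "c' + (c + a) * c'' + (c + a) ^ 2 * k = b' + (a * b + a ^ 2 * k) + 3 * (a * c * k)"
      unfolding eq by Groebner_Basis.algebra
    then have "c' + (c + a) * c'' + (c + a) ^ 2 * k = b' + (a * b + a ^ 2 * k)" by (rule mod3)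
    then have "b' + (a * b + a ^ 2 * k) = c' + (c + a) * c'' + (c + a) ^ 2 * k" ..
    moreover have "c'' = b + - (a * k) + (c + a) * k"
      "k' + a ^ 3 * k ^ 2 = m' - k * m + (c + a) ^ 3 * k ^ 2"
      "k'' + a ^ 3 * k = m + (c + a) ^ 3 * k"
      unfolding cube eq by Groebner_Basis.algebra+
    ultimately show "hexagon_rel (shift (?d True) w) (shift (?d False) u)"
      by (simp add: w u)
  qed (use K in \<open>auto split: list.splits\<close>)
  then show ?thesis by simp
qed

text \<open>
  The twist exchanges the equations for \<open>a''\<close> and \<open>k''\<close>. The equation for \<open>b'\<close>, solved for \<open>a'\<close>, becomes
  the equation for \<open>k'\<close>, and the equation for \<open>k'\<close>, solved for \<open>l'\<close>, becomes the equation for \<open>b'\<close>: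
  in both cases a coefficient \<open>-2\<close> appears, which is \<open>1\<close> in characteristic 3.
\<close>
lemma hexagon_coordinates: "coordinates K 6 hexagon_rel \<theta> \<theta>'"
proof
  show "finite K" "2 \<le> card K" "(3::nat) \<le> 6" by (simp_all add: finK card_K)
  fix w u :: "'f list" and x
  assume w: "length w = 6 - 1" "set w \<subseteq> K"
  then obtain a l a' l' a'' where ab: "w = [a'', l', a', l, a]" "a \<in> K" "l \<in> K" "a' \<in> K" "l' \<in> K" "a'' \<in> K"
    by (auto simp: list5)
  show "\<exists>!u. length u = 6 - 1 \<and> set u \<subseteq> K \<and> last u = x \<and> hexagon_rel w u" if "x \<in> K"
  proof (rule ex1I[of _ "[l + a ^ 3 * x, a' + a * a'' + a ^ 2 * x, l' - x * l + a ^ 3 * x ^ 2, a'' - a * x, x]"])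
    fix u assume u: "length u = 6 - 1 \<and> set u \<subseteq> K \<and> last u = x \<and> hexagon_rel w u"
    then obtain k b k' b' k'' where "u = [k'', b', k', b, k]" by (auto simp: list5)
    then show "u = [l + a ^ 3 * x, a' + a * a'' + a ^ 2 * x, l' - x * l + a ^ 3 * x ^ 2, a'' - a * x, x]"
      using ab u by simp
  qed (use ab that in auto)
  show "\<exists>k<6. ((True, w), v) \<in> E ^^ k" if "v \<in> part1 (coord_graph K 6 hexagon_rel)" for v
    using sees_hexagon[OF ab(2-6)] that ab(1) unfolding sees_part1_def by blast
  assume u: "length u = 6 - 1" "set u \<subseteq> K" "hexagon_rel w u"
  then obtain k b k' b' k'' where kb: "u = [k'', b', k', b, k]" "k \<in> K" by (auto simp: list5)
  have eq: "a'' = b + a * k" "b' = a' + a * a'' + a ^ 2 * k" "k' = l' - k * l + a ^ 3 * k ^ 2" "k'' = l + a ^ 3 * k"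
    using u(3) by (simp_all add: ab kb)
  have th: "\<theta>' (a ^ 3) = \<theta> a" "\<theta>' k ^ 3 = \<theta> k"
    using theta'_power[OF ab(2)] theta'_pow[OF kb(2)] p3 by simp_all
  have sq: "\<theta> (x ^ 2) = \<theta> x ^ 2" "\<theta>' (x ^ 2) = \<theta>' x ^ 2" for x
    by (simp_all add: power2_eq_square)
  have "b' - a * b + a ^ 2 * k = a' + 3 * (a ^ 2 * k)" unfolding eq by Groebner_Basis.algebra
  then have "b' - a * b + a ^ 2 * k = a'" by (rule mod3)
  then have "\<theta> a' = \<theta> (b' - a * b + a ^ 2 * k)" by simp
  then have 1: "\<theta> a' = \<theta> b' - \<theta> a * \<theta> b + \<theta>' k ^ 3 * \<theta> a ^ 2"
    by (simp add: th sq mult.commute)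
  have "k' + k * k'' + k ^ 2 * a ^ 3 = l' + 3 * (a ^ 3 * k ^ 2)" unfolding eq by Groebner_Basis.algebra
  then have "k' + k * k'' + k ^ 2 * a ^ 3 = l'" by (rule mod3)
  then have "\<theta>' l' = \<theta>' (k' + k * k'' + k ^ 2 * a ^ 3)" by simp
  then have 2: "\<theta>' l' = \<theta>' k' + \<theta>' k * \<theta>' k'' + \<theta>' k ^ 2 * \<theta> a"
    by (simp add: th sq)
  have 3: "\<theta>' k'' = \<theta>' l + \<theta>' k * \<theta> a" by (simp add: eq(4) th mult.commute)
  have 4: "\<theta> a'' = \<theta> b + \<theta>' k ^ 3 * \<theta> a" by (simp add: eq(1) th mult.commute)
  show "hexagon_rel (twist \<theta> \<theta>' False u) (twist \<theta> \<theta>' True w)"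
    using 1 2 3 4 by (simp add: ab(1) kb(1))
qed simp_all

end

section \<open>Finite fields as fixed points of the Frobenius map\<close>

text \<open>
  The polynomial \<open>X\<^sup>q - X\<close> has derivative \<open>-1\<close>, so it has \<open>q\<close> distinct roots in an algebraically closed
  field.
\<close>
lemma frobenius_fixed_card:
  fixes K :: "'f :: alg_closed_field set"
  assumes p: "prime CHAR('f)" and m: "1 \<le> m"
    and K: "K = {x. x ^ (CHAR('f) ^ m) = x}"
  shows "finite K" "card K = CHAR('f) ^ m"
proof -
  define q where "q = CHAR('f) ^ m"
  define P :: "'f poly" where "P = monom 1 q - monom 1 1"
  have "CHAR('f) > 1" using p prime_gt_1_nat by blast
  then have q: "q > 1" using m unfolding q_def by (intro one_less_power) auto
  have "of_nat q = (0 :: 'f)" using m by (simp add: q_def zero_power)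
  then have der: "pderiv P = - 1"
    by (simp add: P_def pderiv_diff pderiv_monom one_poly_eq_simps)
  have degP: "Polynomial.degree P = q"
  proof -
    have "Polynomial.degree (- monom (1 :: 'f) 1) < Polynomial.degree (monom (1 :: 'f) q)"
      using q by (simp add: degree_monom_eq)
    from degree_add_eq_left[OF this] show ?thesis by (simp add: P_def degree_monom_eq)
  qed
  have P0: "P \<noteq> 0" using degP q by auto
  obtain A where A: "size A = q" "P = smult (lead_coeff P) (\<Prod>x\<in>#A. [:- x, 1:])"
    using alg_closed_imp_factorization[OF P0] degP by auto
  have lc: "lead_coeff P \<noteq> 0" using P0 by simp
  have root: "poly P x = 0 \<longleftrightarrow> x \<in># A" for x
  proof -
    have "poly P x = lead_coeff P * (\<Prod>a\<in>#A. x - a)"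
      by (subst A(2)) (simp add: poly_prod_mset image_mset.compositionality o_def)
    then show ?thesis using lc by (auto simp: prod_mset_zero_iff)
  qed
  have simple: "count A x = 1" if x: "x \<in># A" for x
  proof (rule ccontr)
    assume "count A x \<noteq> 1"
    moreover have "count A x > 0" using x by simp
    ultimately have "count A x \<ge> 2" by linarith
    then have "{#x, x#} \<subseteq># A" by (intro mset_subset_eqI) auto
    then obtain B where B: "A = {#x, x#} + B" unfolding mset_subset_eq_exists_conv by blast
    define L where "L = [:- x, 1:]"
    define Q where "Q = smult (lead_coeff P) (\<Prod>x\<in>#B. [:- x, 1:])"
    have "P = L * (L * Q)" by (subst A(2)) (simp add: B L_def Q_def)
    then have "pderiv P = L * pderiv (L * Q) + L * Q * pderiv L" by (simp add: pderiv_mult)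
    moreover have "poly L x = 0" by (simp add: L_def)
    ultimately have "poly (pderiv P) x = 0" by simp
    then show False using der by simp
  qed
  have KA: "K = set_mset A"
  proof -
    have "poly P x = x ^ q - x" for x by (simp add: P_def poly_monom)
    then show ?thesis using root by (auto simp: K q_def)
  qed
  then show "finite K" by simp
  have "size A = (\<Sum>x\<in>set_mset A. count A x)" by (simp add: size_multiset_overloaded_eq)
  also have "\<dots> = card K" using simple KA by simp
  finally show "card K = CHAR('f) ^ m" using A(1) q_def by simp
qed

lemma frobenius_add:
  fixes x y :: "'f :: field"
  assumes "prime CHAR('f)"
  shows "(x + y) ^ (CHAR('f) ^ k) = x ^ (CHAR('f) ^ k) + y ^ (CHAR('f) ^ k)"
  using freshmans_dream'[OF assms refl] .

lemma frobenius_fixed_subfield: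
  fixes K :: "'f :: field set"
  assumes p: "prime CHAR('f)" and K: "K = {x. x ^ (CHAR('f) ^ m) = x}"
  shows "0 \<in> K" "1 \<in> K" "x \<in> K \<Longrightarrow> y \<in> K \<Longrightarrow> x + y \<in> K" "x \<in> K \<Longrightarrow> - x \<in> K"
    "x \<in> K \<Longrightarrow> y \<in> K \<Longrightarrow> x * y \<in> K" "x \<in> K \<Longrightarrow> inverse x \<in> K" "x \<in> K \<Longrightarrow> x ^ k \<in> K"
proof -
  have pos: "CHAR('f) ^ m > 0" using prime_gt_0_nat[OF p] by simp
  show z: "0 \<in> K" using pos by (simp add: K)
  show "1 \<in> K" by (simp add: K)
  show "x \<in> K \<Longrightarrow> y \<in> K \<Longrightarrow> x + y \<in> K" using frobenius_add[OF p] by (simp add: K)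
  show "- x \<in> K" if "x \<in> K"
  proof -
    have "(- x) ^ (CHAR('f) ^ m) + x ^ (CHAR('f) ^ m) = (- x + x) ^ (CHAR('f) ^ m)"
      by (rule frobenius_add[OF p, symmetric])
    also have "\<dots> = 0" by (simp only: left_minus zero_power[OF pos])
    finally have "(- x) ^ (CHAR('f) ^ m) = - (x ^ (CHAR('f) ^ m))" by (simp only: eq_neg_iff_add_eq_0)
    then show ?thesis using that by (simp add: K)
  qed
  show "x \<in> K \<Longrightarrow> y \<in> K \<Longrightarrow> x * y \<in> K" by (simp add: K power_mult_distrib)
  show "x \<in> K \<Longrightarrow> inverse x \<in> K" by (simp add: K power_inverse)
  show "x \<in> K \<Longrightarrow> x ^ k \<in> K" by (simp add: K flip: power_mult) (metis mult.commute power_mult)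
qed

lemma polarity_field_identity:
  fixes K :: "'f :: alg_closed_field set"
  assumes p: "prime CHAR('f)" and m: "1 \<le> m" and K: "K = {x. x ^ (CHAR('f) ^ m) = x}"
  shows "polarity_field K 1 (\<lambda>x. x) (\<lambda>x. x)"
  using frobenius_fixed_card[OF p m K] frobenius_fixed_subfield[OF p K]
  by unfold_locales auto

text \<open>
  On \<open>GF(p\<^sup>2\<^sup>e\<^sup>+\<^sup>1)\<close> the map \<open>x \<mapsto> x ^ p ^ (e + 1)\<close> squares to \<open>x \<mapsto> x ^ p ^ (2e + 2) = x ^ p\<close>, and
  \<open>x \<mapsto> x ^ p ^ e\<close> is its inverse.
\<close>
lemma polarity_field_tits:
  fixes K :: "'f :: alg_closed_field set"
  assumes p: "prime CHAR('f)" and K: "K = {x. x ^ (CHAR('f) ^ (2 * e + 1)) = x}"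
  shows "polarity_field K CHAR('f) (\<lambda>x. x ^ (CHAR('f) ^ (e + 1))) (\<lambda>x. x ^ (CHAR('f) ^ e))"
proof -
  let ?p = "CHAR('f)"
  have comp: "?p ^ e * ?p ^ (e + 1) = ?p ^ (2 * e + 1)"
    unfolding power_add[symmetric] by (simp add: mult_2)
  have inv: "(x ^ (?p ^ e)) ^ (?p ^ (e + 1)) = x" "(x ^ (?p ^ (e + 1))) ^ (?p ^ e) = x" if "x \<in> K" for x
    using that comp unfolding power_mult[symmetric] mult.commute[of "?p ^ (e + 1)"]
    by (simp_all only: K mem_Collect_eq)
  have tt: "(x ^ (?p ^ (e + 1))) ^ (?p ^ (e + 1)) = x ^ ?p" if "x \<in> K" for x
  proof -
    have "(x ^ (?p ^ (e + 1))) ^ (?p ^ (e + 1)) = ((x ^ (?p ^ (e + 1))) ^ (?p ^ e)) ^ ?p"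
      by (simp only: power_add power_one_right power_mult)
    then show ?thesis using inv(2)[OF that] by simp
  qed
  show ?thesis
    using frobenius_fixed_card(1)[OF p _ K] frobenius_fixed_subfield[OF p K]
      frobenius_add[OF p, of _ _ e] frobenius_add[OF p, of _ _ "Suc e"] inv tt
    by unfold_locales (simp_all add: power_mult_distrib)
qed

text \<open>
  The algebraic closures of the fields with two and three elements provide the ambient fields.
\<close>
lemma CHAR_finite_2: "CHAR(Enum.finite_2) = 2"
proof -
  have "of_nat (Suc (Suc 0)) = (0 :: Enum.finite_2)" by (simp add: plus_finite_2_def)
  then have "CHAR(Enum.finite_2) dvd 2"
    unfolding of_nat_eq_0_iff_char_dvd by (simp add: numeral_2_eq_2)
  moreover have "prime (2 :: nat)" by simp
  moreover have "CHAR(Enum.finite_2) \<noteq> 1" by simp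
  ultimately show ?thesis by (auto simp: prime_nat_iff)
qed

lemma CHAR_finite_3: "CHAR(Enum.finite_3) = 3"
proof -
  have "of_nat (Suc (Suc (Suc 0))) = (0 :: Enum.finite_3)" by (simp add: plus_finite_3_def)
  then have "CHAR(Enum.finite_3) dvd 3"
    unfolding of_nat_eq_0_iff_char_dvd by (simp add: numeral_3_eq_3)
  moreover have "prime (3 :: nat)" by simp
  moreover have "CHAR(Enum.finite_3) \<noteq> 1" by simp
  ultimately show ?thesis by (auto simp: prime_nat_iff)
qed

section \<open>Infinitely many self-polar polygons\<close>

lemma infinite_range_odd_powers:
  assumes "2 \<le> (p :: nat)" "\<And>e. P (p ^ (2 * e + 1))" shows "infinite {q. P q}"
proof -
  have "inj (\<lambda>e. p ^ (2 * e + 1))" using assms(1) by (intro injI) (simp add: power_inject_exp)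
  then have "infinite (range (\<lambda>e. p ^ (2 * e + 1)))" by (rule range_inj_infinite)
  moreover have "range (\<lambda>e. p ^ (2 * e + 1)) \<subseteq> {q. P q}" using assms(2) by auto
  ultimately show ?thesis by (rule infinite_super[rotated])
qed

lemma infinite_admissible:
  assumes inf: "infinite (UNIV :: 'a set)" and n: "n \<in> {3, 4, 6}"
  shows "infinite {q. admissible TYPE('a) n q}"
proof -
  have p2: "prime CHAR(Enum.finite_2 alg_closure)" "CHAR(Enum.finite_2 alg_closure) = 2"
    and p3: "prime CHAR(Enum.finite_3 alg_closure)" "CHAR(Enum.finite_3 alg_closure) = 3"
    by (simp_all add: CHAR_finite_2 CHAR_finite_3)
  define F2 :: "nat \<Rightarrow> Enum.finite_2 alg_closure set" where
    "F2 e = {x. x ^ (CHAR(Enum.finite_2 alg_closure) ^ (2 * e + 1)) = x}" for e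
  define F3 :: "nat \<Rightarrow> Enum.finite_3 alg_closure set" where
    "F3 e = {x. x ^ (CHAR(Enum.finite_3 alg_closure) ^ (2 * e + 1)) = x}" for e
  have card_F2: "card (F2 e) = 2 ^ (2 * e + 1)" for e
    using frobenius_fixed_card(2)[OF p2(1) _ F2_def] p2(2) by simp
  have card_F3: "card (F3 e) = 3 ^ (2 * e + 1)" for e
    using frobenius_fixed_card(2)[OF p3(1) _ F3_def] p3(2) by simp
  consider "n = 3" | "n = 4" | "n = 6" using n by auto
  then show ?thesis
  proof cases
    case 1
    have "admissible TYPE('a) n (card (F2 e))" for e
    proof -
      interpret polarity_field "F2 e" 1 "\<lambda>x. x" "\<lambda>x. x"
        by (rule polarity_field_identity[OF p2(1) _ F2_def]) simp
      show ?thesis unfolding 1 by (rule coordinates.admissible[OF plane_coordinates inf]) simp_all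
    qed
    then show ?thesis unfolding card_F2 by (intro infinite_range_odd_powers[of 2]) simp_all
  next
    case 2
    have "admissible TYPE('a) n (card (F2 e))" for e
    proof -
      interpret polarity_field "F2 e" "CHAR(Enum.finite_2 alg_closure)"
          "\<lambda>x. x ^ (CHAR(Enum.finite_2 alg_closure) ^ (e + 1))" "\<lambda>x. x ^ (CHAR(Enum.finite_2 alg_closure) ^ e)"
        by (rule polarity_field_tits[OF p2(1) F2_def])
      have "(2 :: Enum.finite_2 alg_closure) = 0"
        using of_nat_CHAR[where 'a = "Enum.finite_2 alg_closure"] unfolding p2(2) by simp
      then show ?thesis unfolding 2 by (intro coordinates.admissible[OF quadrangle_coordinates inf] p2(2))
    qed
    then show ?thesis unfolding card_F2 by (intro infinite_range_odd_powers[of 2]) simp_all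
  next
    case 3
    have "admissible TYPE('a) n (card (F3 e))" for e
    proof -
      have "(3 :: Enum.finite_3 alg_closure) = 0"
        using of_nat_CHAR[where 'a = "Enum.finite_3 alg_closure"] unfolding p3(2) by simp
      then have "hexagon_field (F3 e) (CHAR(Enum.finite_3 alg_closure))
          (\<lambda>x. x ^ (CHAR(Enum.finite_3 alg_closure) ^ (e + 1))) (\<lambda>x. x ^ (CHAR(Enum.finite_3 alg_closure) ^ e))"
        unfolding hexagon_field_def hexagon_field_axioms_def
        using polarity_field_tits[OF p3(1) F3_def] p3(2) by blast
      from coordinates.admissible[OF hexagon_field.hexagon_coordinates[OF this] inf]
      show ?thesis unfolding 3 .
    qed
    then show ?thesis unfolding card_F3 by (intro infinite_range_odd_powers[of 3]) simp_all
  qed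
qed

section \<open>Comparison with the Moore bound\<close>

lemma filterlim_fst_prod: "filterlim fst F (F \<times>\<^sub>F G)"
  unfolding filterlim_iff eventually_prod_filter
  by (intro allI impI, rule_tac x = P in exI, rule_tac x = "\<lambda>_. True" in exI) simp

lemma filterlim_snd_prod: "filterlim snd G (F \<times>\<^sub>F G)"
  unfolding filterlim_iff eventually_prod_filter
  by (intro allI impI, rule_tac x = "\<lambda>_. True" in exI, rule_tac x = P in exI) simp

text \<open>
  With \<open>D = n - 1\<close> and \<open>\<Delta> = (q + 1) (r + 1)\<close> the ratio is the product of
  \<open>(1 + \<dots> + q\<^sup>D) / (q + 1)\<^sup>D\<close>, the same expression in \<open>r\<close>, and \<open>\<Delta>\<^sup>D\<close> divided by the Moore bound; each
  factor is a function of one variable with limit 1.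
\<close>
lemma moore_ratio_tendsto:
  assumes "n \<in> {3, 4, 6}"
  shows "((\<lambda>(q, r). real ((\<Sum>i<n. q ^ i) * (\<Sum>i<n. r ^ i)) / real (moore_bound ((q + 1) * (r + 1)) (n - 1)))
    \<longlongrightarrow> 1) (sequentially \<times>\<^sub>F sequentially)"
proof -
  define D where "D = n - 1"
  define g where "g q = (\<Sum>i<n. real q ^ i) / (real q + 1) ^ D" for q
  define h where "h x = x ^ D / (1 + x * (\<Sum>i<D. (x - 1) ^ i))" for x :: real
  have g: "g \<longlonglongrightarrow> 1"
    using assms unfolding g_def D_def by (elim insertE emptyE; simp add: eval_nat_numeral; real_asymp)
  have h: "(h \<longlongrightarrow> 1) at_top"
    using assms unfolding h_def D_def by (elim insertE emptyE; simp add: eval_nat_numeral; real_asymp)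
  let ?F = "sequentially \<times>\<^sub>F sequentially"
  let ?\<Delta> = "\<lambda>x. (real (fst x) + 1) * (real (snd x) + 1)"
  have "filterlim (\<lambda>x. real (fst x) + 1) at_top ?F" "filterlim (\<lambda>x. real (snd x) + 1) at_top ?F"
    by (rule filterlim_compose[of "\<lambda>q. real q + 1" _ sequentially], real_asymp,
        rule filterlim_fst_prod filterlim_snd_prod)+
  then have "filterlim ?\<Delta> at_top ?F" by (rule filterlim_at_top_mult_at_top)
  then have "((\<lambda>x. h (?\<Delta> x)) \<longlongrightarrow> 1) ?F" by (rule filterlim_compose[OF h])
  moreover have "((\<lambda>x. g (fst x)) \<longlongrightarrow> 1) ?F" "((\<lambda>x. g (snd x)) \<longlongrightarrow> 1) ?F"
    by (rule filterlim_compose[OF g], rule filterlim_fst_prod filterlim_snd_prod)+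
  ultimately have "((\<lambda>x. g (fst x) * g (snd x) * h (?\<Delta> x)) \<longlongrightarrow> 1 * 1 * 1) ?F"
    by (intro tendsto_mult)
  moreover have "(\<lambda>x. g (fst x) * g (snd x) * h (?\<Delta> x)) = (\<lambda>(q, r).
      real ((\<Sum>i<n. q ^ i) * (\<Sum>i<n. r ^ i)) / real (moore_bound ((q + 1) * (r + 1)) (n - 1)))"
  proof
    fix x :: "nat \<times> nat"
    obtain q r where x: "x = (q, r)" by (cases x)
    have \<Delta>: "real ((q + 1) * (r + 1)) = (real q + 1) * (real r + 1)" by (simp add: algebra_simps)
    have "real ((q + 1) * (r + 1) - 1) = (real q + 1) * (real r + 1) - 1"
      by (subst of_nat_diff) (simp_all add: algebra_simps)
    then have "real (moore_bound ((q + 1) * (r + 1)) D) =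
        1 + (real q + 1) * (real r + 1) * (\<Sum>i<D. ((real q + 1) * (real r + 1) - 1) ^ i)"
      unfolding moore_bound_def of_nat_add of_nat_mult of_nat_sum of_nat_power
      using \<Delta> by simp
    moreover have "(real q + 1) ^ D * (real r + 1) ^ D = ((real q + 1) * (real r + 1)) ^ D"
      by (simp add: power_mult_distrib)
    moreover have "((real q + 1) * (real r + 1)) ^ D \<noteq> 0"
      by (simp add: add_eq_0_iff)
    ultimately show "g (fst x) * g (snd x) * h (?\<Delta> x) = (case x of (q, r) \<Rightarrow>
      real ((\<Sum>i<n. q ^ i) * (\<Sum>i<n. r ^ i)) / real (moore_bound ((q + 1) * (r + 1)) (n - 1)))"
      by (simp add: x g_def h_def D_def)
  qed
  ultimately show ?thesis by simp
qed

section \<open>The family of composed quotients\<close>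

lemma graphs_from_nonempty:
  assumes "admissible TYPE('a) n q" "admissible TYPE('a) n r"
  shows "(graphs_from n q r :: 'a quotient_graph set) \<noteq> {}"
proof -
  obtain \<Gamma> \<rho> where 1: "(\<Gamma>, \<rho>) \<in> (polarized_polygons n q :: (('a, 'a) geometry \<times> _) set)"
    using assms(1) unfolding admissible_def by blast
  obtain \<Gamma>' \<rho>' where 2: "(\<Gamma>', \<rho>') \<in> (polarized_polygons n r :: (('a, 'a) geometry \<times> _) set)"
    using assms(2) unfolding admissible_def by blast
  have "delete_loops (polarity_quotient (incidence_graph \<Gamma> \<odot> incidence_graph \<Gamma>')
      (composed_polarity \<rho> \<rho>')) \<in> graphs_from n q r"
    unfolding graphs_from_def using 1 2 by blast
  then show ?thesis by blast
qed

theorem corollary6p11: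
  fixes n :: nat
  assumes "infinite (UNIV :: 'a set)"
    and "n \<in> {3, 4, 6}"
  shows
    "(\<exists>S \<subseteq> (quotient_family n :: 'a quotient_graph set).
        infinite S \<and> pairwise (\<lambda>G H. \<not> isomorphic G H) S) \<and>
     (\<forall>G \<in> (quotient_family n :: 'a quotient_graph set). diameter G = enat (n - 1)) \<and>
     (\<forall>q r. admissible TYPE('a) n q \<and> admissible TYPE('a) n r \<longrightarrow>
        (graphs_from n q r :: 'a quotient_graph set) \<noteq> {} \<and>
        (\<forall>G \<in> (graphs_from n q r :: 'a quotient_graph set). degree G = (q + 1) * (r + 1))) \<and>
     infinite {q. admissible TYPE('a) n q} \<and>
     (\<forall>G :: nat \<Rightarrow> nat \<Rightarrow> 'a quotient_graph.
        (\<forall>q r. admissible TYPE('a) n q \<and> admissible TYPE('a) n r \<longrightarrow> G q r \<in> graphs_from n q r) \<longrightarrow>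
        ((\<lambda>(q, r). real (order (G q r)) / real (moore_bound ((q + 1) * (r + 1)) (n - 1)))
           \<longlongrightarrow> 1)
          (inf (sequentially \<times>\<^sub>F sequentially)
             (principal {(q, r). admissible TYPE('a) n q \<and> admissible TYPE('a) n r})))"
proof (intro conjI allI impI ballI)
  let ?A = "{q. admissible TYPE('a) n q}"
  have n3: "3 \<le> n" using assms(2) by auto
  show infA: "infinite ?A" by (rule infinite_admissible[OF assms])
  show "\<exists>S \<subseteq> (quotient_family n :: 'a quotient_graph set).
      infinite S \<and> pairwise (\<lambda>G H. \<not> isomorphic G H) S"
  proof -
    define g where "g q = (SOME G. G \<in> (graphs_from n q q :: 'a quotient_graph set))" for q
    have g: "g q \<in> graphs_from n q q" if "q \<in> ?A" for q
    proof -
      have "\<exists>G. G \<in> (graphs_from n q q :: 'a quotient_graph set)"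
        using graphs_from_nonempty[of n q q] that by blast
      then show ?thesis unfolding g_def by (rule someI_ex)
    qed
    have deg: "degree (g q) = (q + 1) * (q + 1)" if "q \<in> ?A" for q
      using graphs_from_properties(2)[OF g[OF that] n3] .
    \<comment> \<open>The diagonal members \<open>q = r\<close> are told apart by their degrees.\<close>
    have inj: "q = r" if "q \<in> ?A" "r \<in> ?A" "degree (g q) = degree (g r)" for q r
    proof -
      have "(q + 1) ^ 2 = (r + 1) ^ 2" using that deg by (simp add: power2_eq_square)
      then have "q + 1 = r + 1" by (rule power2_eq_imp_eq) simp_all
      then show ?thesis by simp
    qed
    have "g ` ?A \<subseteq> quotient_family n" using g by (auto simp: quotient_family_def)
    moreover have "infinite (g ` ?A)"
      using infA inj by (subst finite_image_iff) (auto intro!: inj_onI)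
    moreover have "pairwise (\<lambda>G H. \<not> isomorphic G H) (g ` ?A)"
      unfolding pairwise_def using inj graph_iso_degree unfolding isomorphic_def by blast
    ultimately show ?thesis by blast
  qed
  show "diameter G = enat (n - 1)" if "G \<in> quotient_family n" for G :: "'a quotient_graph"
    using that graphs_from_properties(1)[OF _ n3] unfolding quotient_family_def by blast
  fix q r
  show "(graphs_from n q r :: 'a quotient_graph set) \<noteq> {}"
    if "admissible TYPE('a) n q \<and> admissible TYPE('a) n r"
    using that graphs_from_nonempty by blast
  show "degree G = (q + 1) * (r + 1)" if "G \<in> graphs_from n q r" for G :: "'a quotient_graph"
    using graphs_from_properties(2)[OF that n3] .
next
  fix G :: "nat \<Rightarrow> nat \<Rightarrow> 'a quotient_graph"
  assume G: "\<forall>q r. admissible TYPE('a) n q \<and> admissible TYPE('a) n r \<longrightarrow> G q r \<in> graphs_from n q r"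
  let ?A = "{(q, r). admissible TYPE('a) n q \<and> admissible TYPE('a) n r}"
  let ?F = "inf (sequentially \<times>\<^sub>F sequentially) (principal ?A)"
  have n3: "3 \<le> n" using assms(2) by auto
  have "eventually (\<lambda>x. x \<in> ?A) ?F" by (simp add: eventually_inf_principal)
  then have ev: "eventually (\<lambda>x. (\<lambda>(q, r). real ((\<Sum>i<n. q ^ i) * (\<Sum>i<n. r ^ i)) /
        real (moore_bound ((q + 1) * (r + 1)) (n - 1))) x =
      (\<lambda>(q, r). real (order (G q r)) / real (moore_bound ((q + 1) * (r + 1)) (n - 1))) x) ?F"
  proof (rule eventually_mono)
    fix x assume "x \<in> ?A"
    then obtain q r where x: "x = (q, r)" "G q r \<in> graphs_from n q r" using G by blast
    show "(\<lambda>(q, r). real ((\<Sum>i<n. q ^ i) * (\<Sum>i<n. r ^ i)) /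
        real (moore_bound ((q + 1) * (r + 1)) (n - 1))) x =
      (\<lambda>(q, r). real (order (G q r)) / real (moore_bound ((q + 1) * (r + 1)) (n - 1))) x"
      unfolding x(1) using graphs_from_properties(3)[OF x(2) n3] by simp
  qed
  show "((\<lambda>(q, r). real (order (G q r)) / real (moore_bound ((q + 1) * (r + 1)) (n - 1)))
      \<longlongrightarrow> 1) ?F"
    by (rule tendsto_cong[THEN iffD1, OF ev],
        rule tendsto_mono[OF inf_le1 moore_ratio_tendsto[OF assms(2)]])
qed

end
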